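(* Let $T$ be a countable complete first-order theory with monster model $\bar M$ and let $A\subset\bar M$ be countable. Let $\{\mathfrak p_i\mid i\in I\}$ be a countable family of pairwise orthogonal, generically stable global types, each of which is regular over $A$. Assume also that each $\mathfrak p_i\upharpoonright A$ is non-isolated. Then for any function $f:I\to\omega$ there exists a countable elementary submodel $M_f\supseteq A$ of $\bar M$ such that $\dim_{\mathfrak p_i}(M_f/A)=f(i)$ for all $i\in I$.
   Context: $T$ is a complete first-order theory with monster model $\bar M$; "small" means of cardinality less than the saturation of $\bar M$. A global type is a complete type over $\bar M$; $\mathfrak p\upharpoonright A$ is the restriction of $\mathfrak p$ to $A$. For small $A$, $\mathfrak p(x)$ is $A$-invariant if for all $\bar b_1\equiv\bar b_2\,(A)$ and all formulas $\phi(x;\bar y)$ over $A$: $\phi(x,\bar b_1)\in\mathfrak p$ iff $\phi(x,\bar b_2)\in\mathfrak p$. Morley sequence: $(a_i\mid i<\alpha)$ is a Morley sequence in $\mathfrak p$ over $A$ if $a_i\models\mathfrak p\upharpoonright Aa_{<i}$ for all $i<\alpha$. Generic stability: a non-algebraic global type $\mathfrak p$ is generically stable if for some small $A$ it is $A$-invariant and, for every infinite $\alpha$ and every Morley sequence $(a_i\mid i<\alpha)$ in $\mathfrak p$ over $A$, for every formula $\phi(x)$ with parameters from $\bar M$ the set $\{i\mid\ \models\phi(a_i)\}$ is finite or co-finite. Regularity: a non-algebraic global type $\mathfrak p(x)$ in a single variable (possibly of a sort of $\bar M^{eq}$) is regular over a small set $A$ if it is $A$-invariant and for every small $B\supseteq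 A$ and every $a\models\mathfrak p\upharpoonright A$: either $a\models\mathfrak p\upharpoonright B$ or $\mathfrak p\upharpoonright B\vdash\mathfrak p\upharpoonright Ba$. Orthogonality: global types $\mathfrak p,\mathfrak q$ are orthogonal if $\mathfrak p(x)\cup\mathfrak q(y)$ (disjoint variables) determines a complete type over $\bar M$. Dimension: generically stable types are symmetric (Morley sequences are totally indiscernible), and for a symmetric type $\mathfrak p$ that is regular over $A$ the operation $X\mapsto\{b\models\mathfrak p\upharpoonright A\mid b\not\models\mathfrak p\upharpoonright AX\}$ is a pregeometry on the realizations of $\mathfrak p\upharpoonright A$. Hence for $M\supseteq A$ all maximal Morley sequences in $\mathfrak p$ over $A$ consisting of elements of $M$ have the same cardinality; $\dim_{\mathfrak p}(M/A)$ denotes this cardinality. *)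

theory Defs
  imports "HOL-Library.Countable_Set"
begin

unbundle cardinal_syntax

section \<open>Many-sorted first-order logic\<close>

text \<open>
  Logic is many-sorted because \<open>M\<^sup>e\<^sup>q\<close> is; one-sorted logic is the case of one sort. A variable is
  a pair of an index and its sort. The terms of \<open>L(M)\<close> have parameters \<open>Par a\<close> naming elements.
\<close>

record ('f, 'r, 's) language =
  sorts :: "'s set"
  funs :: "'f set"
  fdom :: "'f \<Rightarrow> 's list"
  fcod :: "'f \<Rightarrow> 's"
  rels :: "'r set"
  rdom :: "'r \<Rightarrow> 's list"

definition is_language :: "('f, 'r, 's) language \<Rightarrow> bool" where
  "is_language L \<longleftrightarrow>
     (\<forall>f\<in>funs L. set (fdom L f) \<subseteq> sorts L \<and> fcod L f \<in> sorts L) \<and>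
     (\<forall>r\<in>rels L. set (rdom L r) \<subseteq> sorts L)"

definition countable_language :: "('f, 'r, 's) language \<Rightarrow> bool" where
  "countable_language L \<longleftrightarrow> countable (sorts L) \<and> countable (funs L) \<and> countable (rels L)"

record ('f, 'r, 's, 'a) struct =
  univ :: "'a set"
  srt :: "'a \<Rightarrow> 's"
  fint :: "'f \<Rightarrow> 'a list \<Rightarrow> 'a"
  rint :: "'r \<Rightarrow> 'a list \<Rightarrow> bool"

definition tuples :: "('f, 'r, 's, 'a) struct \<Rightarrow> 's list \<Rightarrow> 'a list set" where
  "tuples M ss = {as. set as \<subseteq> univ M \<and> map (srt M) as = ss}"

definition is_structure :: "('f, 'r, 's) language \<Rightarrow> ('f, 'r, 's, 'a) struct \<Rightarrow> bool" where
  "is_structure L M \<longleftrightarrow> srt M ` univ M \<subseteq> sorts L \<and>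
     (\<forall>f\<in>funs L. \<forall>as\<in>tuples M (fdom L f).
        fint M f as \<in> univ M \<and> srt M (fint M f as) = fcod L f)"

datatype (dead 'f, tvars: 'v, tpars: 'c) tm =
    Var 'v
  | Par 'c
  | Fn 'f "('f, 'v, 'c) tm list"
  for map: map_tm

datatype (dead 'f, dead 'r, fvars: 'v, pars: 'c) fm =
    Eq "('f, 'v, 'c) tm" "('f, 'v, 'c) tm"
  | Rel 'r "('f, 'v, 'c) tm list"
  | Neg "('f, 'r, 'v, 'c) fm"
  | Conj "('f, 'r, 'v, 'c) fm" "('f, 'r, 'v, 'c) fm"
  | Ex 'v "('f, 'r, 'v, 'c) fm"
  for map: map_fm

type_synonym ('f, 'r, 's, 'a) formula = "('f, 'r, nat \<times> 's, 'a) fm"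

fun tm_srt :: "('f, 'r, 's) language \<Rightarrow> ('a \<Rightarrow> 's) \<Rightarrow> ('f, nat \<times> 's, 'a) tm \<Rightarrow> 's" where
  "tm_srt L \<sigma> (Var v) = snd v"
| "tm_srt L \<sigma> (Par a) = \<sigma> a"
| "tm_srt L \<sigma> (Fn f ts) = fcod L f"

fun wf_tm :: "('f, 'r, 's) language \<Rightarrow> ('a \<Rightarrow> 's) \<Rightarrow> ('f, nat \<times> 's, 'a) tm \<Rightarrow> bool" where
  "wf_tm L \<sigma> (Var v) \<longleftrightarrow> snd v \<in> sorts L"
| "wf_tm L \<sigma> (Par a) \<longleftrightarrow> \<sigma> a \<in> sorts L"
| "wf_tm L \<sigma> (Fn f ts) \<longleftrightarrow>
     f \<in> funs L \<and> map (tm_srt L \<sigma>) ts = fdom L f \<and> (\<forall>t\<in>set ts. wf_tm L \<sigma> t)"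

fun wf_fm :: "('f, 'r, 's) language \<Rightarrow> ('a \<Rightarrow> 's) \<Rightarrow> ('f, 'r, 's, 'a) formula \<Rightarrow> bool" where
  "wf_fm L \<sigma> (Eq t u) \<longleftrightarrow> wf_tm L \<sigma> t \<and> wf_tm L \<sigma> u \<and> tm_srt L \<sigma> t = tm_srt L \<sigma> u"
| "wf_fm L \<sigma> (Rel r ts) \<longleftrightarrow>
     r \<in> rels L \<and> map (tm_srt L \<sigma>) ts = rdom L r \<and> (\<forall>t\<in>set ts. wf_tm L \<sigma> t)"
| "wf_fm L \<sigma> (Neg \<phi>) \<longleftrightarrow> wf_fm L \<sigma> \<phi>"
| "wf_fm L \<sigma> (Conj \<phi> \<psi>) \<longleftrightarrow> wf_fm L \<sigma> \<phi> \<and> wf_fm L \<sigma> \<psi>"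
| "wf_fm L \<sigma> (Ex v \<phi>) \<longleftrightarrow> snd v \<in> sorts L \<and> wf_fm L \<sigma> \<phi>"

fun fv :: "('f, 'r, 'v, 'c) fm \<Rightarrow> 'v set" where
  "fv (Eq t u) = tvars t \<union> tvars u"
| "fv (Rel r ts) = \<Union> (tvars ` set ts)"
| "fv (Neg \<phi>) = fv \<phi>"
| "fv (Conj \<phi> \<psi>) = fv \<phi> \<union> fv \<psi>"
| "fv (Ex v \<phi>) = fv \<phi> - {v}"

definition Fm ::
  "('f, 'r, 's) language \<Rightarrow> ('a \<Rightarrow> 's) \<Rightarrow> 'a set \<Rightarrow> (nat \<times> 's) set \<Rightarrow> ('f, 'r, 's, 'a) formula set"
  where "Fm L \<sigma> B X = {\<phi>. wf_fm L \<sigma> \<phi> \<and> pars \<phi> \<subseteq> B \<and> fv \<phi> \<subseteq> X}"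

fun val :: "('f, 'r, 's, 'a) struct \<Rightarrow> (nat \<times> 's \<Rightarrow> 'a) \<Rightarrow> ('f, nat \<times> 's, 'a) tm \<Rightarrow> 'a" where
  "val M e (Var v) = e v"
| "val M e (Par a) = a"
| "val M e (Fn f ts) = fint M f (map (val M e) ts)"

fun sat ::
  "('f, 'r, 's, 'a) struct \<Rightarrow> (nat \<times> 's \<Rightarrow> 'a) \<Rightarrow> ('f, 'r, 's, 'a) formula \<Rightarrow> bool" where
  "sat M e (Eq t u) \<longleftrightarrow> val M e t = val M e u"
| "sat M e (Rel r ts) \<longleftrightarrow> rint M r (map (val M e) ts)"
| "sat M e (Neg \<phi>) \<longleftrightarrow> \<not> sat M e \<phi>"
| "sat M e (Conj \<phi> \<psi>) \<longleftrightarrow> sat M e \<phi> \<and> sat M e \<psi>"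
| "sat M e (Ex v \<phi>) \<longleftrightarrow> (\<exists>a\<in>univ M. srt M a = snd v \<and> sat M (e(v := a)) \<phi>)"

definition holds :: "('f, 'r, 's, 'a) struct \<Rightarrow> ('f, 'r, 's, 'a) formula \<Rightarrow> bool" where
  "holds M \<phi> \<longleftrightarrow> (\<forall>e. sat M e \<phi>)"

text \<open>Truth of \<open>\<phi>(a)\<close> for \<open>\<phi>\<close> with at most one free variable.\<close>

definition sat1 :: "('f, 'r, 's, 'a) struct \<Rightarrow> 'a \<Rightarrow> ('f, 'r, 's, 'a) formula \<Rightarrow> bool" where
  "sat1 M a \<phi> \<longleftrightarrow> sat M (\<lambda>_. a) \<phi>"

definition assigns ::
  "('f, 'r, 's, 'a) struct \<Rightarrow> (nat \<times> 's) set \<Rightarrow> (nat \<times> 's \<Rightarrow> 'a) \<Rightarrow> bool" where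
  "assigns M X e \<longleftrightarrow> (\<forall>v\<in>X. e v \<in> univ M \<and> srt M (e v) = snd v)"


section \<open>Complete theories and monster models\<close>

definition sentences :: "('f, 'r, 's) language \<Rightarrow> ('f, 'r, 's, 'a) formula set" where
  "sentences L = {\<phi>. \<forall>\<sigma>. \<phi> \<in> Fm L \<sigma> {} {}}"

definition model_of ::
  "('f, 'r, 's) language \<Rightarrow> ('f, 'r, 's, 'a) formula set \<Rightarrow> ('f, 'r, 's, 'a) struct \<Rightarrow> bool" where
  "model_of L T N \<longleftrightarrow> is_structure L N \<and> (\<forall>\<phi>\<in>T. holds N \<phi>)"

text \<open>
  Semantic consequence can only quantify over structures on subsets of one type; below, this
  type also contains the monster model.
\<close>

definition complete_theory ::
  "('f, 'r, 's) language \<Rightarrow> ('f, 'r, 's, 'a) formula set \<Rightarrow> bool" where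
  "complete_theory L T \<longleftrightarrow> T \<subseteq> sentences L \<and> (\<exists>N. model_of L T N) \<and>
     (\<forall>\<phi>\<in>sentences L.
        (\<forall>N. model_of L T N \<longrightarrow> holds N \<phi>) \<or> (\<forall>N. model_of L T N \<longrightarrow> holds N (Neg \<phi>)))"

definition elementary_submodel ::
  "('f, 'r, 's) language \<Rightarrow> ('f, 'r, 's, 'a) struct \<Rightarrow> 'a set \<Rightarrow> bool" where
  "elementary_submodel L M N \<longleftrightarrow> N \<subseteq> univ M \<and> is_structure L (M\<lparr>univ := N\<rparr>) \<and>
     (\<forall>\<phi>\<in>Fm L (srt M) N {}. holds (M\<lparr>univ := N\<rparr>) \<phi> \<longleftrightarrow> holds M \<phi>)"

definition finitely_satisfiable ::
  "('f, 'r, 's, 'a) struct \<Rightarrow> (nat \<times> 's) set \<Rightarrow> ('f, 'r, 's, 'a) formula set \<Rightarrow> bool" where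
  "finitely_satisfiable M X \<Sigma> \<longleftrightarrow>
     (\<forall>F. F \<subseteq> \<Sigma> \<and> finite F \<longrightarrow> (\<exists>e. assigns M X e \<and> (\<forall>\<phi>\<in>F. sat M e \<phi>)))"

definition small ::
  "'k rel \<Rightarrow> ('f, 'r, 's, 'a) struct \<Rightarrow> 'a set \<Rightarrow> bool" where
  "small \<kappa> M B \<longleftrightarrow> B \<subseteq> univ M \<and> |B| <o \<kappa>"

definition saturated ::
  "('f, 'r, 's) language \<Rightarrow> 'k rel \<Rightarrow> ('f, 'r, 's, 'a) struct \<Rightarrow> bool" where
  "saturated L \<kappa> M \<longleftrightarrow>
     (\<forall>B. small \<kappa> M B \<longrightarrow> (\<forall>x. \<forall>\<Sigma>. snd x \<in> sorts L \<and> \<Sigma> \<subseteq> Fm L (srt M) B {x} \<and>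
        finitely_satisfiable M {x} \<Sigma> \<longrightarrow>
        (\<exists>a\<in>univ M. srt M a = snd x \<and> (\<forall>\<phi>\<in>\<Sigma>. sat1 M a \<phi>))))"

definition elementary_map ::
  "('f, 'r, 's) language \<Rightarrow> ('f, 'r, 's, 'a) struct \<Rightarrow> 'a set \<Rightarrow> ('a \<Rightarrow> 'a) \<Rightarrow> bool" where
  "elementary_map L M B g \<longleftrightarrow> (\<forall>b\<in>B. g b \<in> univ M \<and> srt M (g b) = srt M b) \<and>
     (\<forall>\<phi>\<in>Fm L (srt M) B {}. holds M \<phi> \<longleftrightarrow> holds M (map_fm id g \<phi>))"

definition automorphism ::
  "('f, 'r, 's) language \<Rightarrow> ('f, 'r, 's, 'a) struct \<Rightarrow> ('a \<Rightarrow> 'a) \<Rightarrow> bool" where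
  "automorphism L M g \<longleftrightarrow> bij_betw g (univ M) (univ M) \<and> (\<forall>a\<in>univ M. srt M (g a) = srt M a) \<and>
     (\<forall>f\<in>funs L. \<forall>as\<in>tuples M (fdom L f). g (fint M f as) = fint M f (map g as)) \<and>
     (\<forall>r\<in>rels L. \<forall>as\<in>tuples M (rdom L r). rint M r as \<longleftrightarrow> rint M r (map g as))"

definition strongly_homogeneous ::
  "('f, 'r, 's) language \<Rightarrow> 'k rel \<Rightarrow> ('f, 'r, 's, 'a) struct \<Rightarrow> bool" where
  "strongly_homogeneous L \<kappa> M \<longleftrightarrow>
     (\<forall>B g. small \<kappa> M B \<and> elementary_map L M B g \<longrightarrow>
        (\<exists>h. automorphism L M h \<and> (\<forall>b\<in>B. h b = g b)))"

text \<open>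
  The monster model is \<open>\<kappa>\<close>-saturated and strongly \<open>\<kappa>\<close>-homogeneous. For a countable theory, all
  that is required of the size of \<open>\<kappa>\<close> is that it be uncountable, so that countable sets are small.
\<close>

definition monster_model ::
  "('f, 'r, 's) language \<Rightarrow> ('f, 'r, 's, 'a) formula set \<Rightarrow> 'k rel \<Rightarrow>
   ('f, 'r, 's, 'a) struct \<Rightarrow> bool" where
  "monster_model L T \<kappa> M \<longleftrightarrow> model_of L T M \<and> Card_order \<kappa> \<and> natLeq <o \<kappa> \<and>
     saturated L \<kappa> M \<and> strongly_homogeneous L \<kappa> M"


section \<open>Imaginaries\<close>

text \<open>
  A sort of \<open>M\<^sup>e\<^sup>q\<close> is a sort of \<open>M\<close>, or a pair \<open>(ss, E)\<close> of a list of \<open>n\<close> sorts and a parameter-free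
  formula defining an equivalence relation on the tuples of these sorts; in \<open>E\<close> the variables with
  index \<open>k < n\<close> stand for the first tuple and those with index \<open>n + k\<close> for the second. Besides the
  symbols of \<open>L\<close>, the language of \<open>M\<^sup>e\<^sup>q\<close> has for each \<open>(ss, E)\<close> a symbol for the quotient map.
\<close>

type_synonym ('f, 'r, 's, 'a) isort = "'s list \<times> ('f, 'r, 's, 'a) formula"

datatype ('f, 'r, 's, 'a) imag =
    Real (the_real: 'a)
  | Class "('f, 'r, 's, 'a) isort" "'a list set"

definition irel :: "('f, 'r, 's, 'a) struct \<Rightarrow> ('f, 'r, 's, 'a) isort \<Rightarrow> 'a list rel" where
  "irel M i = {(as, bs). as \<in> tuples M (fst i) \<and> bs \<in> tuples M (fst i) \<and>
     sat M (\<lambda>(k, s). (as @ bs) ! k) (snd i)}"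

definition isorts ::
  "('f, 'r, 's) language \<Rightarrow> ('f, 'r, 's, 'a) struct \<Rightarrow> ('f, 'r, 's, 'a) isort set" where
  "isorts L M = {(ss, E). set ss \<subseteq> sorts L \<and>
     E \<in> Fm L (srt M) {} {(k, (ss @ ss) ! k) | k. k < 2 * length ss} \<and>
     equiv (tuples M ss) (irel M (ss, E))}"

definition eq_language ::
  "('f, 'r, 's) language \<Rightarrow> ('f, 'r, 's, 'a) struct \<Rightarrow>
   ('f + ('f, 'r, 's, 'a) isort, 'r, 's + ('f, 'r, 's, 'a) isort) language" where
  "eq_language L M = \<lparr>
     sorts = sorts L <+> isorts L M,
     funs = funs L <+> isorts L M,
     fdom = case_sum (\<lambda>f. map Inl (fdom L f)) (\<lambda>i. map Inl (fst i)),
     fcod = case_sum (\<lambda>f. Inl (fcod L f)) Inr,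
     rels = rels L,
     rdom = (\<lambda>r. map Inl (rdom L r))\<rparr>"

text \<open>
  For \<open>N\<close> an elementary submodel of \<open>M\<close>, \<open>eq_univ L M N\<close> is \<open>N\<^sup>e\<^sup>q\<close> in its canonical embedding in
  \<open>M\<^sup>e\<^sup>q\<close>: the class of a tuple from \<open>N\<close> is identified with its class in \<open>M\<close>.
\<close>

definition eq_univ ::
  "('f, 'r, 's) language \<Rightarrow> ('f, 'r, 's, 'a) struct \<Rightarrow> 'a set \<Rightarrow> ('f, 'r, 's, 'a) imag set" where
  "eq_univ L M N = Real ` N \<union>
     {Class i (irel M i `` {as}) | i as. i \<in> isorts L M \<and> as \<in> tuples M (fst i) \<and> set as \<subseteq> N}"

definition eq_struct ::
  "('f, 'r, 's) language \<Rightarrow> ('f, 'r, 's, 'a) struct \<Rightarrow>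
   ('f + ('f, 'r, 's, 'a) isort, 'r, 's + ('f, 'r, 's, 'a) isort, ('f, 'r, 's, 'a) imag) struct"
  where
  "eq_struct L M = \<lparr>
     univ = eq_univ L M (univ M),
     srt = case_imag (\<lambda>a. Inl (srt M a)) (\<lambda>i C. Inr i),
     fint = case_sum (\<lambda>f as. Real (fint M f (map the_real as)))
                     (\<lambda>i as. Class i (irel M i `` {map the_real as})),
     rint = (\<lambda>r as. rint M r (map the_real as))\<rparr>"


section \<open>Global types\<close>

text \<open>
  The notions of this section are stated for an arbitrary many-sorted structure \<open>M\<close>; they are to be
  applied to \<open>M\<^sup>e\<^sup>q\<close>. A type of sort \<open>s\<close> is written in the variable \<open>(0, s)\<close>.
\<close>

definition complete_type ::
  "('f, 'r, 's) language \<Rightarrow> ('f, 'r, 's, 'a) struct \<Rightarrow> 'a set \<Rightarrow> (nat \<times> 's) set \<Rightarrow>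
   ('f, 'r, 's, 'a) formula set \<Rightarrow> bool" where
  "complete_type L M B X p \<longleftrightarrow> p \<subseteq> Fm L (srt M) B X \<and> finitely_satisfiable M X p \<and>
     (\<forall>\<phi>\<in>Fm L (srt M) B X. \<phi> \<in> p \<or> Neg \<phi> \<in> p)"

definition global_type ::
  "('f, 'r, 's) language \<Rightarrow> ('f, 'r, 's, 'a) struct \<Rightarrow> 's \<Rightarrow>
   ('f, 'r, 's, 'a) formula set \<Rightarrow> bool" where
  "global_type L M s p \<longleftrightarrow> s \<in> sorts L \<and> complete_type L M (univ M) {(0, s)} p"

definition restr :: "('f, 'r, 's, 'a) formula set \<Rightarrow> 'a set \<Rightarrow> ('f, 'r, 's, 'a) formula set" where
  "restr p B = {\<phi>\<in>p. pars \<phi> \<subseteq> B}"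

definition realizes ::
  "('f, 'r, 's, 'a) struct \<Rightarrow> 's \<Rightarrow> 'a \<Rightarrow> ('f, 'r, 's, 'a) formula set \<Rightarrow> bool" where
  "realizes M s a \<Sigma> \<longleftrightarrow> a \<in> univ M \<and> srt M a = s \<and> (\<forall>\<phi>\<in>\<Sigma>. sat1 M a \<phi>)"

text \<open>
  \<open>\<Sigma>(x) \<turnstile> \<Delta>(x)\<close> modulo the elementary diagram of \<open>M\<close>: every formula of \<open>\<Delta>\<close> follows from finitely
  many formulas of \<open>\<Sigma>\<close>.
\<close>

definition proves ::
  "('f, 'r, 's, 'a) struct \<Rightarrow> 's \<Rightarrow> ('f, 'r, 's, 'a) formula set \<Rightarrow>
   ('f, 'r, 's, 'a) formula set \<Rightarrow> bool" where
  "proves M s \<Sigma> \<Delta> \<longleftrightarrow>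
     (\<forall>\<phi>\<in>\<Delta>. \<exists>F. F \<subseteq> \<Sigma> \<and> finite F \<and> (\<forall>a. realizes M s a F \<longrightarrow> realizes M s a {\<phi>}))"

definition nonalgebraic ::
  "('f, 'r, 's, 'a) struct \<Rightarrow> 's \<Rightarrow> ('f, 'r, 's, 'a) formula set \<Rightarrow> bool" where
  "nonalgebraic M s p \<longleftrightarrow> (\<forall>\<phi>\<in>p. infinite {a. realizes M s a {\<phi>}})"

definition isolated ::
  "('f, 'r, 's, 'a) struct \<Rightarrow> 's \<Rightarrow> ('f, 'r, 's, 'a) formula set \<Rightarrow> bool" where
  "isolated M s p \<longleftrightarrow> (\<exists>\<phi>\<in>p. proves M s {\<phi>} p)"

text \<open>
  \<open>inst_fm V e \<phi>\<close> is the formula with parameters obtained from \<open>\<phi>\<close> by replacing the free variables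
  outside \<open>V\<close> by their values under \<open>e\<close>.
\<close>

fun inst_tm :: "'v set \<Rightarrow> ('v \<Rightarrow> 'c) \<Rightarrow> ('f, 'v, 'c) tm \<Rightarrow> ('f, 'v, 'c) tm" where
  "inst_tm V e (Var v) = (if v \<in> V then Var v else Par (e v))"
| "inst_tm V e (Par a) = Par a"
| "inst_tm V e (Fn f ts) = Fn f (map (inst_tm V e) ts)"

fun inst_fm :: "'v set \<Rightarrow> ('v \<Rightarrow> 'c) \<Rightarrow> ('f, 'r, 'v, 'c) fm \<Rightarrow> ('f, 'r, 'v, 'c) fm" where
  "inst_fm V e (Eq t u) = Eq (inst_tm V e t) (inst_tm V e u)"
| "inst_fm V e (Rel r ts) = Rel r (map (inst_tm V e) ts)"
| "inst_fm V e (Neg \<phi>) = Neg (inst_fm V e \<phi>)"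
| "inst_fm V e (Conj \<phi> \<psi>) = Conj (inst_fm V e \<phi>) (inst_fm V e \<psi>)"
| "inst_fm V e (Ex v \<phi>) = Ex v (inst_fm (insert v V) e \<phi>)"

text \<open>\<open>b\<^sub>1 \<equiv> b\<^sub>2 (A)\<close> for tuples \<open>b\<^sub>1\<close>, \<open>b\<^sub>2\<close> indexed by the variables in \<open>Y\<close>.\<close>

definition same_type ::
  "('f, 'r, 's) language \<Rightarrow> ('f, 'r, 's, 'a) struct \<Rightarrow> 'a set \<Rightarrow> (nat \<times> 's) set \<Rightarrow>
   (nat \<times> 's \<Rightarrow> 'a) \<Rightarrow> (nat \<times> 's \<Rightarrow> 'a) \<Rightarrow> bool" where
  "same_type L M A Y b1 b2 \<longleftrightarrow> (\<forall>\<psi>\<in>Fm L (srt M) A Y. sat M b1 \<psi> \<longleftrightarrow> sat M b2 \<psi>)"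

definition invariant ::
  "('f, 'r, 's) language \<Rightarrow> ('f, 'r, 's, 'a) struct \<Rightarrow> 's \<Rightarrow>
   ('f, 'r, 's, 'a) formula set \<Rightarrow> 'a set \<Rightarrow> bool" where
  "invariant L M s p A \<longleftrightarrow>
     (\<forall>\<phi>\<in>Fm L (srt M) A UNIV. \<forall>b1 b2. let x = (0, s); Y = fv \<phi> - {x} in
        assigns M Y b1 \<and> assigns M Y b2 \<and> same_type L M A Y b1 b2 \<longrightarrow>
        (inst_fm {x} b1 \<phi> \<in> p \<longleftrightarrow> inst_fm {x} b2 \<phi> \<in> p))"

text \<open>A sequence of ordinal length is a function on the field of a well-order.\<close>

definition morley_seq ::
  "('f, 'r, 's, 'a) struct \<Rightarrow> 's \<Rightarrow> ('f, 'r, 's, 'a) formula set \<Rightarrow> 'a set \<Rightarrow>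
   'o rel \<Rightarrow> ('o \<Rightarrow> 'a) \<Rightarrow> bool" where
  "morley_seq M s p A \<alpha> a \<longleftrightarrow> Well_order \<alpha> \<and>
     (\<forall>i\<in>Field \<alpha>. realizes M s (a i) (restr p (A \<union> a ` underS \<alpha> i)))"

text \<open>
  Since Morley sequences in non-algebraic global types have no repetitions, well-orders on (subsets
  of) the type of elements give Morley sequences of all possible lengths.
\<close>

definition generically_stable ::
  "('f, 'r, 's) language \<Rightarrow> 'k rel \<Rightarrow> ('f, 'r, 's, 'a) struct \<Rightarrow> 's \<Rightarrow>
   ('f, 'r, 's, 'a) formula set \<Rightarrow> bool" where
  "generically_stable L \<kappa> M s p \<longleftrightarrow> global_type L M s p \<and> nonalgebraic M s p \<and>
     (\<exists>A. small \<kappa> M A \<and> invariant L M s p A \<and>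
       (\<forall>(\<alpha> :: 'a rel) a. infinite (Field \<alpha>) \<and> morley_seq M s p A \<alpha> a \<longrightarrow>
         (\<forall>\<phi>\<in>Fm L (srt M) (univ M) {(0, s)}.
           finite {i\<in>Field \<alpha>. sat1 M (a i) \<phi>} \<or> finite {i\<in>Field \<alpha>. \<not> sat1 M (a i) \<phi>})))"

definition regular ::
  "('f, 'r, 's) language \<Rightarrow> 'k rel \<Rightarrow> ('f, 'r, 's, 'a) struct \<Rightarrow> 's \<Rightarrow>
   ('f, 'r, 's, 'a) formula set \<Rightarrow> 'a set \<Rightarrow> bool" where
  "regular L \<kappa> M s p A \<longleftrightarrow> global_type L M s p \<and> nonalgebraic M s p \<and>
     small \<kappa> M A \<and> invariant L M s p A \<and>
     (\<forall>B a. small \<kappa> M B \<and> A \<subseteq> B \<and> realizes M s a (restr p A) \<longrightarrow>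
        realizes M s a (restr p B) \<or> proves M s (restr p B) (restr p (insert a B)))"

text \<open>
  Raising all variable indices by one (bound variables included, hence without capture) moves a type
  from the variable \<open>(0, t)\<close> to \<open>(1, t)\<close>, which is distinct from \<open>(0, s)\<close> even for \<open>s = t\<close>.
\<close>

definition shift :: "('f, 'r, 's, 'a) formula \<Rightarrow> ('f, 'r, 's, 'a) formula" where
  "shift = map_fm (apfst Suc) id"

definition orthogonal ::
  "('f, 'r, 's) language \<Rightarrow> ('f, 'r, 's, 'a) struct \<Rightarrow> 's \<Rightarrow> ('f, 'r, 's, 'a) formula set \<Rightarrow>
   's \<Rightarrow> ('f, 'r, 's, 'a) formula set \<Rightarrow> bool" where
  "orthogonal L M s p t q \<longleftrightarrow>
     (\<exists>!r. complete_type L M (univ M) {(0, s), (1, t)} r \<and> p \<union> shift ` q \<subseteq> r)"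

definition maximal_morley_seq_in ::
  "('f, 'r, 's, 'a) struct \<Rightarrow> 's \<Rightarrow> ('f, 'r, 's, 'a) formula set \<Rightarrow> 'a set \<Rightarrow> 'a set \<Rightarrow>
   'o rel \<Rightarrow> ('o \<Rightarrow> 'a) \<Rightarrow> bool" where
  "maximal_morley_seq_in M s p A N \<alpha> a \<longleftrightarrow>
     morley_seq M s p A \<alpha> a \<and> a ` Field \<alpha> \<subseteq> N \<and>
     \<not> (\<exists>b\<in>N. realizes M s b (restr p (A \<union> a ` Field \<alpha>)))"

text \<open>\<open>dim\<^sub>p(N/A)\<close> is defined and equal to the cardinal \<open>\<mu>\<close>.\<close>

definition has_dim ::
  "('f, 'r, 's, 'a) struct \<Rightarrow> 's \<Rightarrow> ('f, 'r, 's, 'a) formula set \<Rightarrow> 'a set \<Rightarrow> 'a set \<Rightarrow>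
   'm rel \<Rightarrow> bool" where
  "has_dim M s p A N \<mu> \<longleftrightarrow>
     (\<exists>(\<alpha> :: 'a rel) a. maximal_morley_seq_in M s p A N \<alpha> a) \<and>
     (\<forall>(\<alpha> :: 'a rel) a. maximal_morley_seq_in M s p A N \<alpha> a \<longrightarrow> |Field \<alpha>| =o \<mu>)"

end

theory Submission
  imports Defs
begin

text \<open>
  Work in \<open>M\<^sup>e\<^sup>q\<close>, which is saturated because its formulas translate into \<open>L\<close>. A formula that fails
  along a Morley sequence in a generically stable type does not belong to the type. This averaging
  principle gives symmetry; it also shows that orthogonal types \<open>p\<close>, \<open>q\<close> are weakly orthogonal over every
  countable \<open>D \<supseteq> A\<close>, since a dependent pair over \<open>D\<close> could be repeated along two Morley sequences, and
  then \<open>p(x) \<union> q(y)\<close> would not be complete. By averaging again, if \<open>p\<close> is isolated over \<open>Db\<close> with \<open>b \<Turnstile> q\<restriction>D\<close>,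
  then \<open>p\<close> is already isolated over \<open>D\<close>.

  Realize \<open>f i\<close> times each \<open>p\<^sub>i\<close>, each time generically over \<open>A\<close> and the earlier elements, and let \<open>C\<close> be
  the resulting set. No \<open>p\<^sub>i\<close> is isolated over \<open>C\<close>, so a countable model containing \<open>C\<close> omits all
  \<open>p\<^sub>i\<restriction>C\<close>. The chosen realizations of \<open>p\<^sub>i\<close> then form a maximal Morley sequence of the model: by weak
  orthogonality, an element generic over \<open>A\<close> and these is generic over \<open>C\<close>. Regularity and symmetry give
  the exchange argument that makes the dimension independent of the maximal sequence.
\<close>

text \<open>Generic stability comes with a small base of its own, unrelated to \<open>A\<close>, and
  bounds alternation only along Morley sequences over that base, whereas everything here is built
  over countable sets \<open>D \<supseteq> A\<close>. Invariance over \<open>A\<close> bridges the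
  gap: Morley sequences in \<open>p\<close> over \<open>D\<close> are conjugate over
  \<open>D\<close>, so a given one can be carried to a sequence over the other base. Conjugation is
  always by elementary maps on small sets, extended to finitely many further elements by saturation.
  The delicate point of weak orthogonality is that the second halves of the repeated dependent pairs
  have to form a Morley sequence too, although each of them may depend on its partner. The types may
  live on imaginary sorts, so omitting types takes place in \<open>M\<^sup>e\<^sup>q\<close>, and
  the model obtained there has to be recognized as \<open>N\<^sup>e\<^sup>q\<close> for its set
  \<open>N\<close> of real elements. As \<open>f\<close> has finite values, the comparison of Morley
  sequences comes down to exchange between finite sets.\<close>

section \<open>Terms, formulas and satisfaction\<close>

lemma finite_tvars: "finite (tvars t)" and finite_tpars: "finite (tpars t)"
  by (induction t) auto

lemma finite_fv: "finite (fv \<phi>)" and finite_fvars: "finite (fvars \<phi>)" and finite_pars: "finite (pars \<phi>)"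
  by (induction \<phi>) (auto simp: finite_tvars finite_tpars)

lemma fv_subset_fvars: "fv \<phi> \<subseteq> fvars \<phi>"
  by (induction \<phi>) auto

lemma val_cong: "(\<And>v. v \<in> tvars t \<Longrightarrow> e v = e' v) \<Longrightarrow> val M e t = val M e' t"
proof (induction t)
  case (Fn f ts)
  have "map (val M e) ts = map (val M e') ts"
    by (rule map_cong) (use Fn in \<open>simp_all add: Bex_def, metis\<close>)
  then show ?case by (simp only: val.simps)
qed simp_all

lemma sat_cong: "(\<And>v. v \<in> fv \<phi> \<Longrightarrow> e v = e' v) \<Longrightarrow> sat M e \<phi> = sat M e' \<phi>"
proof (induction \<phi> arbitrary: e e')
  case (Eq t u)
  then show ?case using val_cong[of t e e' M] val_cong[of u e e' M] by simp
next
  case (Rel r ts)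
  have "map (val M e) ts = map (val M e') ts"
    using Rel by (intro map_cong) (auto intro!: val_cong)
  then show ?case by (simp only: sat.simps)
next
  case (Neg \<phi>)
  then show ?case by (metis fv.simps(3) sat.simps(3))
next
  case (Conj \<phi> \<psi>)
  then show ?case by (metis UnI1 UnI2 fv.simps(4) sat.simps(4))
next
  case (Ex v \<phi>)
  have "sat M (e(v := a)) \<phi> = sat M (e'(v := a)) \<phi>" for a
    by (rule Ex.IH) (use Ex.prems in auto)
  then show ?case by simp
qed

lemma holds_iff_sat: "fv \<phi> = {} \<Longrightarrow> holds M \<phi> \<longleftrightarrow> sat M e \<phi>"
  unfolding holds_def using sat_cong[of \<phi>] by (metis empty_iff)

lemma sat_iff_sat1: "fv \<phi> \<subseteq> {x} \<Longrightarrow> sat M e \<phi> \<longleftrightarrow> sat1 M (e x) \<phi>"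
  unfolding sat1_def by (rule sat_cong) auto

lemma fv_map_id: "fv (map_fm id h \<phi>) = fv \<phi>"
  by (induction \<phi>) (auto simp: tm.set_map)

lemma tm_srt_map: "(\<And>v. snd (\<rho> v) = snd v) \<Longrightarrow> (\<And>c. c \<in> tpars t \<Longrightarrow> \<sigma> (h c) = \<sigma> c) \<Longrightarrow>
    tm_srt L \<sigma> (map_tm \<rho> h t) = tm_srt L \<sigma> t"
  by (cases t) auto

lemma wf_tm_map: "(\<And>v. snd (\<rho> v) = snd v) \<Longrightarrow> (\<And>c. c \<in> tpars t \<Longrightarrow> \<sigma> (h c) = \<sigma> c) \<Longrightarrow>
    wf_tm L \<sigma> (map_tm \<rho> h t) \<longleftrightarrow> wf_tm L \<sigma> t"
proof (induction t)
  case (Fn f ts)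
  have "\<forall>t\<in>set ts. tm_srt L \<sigma> (map_tm \<rho> h t) = tm_srt L \<sigma> t"
    using Fn.prems by (auto intro!: tm_srt_map)
  moreover have "\<forall>t\<in>set ts. wf_tm L \<sigma> (map_tm \<rho> h t) \<longleftrightarrow> wf_tm L \<sigma> t"
    by (intro ballI Fn.IH) (use Fn.prems in auto)
  ultimately show ?case by (auto simp: o_def cong: map_cong)
qed auto

lemma wf_fm_map: "(\<And>v. snd (\<rho> v) = snd v) \<Longrightarrow> (\<And>c. c \<in> pars \<phi> \<Longrightarrow> \<sigma> (h c) = \<sigma> c) \<Longrightarrow>
    wf_fm L \<sigma> (map_fm \<rho> h \<phi>) \<longleftrightarrow> wf_fm L \<sigma> \<phi>"
proof (induction \<phi>)
  case (Rel r ts)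
  have "\<forall>t\<in>set ts. tm_srt L \<sigma> (map_tm \<rho> h t) = tm_srt L \<sigma> t"
    using Rel.prems by (auto intro!: tm_srt_map)
  moreover have "\<forall>t\<in>set ts. wf_tm L \<sigma> (map_tm \<rho> h t) \<longleftrightarrow> wf_tm L \<sigma> t"
    using Rel.prems by (auto intro!: wf_tm_map)
  ultimately show ?case by (auto simp: o_def cong: map_cong)
qed (auto simp: tm_srt_map wf_tm_map)

lemma Fm_map:
  assumes "\<phi> \<in> Fm L \<sigma> S X" "\<And>c. c \<in> S \<Longrightarrow> \<sigma> (h c) = \<sigma> c"
  shows "map_fm id h \<phi> \<in> Fm L \<sigma> (h ` S) X"
  using assms wf_fm_map[of id \<phi> \<sigma> h L] by (auto simp: Fm_def fv_map_id fm.set_map)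

lemma val_rename: "val M e (map_tm \<rho> id t) = val M (e \<circ> \<rho>) t"
  by (induction t) (auto simp: o_def intro!: arg_cong[where f="fint M _"])

text \<open>Bound variables are renamed as well, so injectivity is what prevents capture; equal
  sorts keep the range of each quantifier.\<close>

lemma sat_rename: "inj \<rho> \<Longrightarrow> (\<And>v. snd (\<rho> v) = snd v) \<Longrightarrow> sat M e (map_fm \<rho> id \<phi>) \<longleftrightarrow> sat M (e \<circ> \<rho>) \<phi>"
proof (induction \<phi> arbitrary: e)
  case (Rel r ts)
  have "map (val M e) (map (map_tm \<rho> id) ts) = map (val M (e \<circ> \<rho>)) ts"
    by (simp add: val_rename)
  then show ?case by (simp only: fm.map sat.simps)
next
  case (Ex v \<phi>)
  have "(e(\<rho> v := a)) \<circ> \<rho> = (e \<circ> \<rho>)(v := a)" for a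
    using Ex.prems(1) by (auto simp: fun_eq_iff inj_eq)
  then show ?case using Ex by (simp del: fun_upd_apply comp_apply add: fm.map)
qed (auto simp: val_rename)

lemma fv_rename: "inj \<rho> \<Longrightarrow> fv (map_fm \<rho> id \<phi>) = \<rho> ` fv \<phi>"
  by (induction \<phi>) (auto simp: tm.set_map inj_eq)

lemma fresh_var: "finite V \<Longrightarrow> \<exists>k. (k :: nat, s) \<notin> V"
proof -
  assume "finite V"
  then have "finite (fst ` V)" by simp
  then obtain k where "k \<notin> fst ` V" using ex_new_if_finite[OF infinite_UNIV_nat] by blast
  then show ?thesis by (metis fst_conv image_eqI)
qed

lemma val_in: 
  assumes "is_structure L M" "wf_tm L (srt M) t" "tpars t \<subseteq> univ M" "assigns M (tvars t) e"
  shows "val M e t \<in> univ M \<and> srt M (val M e t) = tm_srt L (srt M) t"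
  using assms
proof (induction t)
  case (Fn f ts)
  have "\<forall>t\<in>set ts. val M e t \<in> univ M \<and> srt M (val M e t) = tm_srt L (srt M) t"
    using Fn by (auto simp: assigns_def)
  then have "map (val M e) ts \<in> tuples M (fdom L f)"
    using Fn.prems(2) by (auto simp: tuples_def o_def cong: map_cong)
  then show ?case using Fn.prems by (auto simp: is_structure_def)
qed (auto simp: assigns_def)

section \<open>Instances and generalizations\<close>

lemma val_inst: "val M e' (inst_tm V e t) = val M (\<lambda>v. if v \<in> V then e' v else e v) t"
  by (induction t) (auto intro!: arg_cong[where f="fint M _"])

text \<open>\<open>V\<close> grows at each quantifier, so bound occurrences are never replaced, and
  evaluation mixes the two assignments.\<close>

lemma sat_inst: "sat M e' (inst_fm V e \<phi>) \<longleftrightarrow> sat M (\<lambda>v. if v \<in> V then e' v else e v) \<phi>"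
proof (induction \<phi> arbitrary: e' V)
  case (Ex v \<phi>)
  have "(\<lambda>w. if w \<in> insert v V then (e'(v := a)) w else e w) =
    (\<lambda>w. if w \<in> V then e' w else e w)(v := a)" for a by (auto simp: fun_eq_iff)
  then show ?case using Ex by simp
qed (auto simp: val_inst o_def)

lemma tvars_inst: "tvars (inst_tm V e t) = tvars t \<inter> V"
  by (induction t) auto

lemma fv_inst: "fv (inst_fm V e \<phi>) = fv \<phi> \<inter> V"
  by (induction \<phi> arbitrary: V) (auto simp: tvars_inst)

lemma tpars_inst: "tpars (inst_tm V e t) = tpars t \<union> e ` (tvars t - V)"
  by (induction t) auto

lemma pars_inst: "pars (inst_fm V e \<phi>) = pars \<phi> \<union> e ` (fv \<phi> - V)"
  by (induction \<phi> arbitrary: V) (auto simp: tpars_inst)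

lemma tm_srt_inst: "(\<And>v. v \<in> tvars t - V \<Longrightarrow> \<sigma> (e v) = snd v) \<Longrightarrow>
    tm_srt L \<sigma> (inst_tm V e t) = tm_srt L \<sigma> t"
  by (cases t) auto

lemma wf_tm_inst: "(\<And>v. v \<in> tvars t - V \<Longrightarrow> \<sigma> (e v) = snd v) \<Longrightarrow>
    wf_tm L \<sigma> (inst_tm V e t) \<longleftrightarrow> wf_tm L \<sigma> t"
proof (induction t)
  case (Fn f ts)
  have "\<forall>t\<in>set ts. tm_srt L \<sigma> (inst_tm V e t) = tm_srt L \<sigma> t"
    using Fn.prems by (auto intro!: tm_srt_inst)
  moreover have "\<forall>t\<in>set ts. wf_tm L \<sigma> (inst_tm V e t) \<longleftrightarrow> wf_tm L \<sigma> t"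
    by (intro ballI Fn.IH) (use Fn.prems in auto)
  ultimately show ?case by (auto simp: o_def cong: map_cong)
qed auto

lemma wf_fm_inst: "(\<And>v. v \<in> fv \<phi> - V \<Longrightarrow> \<sigma> (e v) = snd v) \<Longrightarrow>
    wf_fm L \<sigma> (inst_fm V e \<phi>) \<longleftrightarrow> wf_fm L \<sigma> \<phi>"
proof (induction \<phi> arbitrary: V)
  case (Rel r ts)
  have "\<forall>t\<in>set ts. tm_srt L \<sigma> (inst_tm V e t) = tm_srt L \<sigma> t"
    using Rel.prems by (auto intro!: tm_srt_inst)
  moreover have "\<forall>t\<in>set ts. wf_tm L \<sigma> (inst_tm V e t) \<longleftrightarrow> wf_tm L \<sigma> t"
    using Rel.prems by (auto intro!: wf_tm_inst)
  ultimately show ?case by (auto simp: o_def cong: map_cong)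
next
  case (Ex v \<phi>)
  have "wf_fm L \<sigma> (inst_fm (insert v V) e \<phi>) \<longleftrightarrow> wf_fm L \<sigma> \<phi>"
    by (rule Ex.IH) (use Ex.prems in auto)
  then show ?case by simp
next
  case (Eq t u)
  have "tm_srt L \<sigma> (inst_tm V e r) = tm_srt L \<sigma> r \<and> wf_tm L \<sigma> (inst_tm V e r) = wf_tm L \<sigma> r"
    if "r \<in> {t, u}" for r
    by (intro conjI tm_srt_inst wf_tm_inst) (use Eq that in auto)
  then show ?case by simp
next
  case (Conj \<phi>1 \<phi>2)
  have "wf_fm L \<sigma> (inst_fm V e \<phi>1) \<longleftrightarrow> wf_fm L \<sigma> \<phi>1"
    by (rule Conj.IH(1)) (use Conj.prems in auto)
  moreover have "wf_fm L \<sigma> (inst_fm V e \<phi>2) \<longleftrightarrow> wf_fm L \<sigma> \<phi>2"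
    by (rule Conj.IH(2)) (use Conj.prems in auto)
  ultimately show ?case by simp
qed auto

lemma Fm_inst:
  assumes "\<phi> \<in> Fm L \<sigma> S X" "\<And>v. v \<in> X - V \<Longrightarrow> \<sigma> (e v) = snd v"
  shows "inst_fm V e \<phi> \<in> Fm L \<sigma> (S \<union> e ` (X - V)) (X \<inter> V)"
  using assms wf_fm_inst[of \<phi> V \<sigma> e L] by (auto simp: Fm_def fv_inst pars_inst)

text \<open>The opposite of instantiation: parameters in the domain of \<nu> become variables.
  Nothing here prevents capture, so the variables have to be chosen outside the formula.\<close>

fun gen_tm :: "('c \<Rightarrow> 'v option) \<Rightarrow> ('f, 'v, 'c) tm \<Rightarrow> ('f, 'v, 'c) tm" where
  "gen_tm \<nu> (Var v) = Var v"
| "gen_tm \<nu> (Par c) = (case \<nu> c of None \<Rightarrow> Par c | Some v \<Rightarrow> Var v)"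
| "gen_tm \<nu> (Fn f ts) = Fn f (map (gen_tm \<nu>) ts)"

fun gen_fm :: "('c \<Rightarrow> 'v option) \<Rightarrow> ('f, 'r, 'v, 'c) fm \<Rightarrow> ('f, 'r, 'v, 'c) fm" where
  "gen_fm \<nu> (Eq t u) = Eq (gen_tm \<nu> t) (gen_tm \<nu> u)"
| "gen_fm \<nu> (Rel r ts) = Rel r (map (gen_tm \<nu>) ts)"
| "gen_fm \<nu> (Neg \<phi>) = Neg (gen_fm \<nu> \<phi>)"
| "gen_fm \<nu> (Conj \<phi> \<psi>) = Conj (gen_fm \<nu> \<phi>) (gen_fm \<nu> \<psi>)"
| "gen_fm \<nu> (Ex v \<phi>) = Ex v (gen_fm \<nu> \<phi>)"

lemma inst_gen_tm:
  assumes "tvars t \<subseteq> V" "ran \<nu> \<inter> V = {}"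
    and "\<And>c. c \<in> tpars t \<Longrightarrow> h' c = (case \<nu> c of None \<Rightarrow> h c | Some v \<Rightarrow> e v)"
  shows "inst_tm V e (map_tm id h (gen_tm \<nu> t)) = map_tm id h' t"
  using assms
proof (induction t)
  case (Fn f ts)
  have "inst_tm V e (map_tm id h (gen_tm \<nu> t)) = map_tm id h' t" if "t \<in> set ts" for t
  proof (rule Fn.IH)
    show "h' c = (case \<nu> c of None \<Rightarrow> h c | Some v \<Rightarrow> e v)" if "c \<in> tpars t" for c
      by (rule Fn.prems(3)) (use that \<open>t \<in> set ts\<close> in auto)
  qed (use Fn.prems(1,2) that in auto)
  then show ?case by (simp add: id_def)
qed (auto simp: ran_def split: option.splits)

text \<open>Turning parameters into variables and then filling these by \<open>e\<close> amounts to
  a change of parameters. The range of \<nu> must avoid \<open>V\<close>, or the new variables would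
  not be filled, and the variables of \<phi>, or a quantifier would capture them. The map
  \<open>h\<close> acts on the parameters that stay.\<close>

lemma inst_gen_fm:
  assumes "fv \<phi> \<subseteq> V" "ran \<nu> \<inter> (V \<union> fvars \<phi>) = {}"
    and "\<And>c. c \<in> pars \<phi> \<Longrightarrow> h' c = (case \<nu> c of None \<Rightarrow> h c | Some v \<Rightarrow> e v)"
  shows "inst_fm V e (map_fm id h (gen_fm \<nu> \<phi>)) = map_fm id h' \<phi>"
  using assms
proof (induction \<phi> arbitrary: V)
  case (Eq t u)
  have "inst_tm V e (map_tm id h (gen_tm \<nu> s)) = map_tm id h' s" if "s \<in> {t, u}" for s
    by (rule inst_gen_tm) (use Eq that in auto)
  then show ?case by (simp add: id_def)
next
  case (Rel r ts)
  have "inst_tm V e (map_tm id h (gen_tm \<nu> t)) = map_tm id h' t" if "t \<in> set ts" for t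
  proof (rule inst_gen_tm)
    show "h' c = (case \<nu> c of None \<Rightarrow> h c | Some v \<Rightarrow> e v)" if "c \<in> tpars t" for c
      by (rule Rel.prems(3)) (use that \<open>t \<in> set ts\<close> in auto)
  qed (use Rel.prems(1,2) that in auto)
  then show ?case by (simp add: id_def)
next
  case (Neg \<phi>)
  then show ?case by simp
next
  case (Conj \<phi>1 \<phi>2)
  have "ran \<nu> \<inter> (V \<union> fvars \<phi>1) = {}" "ran \<nu> \<inter> (V \<union> fvars \<phi>2) = {}"
    using Conj.prems(2) by auto
  then show ?case using Conj by simp
next
  case (Ex v \<phi>)
  have "fv \<phi> \<subseteq> insert v V" "ran \<nu> \<inter> (insert v V \<union> fvars \<phi>) = {}" using Ex.prems by auto
  then show ?case using Ex.IH[of "insert v V"] Ex.prems(3) by simp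
qed

lemma tvars_gen: "tvars (gen_tm \<nu> t) \<subseteq> tvars t \<union> {v. \<exists>c\<in>tpars t. \<nu> c = Some v}"
  by (induction t) (fastforce split: option.splits)+

lemma fv_gen: "fv (gen_fm \<nu> \<phi>) \<subseteq> fv \<phi> \<union> {v. \<exists>c\<in>pars \<phi>. \<nu> c = Some v}"
proof (induction \<phi>)
  case (Eq t u)
  then show ?case using tvars_gen[of \<nu> t] tvars_gen[of \<nu> u] by auto
next
  case (Rel r ts)
  then show ?case using tvars_gen[of \<nu>] by fastforce
qed auto

lemma tpars_gen: "tpars (gen_tm \<nu> t) = tpars t - dom \<nu>"
  by (induction t) (auto split: option.splits)

lemma pars_gen: "pars (gen_fm \<nu> \<phi>) = pars \<phi> - dom \<nu>"
  by (induction \<phi>) (auto simp: tpars_gen)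

lemma tm_srt_gen: "(\<And>c v. c \<in> tpars t \<Longrightarrow> \<nu> c = Some v \<Longrightarrow> snd v = \<sigma> c) \<Longrightarrow>
    tm_srt L \<sigma> (gen_tm \<nu> t) = tm_srt L \<sigma> t"
  by (cases t) (auto split: option.splits)

lemma wf_tm_gen: "(\<And>c v. c \<in> tpars t \<Longrightarrow> \<nu> c = Some v \<Longrightarrow> snd v = \<sigma> c) \<Longrightarrow>
    wf_tm L \<sigma> (gen_tm \<nu> t) \<longleftrightarrow> wf_tm L \<sigma> t"
proof (induction t)
  case (Fn f ts)
  have "\<forall>t\<in>set ts. tm_srt L \<sigma> (gen_tm \<nu> t) = tm_srt L \<sigma> t"
    using Fn.prems by (auto intro!: tm_srt_gen)
  moreover have "\<forall>t\<in>set ts. wf_tm L \<sigma> (gen_tm \<nu> t) \<longleftrightarrow> wf_tm L \<sigma> t"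
    by (intro ballI Fn.IH) (use Fn.prems in auto)
  ultimately show ?case by (auto simp: o_def cong: map_cong)
qed (auto split: option.splits)

lemma wf_fm_gen: "(\<And>c v. c \<in> pars \<phi> \<Longrightarrow> \<nu> c = Some v \<Longrightarrow> snd v = \<sigma> c) \<Longrightarrow>
    wf_fm L \<sigma> (gen_fm \<nu> \<phi>) \<longleftrightarrow> wf_fm L \<sigma> \<phi>"
proof (induction \<phi>)
  case (Rel r ts)
  have "\<forall>t\<in>set ts. tm_srt L \<sigma> (gen_tm \<nu> t) = tm_srt L \<sigma> t"
    using Rel.prems by (auto intro!: tm_srt_gen)
  moreover have "\<forall>t\<in>set ts. wf_tm L \<sigma> (gen_tm \<nu> t) \<longleftrightarrow> wf_tm L \<sigma> t"
    using Rel.prems by (auto intro!: wf_tm_gen)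
  ultimately show ?case by (auto simp: o_def cong: map_cong)
qed (auto simp: tm_srt_gen wf_tm_gen)

text \<open>
  The bound occurrences of \<open>y\<close> are first renamed away, so that \<open>y\<close> can stand for the parameter \<open>c\<close>.
  The equivalence is uniform in a map \<open>h\<close> of the remaining parameters.
\<close>

lemma abstract_param:
  fixes \<phi> :: "('f, 'r, 's, 'a) formula"
  assumes \<phi>: "\<phi> \<in> Fm L \<sigma> (insert c S) X" and y: "y \<notin> X" "snd y = \<sigma> c"
  obtains \<psi> where "\<psi> \<in> Fm L \<sigma> (S - {c}) (insert y X)"
    "\<And>(M :: ('f, 'r, 's, 'a) struct) h e.
      sat M e (map_fm id h \<phi>) \<longleftrightarrow> sat M (e(y := h c)) (map_fm id h \<psi>)"
proof -
  obtain k where k: "(k, snd y) \<notin> insert y (fvars \<phi>)"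
    using fresh_var[of "insert y (fvars \<phi>)"] finite_fvars[of \<phi>] by blast
  define z where "z = (k, snd y)"
  have z: "z \<notin> fvars \<phi>" "z \<noteq> y" "snd z = snd y" using k by (auto simp: z_def)
  \<comment> \<open>The swap is injective and respects sorts. As \<open>y\<close> is not free in
    \<phi> and \<open>z\<close> does not occur in it, only bound occurrences move.\<close>
  define \<rho> where "\<rho> = (\<lambda>v. if v = y then z else if v = z then y else v)"
  have inj: "inj \<rho>" by (auto simp: inj_def \<rho>_def)
  have sr: "snd (\<rho> v) = snd v" for v using z by (auto simp: \<rho>_def)
  define \<phi>' where "\<phi>' = map_fm \<rho> id \<phi>"
  have fvX: "fv \<phi> \<subseteq> X" using \<phi> by (auto simp: Fm_def)
  have yv: "y \<notin> fvars \<phi>'" using z(1,2) by (auto simp: \<phi>'_def fm.set_map \<rho>_def)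
  have "\<rho> v = v" if "v \<in> fv \<phi>" for v
    using that z fvX y fv_subset_fvars[of \<phi>] by (auto simp: \<rho>_def)
  then have fv': "fv \<phi>' = fv \<phi>" by (simp add: \<phi>'_def fv_rename inj)
  have wf': "wf_fm L \<sigma> \<phi>'" using \<phi> wf_fm_map[of \<rho> \<phi> \<sigma> id L] sr by (simp add: \<phi>'_def Fm_def)
  have p': "pars \<phi>' = pars \<phi>" by (simp add: \<phi>'_def fm.set_map)
  have s': "sat M e (map_fm id h \<phi>') \<longleftrightarrow> sat M e (map_fm id h \<phi>)" for M h e
  proof -
    have "map_fm id h \<phi>' = map_fm \<rho> id (map_fm id h \<phi>)"
      by (simp add: \<phi>'_def fm.map_comp o_def)
    moreover have "sat M (e \<circ> \<rho>) (map_fm id h \<phi>) \<longleftrightarrow> sat M e (map_fm id h \<phi>)"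
      by (rule sat_cong) (use \<open>\<And>v. v \<in> fv \<phi> \<Longrightarrow> \<rho> v = v\<close> in \<open>auto simp: fv_map_id\<close>)
    ultimately show ?thesis using sat_rename[OF inj sr] by metis
  qed
  define \<nu> where "\<nu> = [c \<mapsto> y]"
  define \<psi> where "\<psi> = gen_fm \<nu> \<phi>'"
  show ?thesis
  proof
    have "wf_fm L \<sigma> \<psi>" unfolding \<psi>_def
      by (subst wf_fm_gen) (use wf' y in \<open>auto simp: \<nu>_def split: if_splits\<close>)
    then show "\<psi> \<in> Fm L \<sigma> (S - {c}) (insert y X)"
      using \<phi> fv_gen[of \<nu> \<phi>'] fv'
      by (auto simp: Fm_def \<psi>_def pars_gen p' \<nu>_def split: if_splits)
    show "sat M e (map_fm id h \<phi>) \<longleftrightarrow> sat M (e(y := h c)) (map_fm id h \<psi>)"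
      for M :: "('f, 'r, 's, 'a) struct" and h e
    proof -
      have "inst_fm (fv \<phi>) (e(y := h c)) (map_fm id h \<psi>) = map_fm id h \<phi>'"
        unfolding \<psi>_def
        by (rule inst_gen_fm) (use fv' yv y fvX in \<open>auto simp: \<nu>_def\<close>)
      then have "sat M e (map_fm id h \<phi>') \<longleftrightarrow>
          sat M (\<lambda>v. if v \<in> fv \<phi> then e v else (e(y := h c)) v) (map_fm id h \<psi>)"
        by (metis sat_inst)
      also have "\<dots> \<longleftrightarrow> sat M (e(y := h c)) (map_fm id h \<psi>)"
        by (rule sat_cong) (use y fvX in auto)
      finally show ?thesis using s' by metis
    qed
  qed
qed

lemma val_update: "v \<notin> tvars t \<Longrightarrow> val M (e(v := a)) t = val M e t"
  by (rule val_cong) auto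

section \<open>Substitution\<close>

fun subst_tm :: "('v \<Rightarrow> ('f, 'v, 'c) tm) \<Rightarrow> ('f, 'v, 'c) tm \<Rightarrow> ('f, 'v, 'c) tm" where
  "subst_tm \<theta> (Var v) = \<theta> v"
| "subst_tm \<theta> (Par c) = Par c"
| "subst_tm \<theta> (Fn f ts) = Fn f (map (subst_tm \<theta>) ts)"

lemma val_subst: "val M e (subst_tm \<theta> t) = val M (\<lambda>v. val M e (\<theta> v)) t"
  by (induction t) (auto intro!: arg_cong[where f="fint M _"])

lemma tvars_subst: "tvars (subst_tm \<theta> t) = (\<Union>v\<in>tvars t. tvars (\<theta> v))"
  by (induction t) auto

lemma tpars_subst: "tpars (subst_tm \<theta> t) = tpars t \<union> (\<Union>v\<in>tvars t. tpars (\<theta> v))"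
  by (induction t) auto

lemma tm_srt_subst: "(\<And>v. v \<in> tvars t \<Longrightarrow> tm_srt L \<sigma> (\<theta> v) = snd v) \<Longrightarrow>
    tm_srt L \<sigma> (subst_tm \<theta> t) = tm_srt L \<sigma> t"
  by (cases t) auto

lemma wf_tm_subst: "(\<And>v. v \<in> tvars t \<Longrightarrow> wf_tm L \<sigma> (\<theta> v) \<and> tm_srt L \<sigma> (\<theta> v) = snd v) \<Longrightarrow>
    wf_tm L \<sigma> t \<Longrightarrow> wf_tm L \<sigma> (subst_tm \<theta> t)"
proof (induction t)
  case (Fn f ts)
  have "\<forall>t\<in>set ts. tm_srt L \<sigma> (subst_tm \<theta> t) = tm_srt L \<sigma> t"
    using Fn.prems by (auto intro!: tm_srt_subst)
  moreover have "\<forall>t\<in>set ts. wf_tm L \<sigma> (subst_tm \<theta> t)"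
    by (intro ballI Fn.IH) (use Fn.prems in auto)
  ultimately show ?case using Fn.prems by (auto simp: o_def cong: map_cong)
qed auto

text \<open>A relation, because the result depends on the renaming chosen for bound variables. The
  bounds on variables and parameters serve to place the result in a set \<open>Fm\<close>.\<close>

definition subst_of where
  "subst_of L \<sigma> \<theta> \<phi> \<psi> \<longleftrightarrow> wf_fm L \<sigma> \<psi> \<and> fv \<psi> \<subseteq> (\<Union>v\<in>fv \<phi>. tvars (\<theta> v)) \<and>
    pars \<psi> \<subseteq> pars \<phi> \<union> (\<Union>v\<in>fv \<phi>. tpars (\<theta> v)) \<and>
    (\<forall>M e. sat M e \<psi> = sat M (\<lambda>v. val M e (\<theta> v)) \<phi>)"

lemma subst_ofD:
  assumes "subst_of L \<sigma> \<theta> \<phi> \<psi>"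
  shows "wf_fm L \<sigma> \<psi>" "fv \<psi> \<subseteq> (\<Union>v\<in>fv \<phi>. tvars (\<theta> v))"
    "pars \<psi> \<subseteq> pars \<phi> \<union> (\<Union>v\<in>fv \<phi>. tpars (\<theta> v))"
    "sat M e \<psi> = sat M (\<lambda>v. val M e (\<theta> v)) \<phi>"
  using assms unfolding subst_of_def by simp_all

lemma subst_ex:
  assumes "wf_fm L \<sigma> \<phi>" "\<forall>v\<in>fv \<phi>. wf_tm L \<sigma> (\<theta> v) \<and> tm_srt L \<sigma> (\<theta> v) = snd v"
  shows "\<exists>\<psi>. subst_of L \<sigma> \<theta> \<phi> \<psi>"
  using assms
proof (induction \<phi> arbitrary: \<theta>)
  case (Eq t u)
  have "subst_of L \<sigma> \<theta> (Eq t u) (Eq (subst_tm \<theta> t) (subst_tm \<theta> u))"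
  proof -
    have "wf_tm L \<sigma> (subst_tm \<theta> r) \<and> tm_srt L \<sigma> (subst_tm \<theta> r) = tm_srt L \<sigma> r" if "r \<in> {t, u}" for r
      by (intro conjI wf_tm_subst tm_srt_subst) (use Eq that in auto)
    then show ?thesis using Eq.prems
      by (simp add: subst_of_def val_subst tvars_subst tpars_subst) blast
  qed
  then show ?case ..
next
  case (Rel r ts)
  have "\<forall>t\<in>set ts. tm_srt L \<sigma> (subst_tm \<theta> t) = tm_srt L \<sigma> t"
    using Rel.prems by (auto intro!: tm_srt_subst)
  moreover have "\<forall>t\<in>set ts. wf_tm L \<sigma> (subst_tm \<theta> t)"
    using Rel.prems by (auto intro!: wf_tm_subst)
  ultimately have "wf_fm L \<sigma> (Rel r (map (subst_tm \<theta>) ts))"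
    using Rel.prems by (auto simp: o_def cong: map_cong)
  then have "subst_of L \<sigma> \<theta> (Rel r ts) (Rel r (map (subst_tm \<theta>) ts))"
    unfolding subst_of_def by (simp add: val_subst tvars_subst tpars_subst o_def) blast
  then show ?case ..
next
  case (Neg \<phi>)
  have p: "wf_fm L \<sigma> \<phi>" "\<forall>v\<in>fv \<phi>. wf_tm L \<sigma> (\<theta> v) \<and> tm_srt L \<sigma> (\<theta> v) = snd v"
    using Neg.prems by simp_all
  from Neg.IH[OF p] obtain \<psi> where "subst_of L \<sigma> \<theta> \<phi> \<psi>" ..
  then have "subst_of L \<sigma> \<theta> (Neg \<phi>) (Neg \<psi>)"
    unfolding subst_of_def by (simp only: fv.simps fm.set wf_fm.simps sat.simps simp_thms)
  then show ?case ..
next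
  case (Conj \<phi>1 \<phi>2)
  have p: "wf_fm L \<sigma> \<phi>1" "\<forall>v\<in>fv \<phi>1. wf_tm L \<sigma> (\<theta> v) \<and> tm_srt L \<sigma> (\<theta> v) = snd v"
      "wf_fm L \<sigma> \<phi>2" "\<forall>v\<in>fv \<phi>2. wf_tm L \<sigma> (\<theta> v) \<and> tm_srt L \<sigma> (\<theta> v) = snd v"
    using Conj.prems by simp_all
  from Conj.IH(1)[OF p(1,2)] obtain \<psi>1 where 1: "subst_of L \<sigma> \<theta> \<phi>1 \<psi>1" ..
  from Conj.IH(2)[OF p(3,4)] obtain \<psi>2 where 2: "subst_of L \<sigma> \<theta> \<phi>2 \<psi>2" ..
  have "subst_of L \<sigma> \<theta> (Conj \<phi>1 \<phi>2) (Conj \<psi>1 \<psi>2)"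
    unfolding subst_of_def
  proof (intro conjI allI)
    show "wf_fm L \<sigma> (Conj \<psi>1 \<psi>2)" using subst_ofD(1)[OF 1] subst_ofD(1)[OF 2] by simp
    show "fv (Conj \<psi>1 \<psi>2) \<subseteq> (\<Union>v\<in>fv (Conj \<phi>1 \<phi>2). tvars (\<theta> v))"
      using Un_mono[OF subst_ofD(2)[OF 1] subst_ofD(2)[OF 2]] by (simp only: fv.simps UN_Un)
    show "pars (Conj \<psi>1 \<psi>2) \<subseteq> pars (Conj \<phi>1 \<phi>2) \<union> (\<Union>v\<in>fv (Conj \<phi>1 \<phi>2). tpars (\<theta> v))"
      using Un_mono[OF subst_ofD(3)[OF 1] subst_ofD(3)[OF 2]]
      by (simp only: fv.simps fm.set UN_Un Un_ac)
    show "sat M e (Conj \<psi>1 \<psi>2) = sat M (\<lambda>v. val M e (\<theta> v)) (Conj \<phi>1 \<phi>2)" for M e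
      by (simp only: sat.simps subst_ofD(4)[OF 1] subst_ofD(4)[OF 2])
  qed
  then show ?case ..
next
  case (Ex x \<phi>)
  let ?V = "\<Union>v\<in>fv (Ex x \<phi>). tvars (\<theta> v)"
  have "finite ?V" using finite_fv[of "Ex x \<phi>"] finite_tvars by blast
  from fresh_var[OF this] obtain k where k: "(k, snd x) \<notin> ?V" ..
  \<comment> \<open>The bound variable is replaced by one that occurs in no term substituted into
    the body, so nothing is captured.\<close>
  define w where "w = (k, snd x)"
  have w: "w \<notin> ?V" "snd w = snd x" using k by (auto simp: w_def)
  define \<theta>' where "\<theta>' = \<theta>(x := Var w)"
  have 1: "wf_fm L \<sigma> \<phi>" using Ex.prems by simp
  have 2: "\<forall>v\<in>fv \<phi>. wf_tm L \<sigma> (\<theta>' v) \<and> tm_srt L \<sigma> (\<theta>' v) = snd v"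
  proof
    fix v assume v: "v \<in> fv \<phi>"
    show "wf_tm L \<sigma> (\<theta>' v) \<and> tm_srt L \<sigma> (\<theta>' v) = snd v"
    proof (cases "v = x")
      case True
      then show ?thesis using Ex.prems(1) w(2) by (simp add: \<theta>'_def)
    next
      case False
      then show ?thesis using Ex.prems(2) v by (simp add: \<theta>'_def)
    qed
  qed
  from Ex.IH[OF 1 2] obtain \<psi> where \<psi>: "subst_of L \<sigma> \<theta>' \<phi> \<psi>" ..
  have s: "sat M (e(w := a)) \<psi> = sat M ((\<lambda>v. val M e (\<theta> v))(x := a)) \<phi>" for M e a
  proof -
    have "sat M (e(w := a)) \<psi> = sat M (\<lambda>v. val M (e(w := a)) (\<theta>' v)) \<phi>"
      using \<psi> by (rule subst_ofD)
    also have "\<dots> = sat M ((\<lambda>v. val M e (\<theta> v))(x := a)) \<phi>"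
    proof (rule sat_cong)
      fix v assume v: "v \<in> fv \<phi>"
      show "val M (e(w := a)) (\<theta>' v) = ((\<lambda>v. val M e (\<theta> v))(x := a)) v"
      proof (cases "v = x")
        case False
        then have "w \<notin> tvars (\<theta> v)" using w v by auto
        then show ?thesis using False by (simp add: val_update \<theta>'_def)
      qed (simp add: \<theta>'_def)
    qed
    finally show ?thesis .
  qed
  have t: "tvars (\<theta>' v) \<subseteq> insert w ?V" "tpars (\<theta>' v) \<subseteq> (\<Union>v\<in>fv (Ex x \<phi>). tpars (\<theta> v))"
    if "v \<in> fv \<phi>" for v
    by (cases "v = x", use that in \<open>auto simp: \<theta>'_def\<close>)+
  have *: "fv \<psi> \<subseteq> insert w ?V"
    by (rule subset_trans[OF subst_ofD(2)[OF \<psi>]], rule UN_least) (rule t(1))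
  have **: "pars \<psi> \<subseteq> pars \<phi> \<union> (\<Union>v\<in>fv (Ex x \<phi>). tpars (\<theta> v))"
    by (rule subset_trans[OF subst_ofD(3)[OF \<psi>]], rule Un_mono[OF subset_refl], rule UN_least) (rule t(2))
  have "subst_of L \<sigma> \<theta> (Ex x \<phi>) (Ex w \<psi>)"
    unfolding subst_of_def
  proof (intro conjI allI)
    show "wf_fm L \<sigma> (Ex w \<psi>)" using w(2) Ex.prems(1) subst_ofD(1)[OF \<psi>] by simp
    show "fv (Ex w \<psi>) \<subseteq> ?V" using * by (simp only: fv.simps) (rule Diff_subset_conv[THEN iffD2], simp only: insert_is_Un[symmetric])
    show "pars (Ex w \<psi>) \<subseteq> pars (Ex x \<phi>) \<union> (\<Union>v\<in>fv (Ex x \<phi>). tpars (\<theta> v))"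
      using ** by (simp only: fm.set)
    show "sat M e (Ex w \<psi>) = sat M (\<lambda>v. val M e (\<theta> v)) (Ex x \<phi>)" for M e
      by (simp only: sat.simps s w(2))
  qed
  then show ?case ..
qed

lemma subst_fm:
  assumes "wf_fm L \<sigma> \<phi>" "\<And>v. v \<in> fv \<phi> \<Longrightarrow> wf_tm L \<sigma> (\<theta> v) \<and> tm_srt L \<sigma> (\<theta> v) = snd v"
  obtains \<psi> where "wf_fm L \<sigma> \<psi>" "fv \<psi> \<subseteq> (\<Union>v\<in>fv \<phi>. tvars (\<theta> v))"
    "pars \<psi> \<subseteq> pars \<phi> \<union> (\<Union>v\<in>fv \<phi>. tpars (\<theta> v))"
    "\<And>M e. sat M e \<psi> \<longleftrightarrow> sat M (\<lambda>v. val M e (\<theta> v)) \<phi>"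
proof -
  from assms have 1: "wf_fm L \<sigma> \<phi>" "\<forall>v\<in>fv \<phi>. wf_tm L \<sigma> (\<theta> v) \<and> tm_srt L \<sigma> (\<theta> v) = snd v"
    by blast+
  from subst_ex[OF 1] obtain \<psi> where \<psi>: "subst_of L \<sigma> \<theta> \<phi> \<psi>" ..
  show ?thesis
  proof (rule that)
    show "sat M e \<psi> \<longleftrightarrow> sat M (\<lambda>v. val M e (\<theta> v)) \<phi>" for M e
      using \<psi> by (rule subst_ofD)
  qed (rule subst_ofD[OF \<psi>])+
qed

lemma map_inst_tm_gen: "map_tm id g (inst_tm V e t) = inst_tm V (g \<circ> e) (map_tm id g t)"
proof (induction t)
  case (Fn f ts)
  then show ?case by (simp add: id_def o_def)
qed auto

lemma map_inst_fm_gen: "map_fm id g (inst_fm V e \<phi>) = inst_fm V (g \<circ> e) (map_fm id g \<phi>)"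
proof (induction \<phi> arbitrary: V)
  case (Rel r ts)
  show ?case by (simp add: map_inst_tm_gen[unfolded id_def o_def] id_def o_def)
qed (simp_all add: map_inst_tm_gen)

text \<open>The empty conjunction: a true sentence that is available as soon as there is a sort
  \<open>s\<close>.\<close>

definition tt :: "'s \<Rightarrow> ('f, 'r, 's, 'a) formula" where
  "tt s = Neg (Ex (0, s) (Neg (Eq (Var (0, s)) (Var (0, s)))))"

fun conjs :: "'s \<Rightarrow> ('f, 'r, 's, 'a) formula list \<Rightarrow> ('f, 'r, 's, 'a) formula" where
  "conjs s [] = tt s"
| "conjs s (\<phi> # \<phi>s) = Conj \<phi> (conjs s \<phi>s)"

lemma sat_conjs [simp]: "sat M e (conjs s \<phi>s) \<longleftrightarrow> (\<forall>\<phi>\<in>set \<phi>s. sat M e \<phi>)"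
  by (induction \<phi>s) (auto simp: tt_def)

lemma sat1_conjs [simp]: "sat1 M a (conjs s \<phi>s) \<longleftrightarrow> (\<forall>\<phi>\<in>set \<phi>s. sat1 M a \<phi>)"
  by (simp add: sat1_def)

lemma sat1_simps [simp]:
  "sat1 M a (Neg \<phi>) \<longleftrightarrow> \<not> sat1 M a \<phi>"
  "sat1 M a (Conj \<phi> \<psi>) \<longleftrightarrow> sat1 M a \<phi> \<and> sat1 M a \<psi>"
  by (simp_all add: sat1_def)

lemma map_conjs: "map_fm id h (conjs s \<phi>s) = conjs s (map (map_fm id h) \<phi>s)"
  by (induction \<phi>s) (auto simp: tt_def)

lemma Fm_conjs: "s \<in> sorts L \<Longrightarrow> set \<phi>s \<subseteq> Fm L \<sigma> S X \<Longrightarrow> conjs s \<phi>s \<in> Fm L \<sigma> S X"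
  by (induction \<phi>s) (auto simp: tt_def Fm_def)

lemma Fm_simps [simp]:
  "Neg \<phi> \<in> Fm L \<sigma> S X \<longleftrightarrow> \<phi> \<in> Fm L \<sigma> S X"
  "Conj \<phi> \<psi> \<in> Fm L \<sigma> S X \<longleftrightarrow> \<phi> \<in> Fm L \<sigma> S X \<and> \<psi> \<in> Fm L \<sigma> S X"
  by (auto simp: Fm_def)

lemma Fm_mono: "S \<subseteq> S' \<Longrightarrow> X \<subseteq> X' \<Longrightarrow> Fm L \<sigma> S X \<subseteq> Fm L \<sigma> S' X'"
  by (auto simp: Fm_def)

lemma Fm_Ex: "\<phi> \<in> Fm L \<sigma> S (insert x X) \<Longrightarrow> snd x \<in> sorts L \<Longrightarrow> Ex x \<phi> \<in> Fm L \<sigma> S X"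
  by (auto simp: Fm_def)

lemma Fm_pars: "\<phi> \<in> Fm L \<sigma> S X \<Longrightarrow> pars \<phi> \<subseteq> T \<Longrightarrow> \<phi> \<in> Fm L \<sigma> T X"
  by (auto simp: Fm_def)

lemma realizes_mono: "realizes M s a \<Sigma> \<Longrightarrow> \<Delta> \<subseteq> \<Sigma> \<Longrightarrow> realizes M s a \<Delta>"
  by (auto simp: realizes_def)

lemma restr_mono: "S \<subseteq> T \<Longrightarrow> restr p S \<subseteq> restr p T"
  by (auto simp: restr_def)

section \<open>Saturated structures in countable languages\<close>

text \<open>No theory is fixed, because the locale is interpreted twice, for \<open>M\<close> and
  for \<open>M\<^sup>e\<^sup>q\<close>. Countability of the language leaves only countably many
  formulas over a countable set of parameters.\<close>

locale saturated_structure =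
  fixes L :: "('f, 'r, 's) language" and K :: "('f, 'r, 's, 'a) struct" and \<kappa> :: "'k rel"
  assumes language: "is_language L" and countable_lang: "countable_language L"
    and struct: "is_structure L K"
    and card_\<kappa>: "Card_order \<kappa>" "natLeq <o \<kappa>"
    and saturated: "saturated L \<kappa> K"
begin

abbreviation "U \<equiv> univ K"
abbreviation "F \<equiv> Fm L (srt K)"
abbreviation "elem \<equiv> elementary_map L K"

lemma srt_in_sorts: "a \<in> U \<Longrightarrow> srt K a \<in> sorts L"
  using struct by (auto simp: is_structure_def)

lemma infinite_\<kappa>: "infinite (Field \<kappa>)"
proof
  assume "finite (Field \<kappa>)"
  then have "|Field \<kappa>| <o |UNIV :: nat set|" by (simp add: finite_iff_ordLess_natLeq ordLess_ordIso_trans card_of_nat ordIso_symmetric)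
  moreover have "|Field \<kappa>| =o \<kappa>" using card_\<kappa>(1) card_of_Field_ordIso by blast
  ultimately have "\<kappa> <o natLeq"
    using card_of_nat ordIso_ordLess_trans ordIso_symmetric ordLess_ordIso_trans by blast
  then show False using card_\<kappa>(2) not_ordLess_ordLeq ordLess_imp_ordLeq by blast
qed

lemma small_countable:
  assumes "countable S" "S \<subseteq> U" shows "small \<kappa> K S"
proof -
  have "|S| \<le>o natLeq"
  proof (cases "finite S")
    case True
    then show ?thesis using finite_iff_ordLess_natLeq ordLess_imp_ordLeq by blast
  next
    case False
    obtain f :: "'a \<Rightarrow> nat" where "bij_betw f S UNIV"
      using countableE_infinite[OF assms(1) False] by blast
    then have "|S| =o |UNIV :: nat set|" using card_of_ordIso by blast
    then show ?thesis using card_of_nat ordIso_iff_ordLeq ordIso_transitive by blast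
  qed
  then show ?thesis using assms(2) card_\<kappa>(2) by (auto simp: small_def intro: ordLeq_ordLess_trans)
qed

lemma small_Un: "small \<kappa> K S \<Longrightarrow> small \<kappa> K T \<Longrightarrow> small \<kappa> K (S \<union> T)"
  unfolding small_def using card_of_Un_ordLess_infinite_Field[OF infinite_\<kappa> card_\<kappa>(1)] by blast

text \<open>Saturation with finite satisfiability expressed by elements: only one variable is free,
  so constant assignments suffice.\<close>

lemma realize_finite:
  assumes "small \<kappa> K S" "s \<in> sorts L" "\<Sigma> \<subseteq> F S {(k, s)}"
    and "\<And>G. G \<subseteq> \<Sigma> \<Longrightarrow> finite G \<Longrightarrow> \<exists>a. realizes K s a G"
  shows "\<exists>a. realizes K s a \<Sigma>"
proof -
  have "finitely_satisfiable K {(k, s)} \<Sigma>" unfolding finitely_satisfiable_def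
  proof (intro allI impI)
    fix G assume G: "G \<subseteq> \<Sigma> \<and> finite G"
    then obtain a where "realizes K s a G" using assms(4) by blast
    then show "\<exists>e. assigns K {(k, s)} e \<and> (\<forall>\<phi>\<in>G. sat K e \<phi>)"
      by (intro exI[of _ "\<lambda>_. a"]) (auto simp: realizes_def assigns_def sat1_def)
  qed
  then show ?thesis using saturated assms(1-3) unfolding saturated_def realizes_def
    by (metis snd_conv)
qed

lemma Fm_eq: "c \<in> S \<Longrightarrow> snd x = srt K c \<Longrightarrow> srt K c \<in> sorts L \<Longrightarrow> Eq (Var x) (Par c) \<in> F S {x}"
  by (auto simp: Fm_def)

section \<open>Elementary maps\<close>

lemma elem_range: "elem S g \<Longrightarrow> c \<in> S \<Longrightarrow> g c \<in> U \<and> srt K (g c) = srt K c"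
  by (simp add: elementary_map_def)

lemma elem_subset: "elem S g \<Longrightarrow> T \<subseteq> S \<Longrightarrow> elem T g"
  unfolding elementary_map_def using Fm_mono[of T S "{}" "{}" L "srt K"] by blast

lemma elem_id: "S \<subseteq> U \<Longrightarrow> elem S id"
  by (auto simp: elementary_map_def fm.map_id)

text \<open>A sentence has only finitely many parameters.\<close>

lemma elem_finite_char:
  assumes "\<And>T. T \<subseteq> S \<Longrightarrow> finite T \<Longrightarrow> elem T g" shows "elem S g"
  unfolding elementary_map_def
proof (intro conjI ballI)
  show "g b \<in> U" "srt K (g b) = srt K b" if "b \<in> S" for b
    using assms[of "{b}"] that elem_range[of "{b}" g b] by auto
  fix \<phi> assume \<phi>: "\<phi> \<in> F S {}"
  then have "elem (pars \<phi>) g" by (intro assms) (auto simp: Fm_def finite_pars)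
  then show "holds K \<phi> \<longleftrightarrow> holds K (map_fm id g \<phi>)"
    using Fm_pars[OF \<phi> subset_refl] by (auto simp: elementary_map_def)
qed

lemma elem_cong: "elem S g \<Longrightarrow> (\<And>c. c \<in> S \<Longrightarrow> g c = g' c) \<Longrightarrow> elem S g'"
proof -
  assume g: "elem S g" and eq: "\<And>c. c \<in> S \<Longrightarrow> g c = g' c"
  have "map_fm id g \<phi> = map_fm id g' \<phi>" if "\<phi> \<in> F S {}" for \<phi>
    by (rule fm.map_cong) (use that eq in \<open>auto simp: Fm_def\<close>)
  then show "elem S g'" using g eq by (auto simp: elementary_map_def)
qed

text \<open>The definition of elementary maps speaks of sentences only; substituting the values of
  the variables as parameters reduces to it.\<close>

lemma elem_sat:
  assumes g: "elem S g" and \<phi>: "\<phi> \<in> F S X" and e: "\<And>v. v \<in> X \<Longrightarrow> e v \<in> S \<and> srt K (e v) = snd v"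
  shows "sat K e \<phi> \<longleftrightarrow> sat K (g \<circ> e) (map_fm id g \<phi>)"
proof -
  let ?\<phi> = "inst_fm {} e \<phi>"
  have "?\<phi> \<in> F (S \<union> e ` (X - {})) (X \<inter> {})" by (rule Fm_inst[OF \<phi>]) (use e in auto)
  moreover have "S \<union> e ` (X - {}) = S" using e by auto
  ultimately have 1: "?\<phi> \<in> F S {}" by simp
  then have fv: "fv ?\<phi> = {}" "fv (map_fm id g ?\<phi>) = {}" by (auto simp: Fm_def fv_map_id)
  have "sat K e \<phi> \<longleftrightarrow> holds K ?\<phi>" by (simp add: holds_iff_sat[OF fv(1), of K e] sat_inst)
  also have "\<dots> \<longleftrightarrow> holds K (map_fm id g ?\<phi>)" using g 1 by (auto simp: elementary_map_def)
  also have "\<dots> \<longleftrightarrow> sat K e (map_fm id g ?\<phi>)" by (rule holds_iff_sat[OF fv(2)])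
  also have "\<dots> \<longleftrightarrow> sat K (g \<circ> e) (map_fm id g \<phi>)"
    unfolding map_inst_fm_gen sat_inst by (simp add: comp_def)
  finally show ?thesis .
qed

lemma elem_sat1:
  assumes "elem S g" "\<phi> \<in> F S {x}" "c \<in> S" "srt K c = snd x"
  shows "sat1 K c \<phi> \<longleftrightarrow> sat1 K (g c) (map_fm id g \<phi>)"
proof -
  have "sat K (\<lambda>_. c) \<phi> \<longleftrightarrow> sat K (g \<circ> (\<lambda>_. c)) (map_fm id g \<phi>)"
    by (rule elem_sat[OF assms(1,2)]) (use assms in auto)
  then show ?thesis by (simp add: sat1_def o_def)
qed

text \<open>Once \<open>c\<close> is abstracted to a variable, a sentence over
  \<open>insert c S\<close> is \<psi>(c) for a formula \<psi> over \<open>S\<close>. As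
  \<open>c\<close> is not in \<open>S\<close>, changing \<open>g\<close> at \<open>c\<close> does
  not affect \<psi>.\<close>

lemma elem_insert:
  assumes g: "elem S g" and c: "c \<notin> S" and c': "c' \<in> U" "srt K c' = srt K c"
    and eq: "\<And>\<phi>. \<phi> \<in> F S {(0, srt K c)} \<Longrightarrow> sat1 K c \<phi> \<longleftrightarrow> sat1 K c' (map_fm id g \<phi>)"
  shows "elem (insert c S) (g(c := c'))"
  unfolding elementary_map_def
proof (intro conjI ballI)
  show "(g(c := c')) b \<in> U" "srt K ((g(c := c')) b) = srt K b" if "b \<in> insert c S" for b
    using that c' elem_range[OF g] by auto
  fix \<phi> assume \<phi>: "\<phi> \<in> F (insert c S) {}"
  let ?x = "(0 :: nat, srt K c)"
  obtain \<psi> where \<psi>: "\<psi> \<in> F (S - {c}) {?x}"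
    and s: "\<And>(M :: ('f, 'r, 's, 'a) struct) h e. sat M e (map_fm id h \<phi>) \<longleftrightarrow> sat M (e(?x := h c)) (map_fm id h \<psi>)"
    by (rule abstract_param[OF \<phi>, of ?x]) auto
  have fv: "fv \<phi> = {}" "fv \<psi> \<subseteq> {?x}" using \<phi> \<psi> by (auto simp: Fm_def)
  have F: "\<psi> \<in> F S {?x}" using \<psi> Fm_mono[of "S - {c}" S "{?x}" "{?x}" L "srt K"] by blast
  have "holds K \<phi> \<longleftrightarrow> sat1 K c \<psi>"
    using s[of K "\<lambda>_. c" id] holds_iff_sat[OF fv(1), of K "\<lambda>_. c"]
    by (simp add: fm.map_id sat_iff_sat1[OF fv(2)])
  also have "\<dots> \<longleftrightarrow> sat1 K c' (map_fm id g \<psi>)" by (rule eq[OF F])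
  also have "map_fm id g \<psi> = map_fm id (g(c := c')) \<psi>"
    by (rule fm.map_cong) (use \<psi> in \<open>auto simp: Fm_def\<close>)
  also have "sat1 K c' \<dots> \<longleftrightarrow> holds K (map_fm id (g(c := c')) \<phi>)"
    using s[of K "\<lambda>_. c" "g(c := c')"] holds_iff_sat[of "map_fm id (g(c := c')) \<phi>" K "\<lambda>_. c"]
    by (simp add: fv_map_id fv sat_iff_sat1[of _ ?x])
  finally show "holds K \<phi> \<longleftrightarrow> holds K (map_fm id (g(c := c')) \<phi>)" .
qed

text \<open>The type of \<open>c\<close> over \<open>S\<close>, moved by \<open>g\<close>, is
  finitely satisfiable because \<open>g\<close> preserves existential sentences; saturation provides
  \<open>c'\<close>.\<close>

lemma elem_extend:
  assumes g: "elem S g" and S: "countable S" and c: "c \<in> U"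
  obtains c' where "elem (insert c S) (g(c := c'))"
proof (cases "c \<in> S")
  case True
  then show ?thesis using that[of "g c"] g by (simp add: insert_absorb)
next
  case False
  let ?s = "srt K c" let ?x = "(0 :: nat, ?s)"
  have s: "?s \<in> sorts L" using c by (rule srt_in_sorts)
  define T where "T = {\<phi>\<in>F S {?x}. sat1 K c \<phi>}"
  have gS: "g ` S \<subseteq> U" using elem_range[OF g] by auto
  have mF: "map_fm id g \<phi> \<in> F (g ` S) {?x}" if "\<phi> \<in> F S {?x}" for \<phi>
    by (rule Fm_map[OF that]) (use elem_range[OF g] in auto)
  have "\<exists>a. realizes K ?s a (map_fm id g ` T)"
  proof (rule realize_finite[where S="g ` S"])
    show "small \<kappa> K (g ` S)" using S gS by (intro small_countable) auto
    show "map_fm id g ` T \<subseteq> F (g ` S) {?x}" using mF by (auto simp: T_def)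
    fix G assume "G \<subseteq> map_fm id g ` T" "finite G"
    then obtain G' where G': "G' \<subseteq> T" "finite G'" "G = map_fm id g ` G'"
      by (meson finite_subset_image)
    obtain l where l: "set l = G'" using finite_list G'(2) by blast
    let ?\<chi> = "Ex ?x (conjs ?s l)"
    have "conjs ?s l \<in> F S {?x}" by (rule Fm_conjs[OF s]) (use G' l in \<open>auto simp: T_def\<close>)
    then have F: "?\<chi> \<in> F S {}" using s by (intro Fm_Ex) auto
    have "(\<lambda>_. c)(?x := c) = (\<lambda>_. c)" by auto
    moreover have "sat K (\<lambda>_. c) (conjs ?s l)"
      using G' l by (auto simp: T_def sat1_def)
    ultimately have "sat K ((\<lambda>_. c)(?x := c)) (conjs ?s l)" by (simp only:)
    then have "sat K (\<lambda>_. c) ?\<chi>" using c by (simp only: sat.simps) auto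
    then have "holds K ?\<chi>" using F holds_iff_sat[of ?\<chi>] by (auto simp: Fm_def)
    then have "holds K (map_fm id g ?\<chi>)" using g F by (auto simp: elementary_map_def)
    then have "sat K (\<lambda>_. c) (Ex ?x (conjs ?s (map (map_fm id g) l)))"
      by (simp add: holds_def map_conjs[unfolded id_def] id_def)
    then obtain a where a: "a \<in> U" "srt K a = ?s"
      "\<And>\<phi>. \<phi> \<in> G' \<Longrightarrow> sat K ((\<lambda>_. c)(?x := a)) (map_fm id g \<phi>)"
      using l by (auto simp: id_def)
    have "sat1 K a (map_fm id g \<phi>)" if "\<phi> \<in> G'" for \<phi>
    proof -
      have "fv (map_fm id g \<phi>) \<subseteq> {?x}" using that G' by (auto simp: T_def Fm_def fv_map_id)
      from sat_iff_sat1[OF this, of K "(\<lambda>_. c)(?x := a)"] show ?thesis using a(3)[OF that] by simp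
    qed
    then show "\<exists>a. realizes K ?s a G" using a G' by (auto simp: realizes_def)
  qed (use s in auto)
  then obtain c' where c': "realizes K ?s c' (map_fm id g ` T)" ..
  have "elem (insert c S) (g(c := c'))"
  proof (rule elem_insert[OF g False])
    show "c' \<in> U" "srt K c' = srt K c" using c' by (auto simp: realizes_def)
    fix \<phi> assume \<phi>: "\<phi> \<in> F S {?x}"
    have "sat1 K c' (map_fm id g \<psi>)" if "\<psi> \<in> T" for \<psi> using c' that by (auto simp: realizes_def)
    from this[of \<phi>] this[of "Neg \<phi>"] show "sat1 K c \<phi> \<longleftrightarrow> sat1 K c' (map_fm id g \<phi>)"
      using \<phi> by (auto simp: T_def id_def)
  qed
  then show ?thesis by (rule that)
qed

lemma elem_extend_finite:
  assumes g: "elem S g" and S: "countable S" and E: "finite E" "E \<subseteq> U"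
  shows "\<exists>g'. elem (S \<union> E) g' \<and> (\<forall>c\<in>S. g' c = g c)"
  using E
proof (induction E rule: finite_induct)
  case empty
  then show ?case using g by auto
next
  case (insert c E)
  then obtain g' where g': "elem (S \<union> E) g'" "\<forall>c\<in>S. g' c = g c" by auto
  show ?case
  proof (cases "c \<in> S \<union> E")
    case True
    then show ?thesis using g' by (auto simp: insert_absorb)
  next
    case False
    obtain c' where "elem (insert c (S \<union> E)) (g'(c := c'))"
      using elem_extend[OF g'(1), of c] S insert by (auto simp: countable_finite)
    then have "elem (S \<union> insert c E) (g'(c := c'))" by simp
    moreover have "\<forall>d\<in>S. (g'(c := c')) d = g d" using g'(2) False by auto
    ultimately show ?thesis by blast
  qed
qed

section \<open>Global types\<close>

lemma global_type_sort: "global_type L K s p \<Longrightarrow> s \<in> sorts L"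
  by (simp add: global_type_def)

lemma global_type_Fm: "global_type L K s p \<Longrightarrow> \<phi> \<in> p \<Longrightarrow> \<phi> \<in> F U {(0, s)}"
  by (auto simp: global_type_def complete_type_def)

lemma global_type_finite:
  assumes "global_type L K s p" "G \<subseteq> p" "finite G"
  shows "\<exists>a. realizes K s a G"
proof -
  have "finitely_satisfiable K {(0, s)} p" using assms by (auto simp: global_type_def complete_type_def)
  then obtain e where e: "assigns K {(0, s)} e" "\<forall>\<phi>\<in>G. sat K e \<phi>"
    using assms unfolding finitely_satisfiable_def by blast
  have "sat1 K (e (0, s)) \<phi>" if "\<phi> \<in> G" for \<phi>
  proof -
    have "fv \<phi> \<subseteq> {(0, s)}" using global_type_Fm[OF assms(1)] assms(2) that by (auto simp: Fm_def)
    from sat_iff_sat1[OF this, of K e] show ?thesis using e that by auto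
  qed
  then show ?thesis using e by (auto simp: realizes_def assigns_def)
qed

lemma global_type_Neg:
  assumes "global_type L K s p" "\<phi> \<in> F U {(0, s)}"
  shows "Neg \<phi> \<in> p \<longleftrightarrow> \<phi> \<notin> p"
  using global_type_finite[OF assms(1), of "{\<phi>, Neg \<phi>}"] assms
  by (auto simp: realizes_def global_type_def complete_type_def)

lemma global_type_entails:
  assumes "global_type L K s p" "G \<subseteq> p" "finite G" "\<psi> \<in> F U {(0, s)}"
    and "\<And>a. realizes K s a G \<Longrightarrow> sat1 K a \<psi>"
  shows "\<psi> \<in> p"
proof (rule ccontr)
  assume "\<psi> \<notin> p"
  then have "Neg \<psi> \<in> p" using global_type_Neg assms by blast
  then obtain a where "realizes K s a (insert (Neg \<psi>) G)"
    using global_type_finite[OF assms(1), of "insert (Neg \<psi>) G"] assms by auto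
  then show False using assms(5)[of a] by (auto simp: realizes_def)
qed

lemma realizes_restr_iff:
  assumes "global_type L K s p" "realizes K s a (restr p S)" "\<phi> \<in> F S {(0, s)}" "S \<subseteq> U"
  shows "\<phi> \<in> p \<longleftrightarrow> sat1 K a \<phi>"
proof -
  have "\<phi> \<in> F U {(0, s)}" using assms(3,4) by (auto simp: Fm_def)
  then have "Neg \<phi> \<in> p \<longleftrightarrow> \<phi> \<notin> p" by (rule global_type_Neg[OF assms(1)])
  moreover have "sat1 K a \<psi>" if "\<psi> \<in> p" "\<psi> \<in> F S {(0, s)}" for \<psi>
    using assms(2) that by (auto simp: realizes_def restr_def Fm_def)
  from this[of \<phi>] this[of "Neg \<phi>"] calculation show ?thesis using assms(3) by auto
qed

lemma realizes_restrI:
  assumes "global_type L K s p" "a \<in> U" "srt K a = s" "S \<subseteq> U"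
    and "\<And>\<phi>. \<phi> \<in> F S {(0, s)} \<Longrightarrow> \<phi> \<in> p \<Longrightarrow> sat1 K a \<phi>"
  shows "realizes K s a (restr p S)"
proof -
  have "\<phi> \<in> F S {(0, s)}" if "\<phi> \<in> restr p S" for \<phi>
    using global_type_Fm[OF assms(1), of \<phi>] that by (auto simp: restr_def Fm_def)
  then show ?thesis using assms by (auto simp: realizes_def restr_def)
qed

lemma global_type_realized:
  assumes "global_type L K s p" "small \<kappa> K S"
  obtains a where "realizes K s a (restr p S)"
proof -
  have "\<exists>a. realizes K s a (restr p S)"
  proof (rule realize_finite[OF assms(2), of s _ 0])
    show "s \<in> sorts L" using assms(1) by (rule global_type_sort)
    show "restr p S \<subseteq> F S {(0, s)}"
      using global_type_Fm[OF assms(1)] by (auto simp: restr_def Fm_def)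
    show "\<exists>a. realizes K s a G" if "G \<subseteq> restr p S" "finite G" for G
      by (rule global_type_finite[OF assms(1)]) (use that in \<open>auto simp: restr_def\<close>)
  qed
  then show ?thesis using that by blast
qed

text \<open>Otherwise the type contains x = a, a formula with a single solution.\<close>

lemma nonalgebraic_notin:
  assumes "global_type L K s p" "nonalgebraic K s p" "S \<subseteq> U" "realizes K s a (restr p S)"
  shows "a \<notin> S"
proof
  assume "a \<in> S"
  let ?\<phi> = "Eq (Var (0, s)) (Par a)"
  have a: "a \<in> U" "srt K a = s" using assms(4) by (auto simp: realizes_def)
  have "?\<phi> \<in> F S {(0, s)}" using \<open>a \<in> S\<close> a srt_in_sorts[of a] by (auto simp: Fm_def)
  then have "?\<phi> \<in> p" using realizes_restr_iff[OF assms(1,4) _ assms(3)] by (auto simp: sat1_def)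
  then have "infinite {b. realizes K s b {?\<phi>}}" using assms(2) by (auto simp: nonalgebraic_def)
  moreover have "{b. realizes K s b {?\<phi>}} \<subseteq> {a}" by (auto simp: realizes_def sat1_def)
  ultimately show False using finite_subset by blast
qed

text \<open>Invariance is stated for formulas over \<open>A\<close> and tuples assigned to their
  variables; here it is needed for formulas with parameters. The parameters outside \<open>A\<close>
  are replaced by distinct new variables, so that \<phi> and its image under \<open>g\<close> become
  instances of one formula over \<open>A\<close>, at two tuples with the same type over
  \<open>A\<close>.\<close>

lemma invariant_elem:
  assumes inv: "invariant L K s p A" and S: "A \<subseteq> S" "S \<subseteq> U"
    and g: "elem S g" "\<And>c. c \<in> A \<Longrightarrow> g c = c" and \<phi>: "\<phi> \<in> F S {(0, s)}"
  shows "\<phi> \<in> p \<longleftrightarrow> map_fm id g \<phi> \<in> p"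
proof -
  let ?x = "(0 :: nat, s)"
  define P where "P = pars \<phi> - A"
  have P: "finite P" "P \<subseteq> S" using \<phi> by (auto simp: P_def finite_pars Fm_def)
  obtain idx :: "'a \<Rightarrow> nat" where idx: "inj_on idx P"
    using finite_imp_inj_to_nat_seg[OF P(1)] by auto
  have "finite (fst ` insert ?x (fvars \<phi>))" by (simp add: finite_fvars)
  then obtain N where N: "\<And>k. k \<in> fst ` insert ?x (fvars \<phi>) \<Longrightarrow> k < N"
    using finite_nat_set_iff_bounded by meson
  \<comment> \<open>Indices from \<open>N\<close> on do not occur in \<phi>, and \<open>idx\<close>
    is injective on \<open>P\<close>, so \<open>b\<close> inverts \<nu>.\<close>
  define \<nu> where "\<nu> = (\<lambda>c. if c \<in> P then Some (N + idx c, srt K c) else None)"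
  define b where "b = (\<lambda>v. SOME c. \<nu> c = Some v)"
  have b: "b v = c" if "\<nu> c = Some v" for c v
    unfolding b_def by (rule some_equality) (use that idx in \<open>auto simp: \<nu>_def inj_on_def split: if_splits\<close>)
  define \<phi>0 where "\<phi>0 = gen_fm \<nu> \<phi>"
  have fvx: "fv \<phi> \<subseteq> {?x}" using \<phi> by (auto simp: Fm_def)
  have fresh: "ran \<nu> \<inter> ({?x} \<union> fvars \<phi>) = {}"
  proof -
    have "fst v \<ge> N" if "v \<in> ran \<nu>" for v using that by (auto simp: \<nu>_def ran_def split: if_splits)
    moreover have "fst v < N" if "v \<in> {?x} \<union> fvars \<phi>" for v
      using N[of "fst v"] that by auto
    ultimately show ?thesis by (meson disjoint_iff leD)
  qed
  have *: "inst_fm {?x} (g' \<circ> b) \<phi>0 = map_fm id g' \<phi>" if g': "\<And>c. c \<in> A \<Longrightarrow> g' c = c" for g'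
  proof -
    have "inst_fm {?x} (g' \<circ> b) (map_fm id id \<phi>0) = map_fm id g' \<phi>"
      unfolding \<phi>0_def
    proof (rule inst_gen_fm[OF fvx fresh])
      fix c assume "c \<in> pars \<phi>"
      then show "g' c = (case \<nu> c of None \<Rightarrow> id c | Some v \<Rightarrow> (g' \<circ> b) v)"
        using b[of c] g' by (auto simp: \<nu>_def P_def split: option.splits if_splits)
    qed
    then show ?thesis by (simp add: fm.map_id)
  qed
  have srtb: "b v \<in> P \<and> srt K (b v) = snd v" if "v \<in> ran \<nu>" for v
    using that b by (auto simp: ran_def \<nu>_def split: if_splits)
  have fv0: "fv \<phi>0 - {?x} \<subseteq> ran \<nu>"
    using fv_gen[of \<nu> \<phi>] fvx by (auto simp: \<phi>0_def ran_def)
  have "wf_fm L (srt K) \<phi>0" unfolding \<phi>0_def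
    by (subst wf_fm_gen) (use \<phi> in \<open>auto simp: \<nu>_def Fm_def split: if_splits\<close>)
  then have \<phi>0: "\<phi>0 \<in> F A UNIV"
    by (auto simp: Fm_def \<phi>0_def pars_gen \<nu>_def P_def dom_def)
  let ?Y = "fv \<phi>0 - {?x}"
  have "assigns K ?Y b" "assigns K ?Y (g \<circ> b)"
    using fv0 srtb P S elem_range[OF g(1)] unfolding assigns_def o_def by (blast, metis subsetD)
  moreover have "same_type L K A ?Y b (g \<circ> b)" unfolding same_type_def
  proof
    fix \<psi> assume \<psi>: "\<psi> \<in> F A ?Y"
    have "sat K b \<psi> \<longleftrightarrow> sat K (g \<circ> b) (map_fm id g \<psi>)"
    proof (rule elem_sat[OF g(1)])
      show "\<psi> \<in> F S ?Y" using \<psi> S by (auto simp: Fm_def)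
      show "b v \<in> S \<and> srt K (b v) = snd v" if "v \<in> ?Y" for v
        using srtb[of v] fv0 that P by blast
    qed
    also have "map_fm id g \<psi> = map_fm id id \<psi>"
      by (rule fm.map_cong) (use \<psi> g in \<open>auto simp: Fm_def\<close>)
    finally show "sat K b \<psi> \<longleftrightarrow> sat K (g \<circ> b) \<psi>" by (simp only: fm.map_id)
  qed
  ultimately have "inst_fm {?x} b \<phi>0 \<in> p \<longleftrightarrow> inst_fm {?x} (g \<circ> b) \<phi>0 \<in> p"
    using inv \<phi>0 unfolding invariant_def Let_def by blast
  then show ?thesis using *[of id] *[of g] g(2) by (simp add: fm.map_id)
qed

text \<open>By invariance \<open>g\<close> carries the restriction of \<open>p\<close> to
  \<open>S\<close> to its restriction to the image of \<open>S\<close>, so a realization of the one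
  may be sent to any realization of the other.\<close>

lemma elem_insert_realizes:
  assumes p: "global_type L K s p" "nonalgebraic K s p" "invariant L K s p A"
    and S: "A \<subseteq> S" "S \<subseteq> U" and g: "elem S g" "\<And>c. c \<in> A \<Longrightarrow> g c = c"
    and c: "realizes K s c (restr p S)" and c': "realizes K s c' (restr p (g ` S))"
  shows "elem (insert c S) (g(c := c'))"
proof (rule elem_insert[OF g(1)])
  show "c \<notin> S" by (rule nonalgebraic_notin[OF p(1,2) S(2) c])
  show "c' \<in> U" "srt K c' = srt K c" using c c' by (auto simp: realizes_def)
  have gS: "g ` S \<subseteq> U" using elem_range[OF g(1)] by auto
  fix \<phi> assume "\<phi> \<in> F S {(0, srt K c)}"
  then have \<phi>: "\<phi> \<in> F S {(0, s)}" using c by (simp add: realizes_def)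
  then have "map_fm id g \<phi> \<in> F (g ` S) {(0, s)}"
    by (rule Fm_map) (use elem_range[OF g(1)] in auto)
  then show "sat1 K c \<phi> \<longleftrightarrow> sat1 K c' (map_fm id g \<phi>)"
    using realizes_restr_iff[OF p(1) c \<phi> S(2)] realizes_restr_iff[OF p(1) c' _ gS]
      invariant_elem[OF p(3) S g \<phi>] by blast
qed

end

section \<open>Well-orders by rank, and recursion on the natural numbers\<close>

text \<open>The well-orders that index Morley sequences are to live on the type of elements. A
  sequence without repetitions is therefore indexed by its own elements, ordered by a rank
  \<open>rk\<close>, with the identity as enumeration.\<close>

definition rank_order :: "('a \<Rightarrow> 'n) \<Rightarrow> 'n rel \<Rightarrow> 'a set \<Rightarrow> 'a rel" where
  "rank_order rk R S = {(x, y). x \<in> S \<and> y \<in> S \<and> (x = y \<or> (rk x, rk y) \<in> R)}"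

lemma Field_rank_order [simp]: "Field (rank_order rk R S) = S"
  by (auto simp: rank_order_def Field_def)

lemma underS_rank_order: "irrefl R \<Longrightarrow> x \<in> S \<Longrightarrow> underS (rank_order rk R S) x = {y \<in> S. (rk y, rk x) \<in> R}"
  by (auto simp: rank_order_def underS_def irrefl_def)

lemma Well_order_rank_order:
  assumes "inj_on rk S" "wf R" "trans R" "total R"
  shows "Well_order (rank_order rk R S)"
proof -
  have irr: "(a, a) \<notin> R" for a using assms(2) by (rule wf_not_refl)
  have "refl_on S (rank_order rk R S)" by (auto simp: rank_order_def refl_on_def)
  moreover have "trans (rank_order rk R S)"
    unfolding trans_def rank_order_def using transD[OF assms(3)] by auto
  moreover have "antisym (rank_order rk R S)"
    unfolding antisym_def rank_order_def using transD[OF assms(3)] irr by auto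
  moreover have "total_on S (rank_order rk R S)"
    using assms(1,4) by (auto simp: rank_order_def total_on_def inj_on_def)
  moreover have "wf (rank_order rk R S - Id)"
    by (rule wf_subset[OF wf_inv_image[OF assms(2), of rk]]) (auto simp: rank_order_def inv_image_def)
  moreover have "rank_order rk R S \<subseteq> S \<times> S" by (auto simp: rank_order_def)
  ultimately show ?thesis unfolding Field_rank_order order_on_defs by blast
qed

text \<open>Dependent choice in which the condition on a value sees its position and the set of
  earlier values, as suits types over what was chosen before.\<close>

lemma dependent_nat_course:
  fixes P :: "nat \<Rightarrow> 'a set \<Rightarrow> 'a \<Rightarrow> bool"
  assumes "\<And>f n. (\<And>m. m < n \<Longrightarrow> P m (f ` {..<m}) (f m)) \<Longrightarrow> \<exists>r. P n (f ` {..<n}) r"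
  shows "\<exists>f. \<forall>n. P n (f ` {..<n}) (f n)"
proof (rule dependent_wellorder_choice)
  fix r and f g :: "nat \<Rightarrow> 'a" and n :: nat
  assume "\<And>m. m < n \<Longrightarrow> f m = g m"
  then have "f ` {..<n} = g ` {..<n}" by (auto intro!: image_cong)
  then show "P n (f ` {..<n}) r = P n (g ` {..<n}) r" by simp
qed (rule assms)

section \<open>Stable types and Morley sequences over countable sets\<close>

locale small_base = saturated_structure L K \<kappa>
  for L :: "('f, 'r, 's) language" and K :: "('f, 'r, 's, 'a) struct" and \<kappa> :: "'k rel" +
  fixes A :: "'a set"
  assumes countable_A: "countable A" and A_sub: "A \<subseteq> univ K"
begin

definition base :: "'a set \<Rightarrow> bool" where
  "base D \<longleftrightarrow> countable D \<and> A \<subseteq> D \<and> D \<subseteq> U"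

text \<open>Generic stability supplies its own set of invariance; invariance over the fixed
  \<open>A\<close> is added because all bases contain \<open>A\<close>.\<close>

definition stable :: "'s \<Rightarrow> ('f, 'r, 's, 'a) formula set \<Rightarrow> bool" where
  "stable s p \<longleftrightarrow> generically_stable L \<kappa> K s p \<and> invariant L K s p A"

lemma base_insert: "base D \<Longrightarrow> a \<in> U \<Longrightarrow> base (insert a D)"
  by (simp add: base_def subset_insertI2)

lemma base_Un: "base D \<Longrightarrow> countable E \<Longrightarrow> E \<subseteq> U \<Longrightarrow> base (D \<union> E)"
  by (simp add: base_def le_supI1)

lemma base_small: "base D \<Longrightarrow> small \<kappa> K D"
  unfolding base_def by (intro small_countable) simp_all

lemma base_sub: "base D \<Longrightarrow> A \<subseteq> D \<and> D \<subseteq> U"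
  by (simp add: base_def)

lemma stableD:
  assumes "stable s p"
  shows "global_type L K s p" "nonalgebraic K s p" "invariant L K s p A" "s \<in> sorts L"
  using assms by (auto simp: stable_def generically_stable_def global_type_def)

lemma stable_realized:
  assumes "stable s p" "base D" shows "\<exists>a. realizes K s a (restr p D)"
  by (rule global_type_realized[OF stableD(1)[OF assms(1)] base_small[OF assms(2)]]) (rule exI)

lemma realizes_U: "realizes K s a \<Sigma> \<Longrightarrow> a \<in> U \<and> srt K a = s"
  by (simp add: realizes_def)

lemma realizes_restr_mono: "realizes K s a (restr p S) \<Longrightarrow> T \<subseteq> S \<Longrightarrow> realizes K s a (restr p T)"
  by (rule realizes_mono[OF _ restr_mono])

definition morley :: "('f, 'r, 's, 'a) formula set \<Rightarrow> 's \<Rightarrow> 'a set \<Rightarrow> (nat \<Rightarrow> 'a) \<Rightarrow> bool" where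
  "morley p s D b \<longleftrightarrow> (\<forall>n. realizes K s (b n) (restr p (D \<union> b ` {..<n})))"

lemma morley_exists:
  assumes "global_type L K s p" "small \<kappa> K D"
  obtains b where "morley p s D b"
proof -
  have "\<exists>b. \<forall>n :: nat. realizes K s (b n) (restr p (D \<union> b ` {..<n}))"
  proof (rule dependent_nat_course[of "\<lambda>n B r. realizes K s r (restr p (D \<union> B))"])
    fix f and n :: nat
    assume f: "\<And>m. m < n \<Longrightarrow> realizes K s (f m) (restr p (D \<union> f ` {..<m}))"
    have "f m \<in> U" if "m < n" for m using realizes_U[OF f[OF that]] ..
    then have "f ` {..<n} \<subseteq> U" by auto
    then have "small \<kappa> K (D \<union> f ` {..<n})"
      by (intro small_Un assms(2) small_countable) auto
    then show "\<exists>r. realizes K s r (restr p (D \<union> f ` {..<n}))"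
      by (rule global_type_realized[OF assms(1)]) (rule exI)
  qed
  then show ?thesis unfolding morley_def[symmetric] by (elim exE) (rule that)
qed

lemma morley_base:
  assumes "stable s p" "base D" obtains b where "morley p s D b"
  by (rule morley_exists[OF stableD(1)[OF assms(1)] base_small[OF assms(2)]])

lemma morley_U: "morley p s D b \<Longrightarrow> b n \<in> U \<and> srt K (b n) = s"
  unfolding morley_def by (rule realizes_U[of s "b n" "restr p (D \<union> b ` {..<n})"]) simp

lemma morley_subset: "morley p s D b \<Longrightarrow> D' \<subseteq> D \<Longrightarrow> morley p s D' b"
  unfolding morley_def by (rule allI, rule realizes_restr_mono[of s _ p "D \<union> _"], erule spec) auto

lemma morley_realizes: "morley p s D b \<Longrightarrow> realizes K s (b n) (restr p D)"
  unfolding morley_def by (rule realizes_restr_mono[of s _ p "D \<union> b ` {..<n}"]) auto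

lemma morley_new:
  assumes p: "global_type L K s p" "nonalgebraic K s p" and D: "D \<subseteq> U" and b: "morley p s D b"
  shows "inj b" "b n \<notin> D"
proof -
  have sub: "D \<union> b ` {..<n} \<subseteq> U" for n using D morley_U[OF b] by auto
  have new: "b n \<notin> D \<union> b ` {..<n}" for n
    by (rule nonalgebraic_notin[OF p sub]) (use b in \<open>auto simp: morley_def\<close>)
  then show "b n \<notin> D" by simp
  show "inj b"
  proof (rule linorder_injI)
    fix m n :: nat assume "m < n"
    then have "b m \<in> D \<union> b ` {..<n}" by simp
    then show "b m \<noteq> b n" using new[of n] by metis
  qed
qed

text \<open>The identity on \<open>D\<close> is extended by one term at a time, each step by
  invariance; finite character passes to the whole sequence.\<close>

lemma morley_unique:
  assumes p: "global_type L K s p" "nonalgebraic K s p" "invariant L K s p A"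
    and D: "A \<subseteq> D" "D \<subseteq> U" and b: "morley p s D b" and b': "morley p s D b'"
  obtains g where "elem (D \<union> range b) g" "\<And>c. c \<in> D \<Longrightarrow> g c = c" "\<And>n. g (b n) = b' n"
proof
  note new = morley_new[OF p(1,2) D(2) b]
  define g where "g = (\<lambda>c. if c \<in> D then c else b' (the_inv b c))"
  show gD: "g c = c" if "c \<in> D" for c using that by (simp add: g_def)
  show gb: "g (b n) = b' n" for n using new by (simp add: g_def the_inv_f_f)
  have *: "elem (D \<union> b ` {..<n}) g" for n
  proof (induction n)
    case 0
    show ?case using elem_cong[OF elem_id[OF D(2)], of g] gD by simp
  next
    case (Suc n)
    have im: "g ` (D \<union> b ` {..<n}) = D \<union> b' ` {..<n}"
      by (simp add: image_Un image_image gb gD)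
    have "elem (insert (b n) (D \<union> b ` {..<n})) (g(b n := b' n))"
    proof (rule elem_insert_realizes[OF p _ _ Suc])
      show "A \<subseteq> D \<union> b ` {..<n}" using D by blast
      show "D \<union> b ` {..<n} \<subseteq> U" using D morley_U[OF b] by auto
      show "g c = c" if "c \<in> A" for c using that D gD by auto
      show "realizes K s (b n) (restr p (D \<union> b ` {..<n}))" using b by (simp add: morley_def)
      show "realizes K s (b' n) (restr p (g ` (D \<union> b ` {..<n})))"
        using b' unfolding im by (simp add: morley_def)
    qed
    moreover have "g(b n := b' n) = g" using gb[of n] by (metis fun_upd_triv)
    moreover have "insert (b n) (D \<union> b ` {..<n}) = D \<union> b ` {..<Suc n}" by (auto simp: lessThan_Suc)
    ultimately show ?case by simp
  qed
  show "elem (D \<union> range b) g"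
  proof (rule elem_finite_char)
    fix T assume T: "T \<subseteq> D \<union> range b" "finite T"
    then have "finite (T - D)" "T - D \<subseteq> b ` UNIV" by auto
    from finite_subset_image[OF this] obtain N where N: "finite N" "T - D = b ` N" by auto
    from N(1) obtain n where "N \<subseteq> {..<n}" unfolding finite_nat_iff_bounded ..
    then have "T \<subseteq> D \<union> b ` {..<n}" using N by blast
    then show "elem T g" by (rule elem_subset[OF *])
  qed
qed

text \<open>
  Both halves of an alternating sequence of type \<open>\<omega> + \<omega>\<close> are built over the base of generic stability;
  the first half is a copy of the given sequence, along which the parameters of \<open>\<phi>\<close> are moved.
\<close>

lemma stable_all:
  assumes p: "stable s p" and D: "base D" and b: "morley p s D b"
    and \<phi>: "\<phi> \<in> F U {(0, s)}" and neg: "\<And>n. \<not> sat1 K (b n) \<phi>"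
  shows "\<phi> \<notin> p"
proof
  assume "\<phi> \<in> p"
  note gt = stableD(1-3)[OF p]
  obtain A' where A': "small \<kappa> K A'"
    and alt: "\<forall>(\<alpha> :: 'a rel) a. infinite (Field \<alpha>) \<and> morley_seq K s p A' \<alpha> a \<longrightarrow>
         (\<forall>\<phi>\<in>F U {(0, s)}. finite {i\<in>Field \<alpha>. sat1 K (a i) \<phi>} \<or> finite {i\<in>Field \<alpha>. \<not> sat1 K (a i) \<phi>})"
    using p unfolding stable_def generically_stable_def by (elim conjE exE) (rule that)
  have D': "A \<subseteq> D" "D \<subseteq> U" "countable D" using D by (auto simp: base_def)
  have sm: "small \<kappa> K (D \<union> A')" using base_small[OF D] A' by (rule small_Un)
  obtain b' where b': "morley p s (D \<union> A') b'" using morley_exists[OF gt(1) sm] .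
  obtain g where g: "elem (D \<union> range b) g" "\<And>c. c \<in> D \<Longrightarrow> g c = c" "\<And>n. g (b n) = b' n"
    by (rule morley_unique[OF gt D'(1,2) b morley_subset[OF b']]) auto
  define E where "E = pars \<phi>"
  have E: "finite E" "E \<subseteq> U" using \<phi> by (auto simp: E_def Fm_def finite_pars)
  let ?S = "D \<union> range b \<union> E"
  \<comment> \<open>The parameters of \<phi> are moved together with the sequence, so the image of
    \<phi> fails along the copy, while invariance keeps this image in \<open>p\<close>.\<close>
  obtain h where h: "elem ?S h" "\<forall>c\<in>D \<union> range b. h c = g c"
    using elem_extend_finite[OF g(1) _ E] D' by auto
  have S: "A \<subseteq> ?S" "?S \<subseteq> U" using D' E morley_U[OF b] by auto
  have \<phi>S: "\<phi> \<in> F ?S {(0, s)}" using \<phi> by (auto simp: Fm_def E_def)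
  define \<phi>' where "\<phi>' = map_fm id h \<phi>"
  have "h c = c" if "c \<in> A" for c using that h(2) g(2) D' by auto
  from invariant_elem[OF gt(3) S h(1) this \<phi>S] have "\<phi>' \<in> p" unfolding \<phi>'_def
    using \<open>\<phi> \<in> p\<close> by simp
  then have \<phi>'F: "\<phi>' \<in> F U {(0, s)}" by (rule global_type_Fm[OF gt(1)])
  have neg': "\<not> sat1 K (b' n) \<phi>'" for n
    using elem_sat1[OF h(1) \<phi>S, of "b n"] neg[of n] morley_U[OF b, of n] h(2) g(3)
    by (simp add: \<phi>'_def)
  have hE: "h ` E \<subseteq> U" using elem_range[OF h(1)] by auto
  have "countable (range b' \<union> h ` E)" using E(1) by (auto intro: countable_finite)
  then have "small \<kappa> K (range b' \<union> h ` E)"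
    using morley_U[OF b'] hE by (intro small_countable) auto
  then have sm2: "small \<kappa> K (D \<union> A' \<union> (range b' \<union> h ` E))" using sm by (rule small_Un[rotated])
  \<comment> \<open>Being generic also over the parameters of \<open>\<phi>'\<close>, which belongs
    to \<open>p\<close>, all terms of \<open>c\<close> satisfy it.\<close>
  obtain c where c: "morley p s (D \<union> A' \<union> (range b' \<union> h ` E)) c" using morley_exists[OF gt(1) sm2] .
  have pos: "sat1 K (c n) \<phi>'" for n
  proof -
    have "\<phi>' \<in> restr p (D \<union> A' \<union> (range b' \<union> h ` E))"
      using \<open>\<phi>' \<in> p\<close> by (auto simp: restr_def \<phi>'_def fm.set_map E_def)
    then show ?thesis using morley_realizes[OF c, of n] by (auto simp: realizes_def)
  qed
  have sub: "D \<union> A' \<subseteq> U" "D \<union> A' \<union> (range b' \<union> h ` E) \<subseteq> U"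
    using sm sm2 by (auto simp: small_def)
  note nb = morley_new[OF gt(1,2) sub(1) b'] and nc = morley_new[OF gt(1,2) sub(2) c]
  \<comment> \<open>Ranked lexicographically, all terms of the copy \<open>b'\<close> precede all
    terms of its continuation \<open>c\<close>.\<close>
  define rk :: "'a \<Rightarrow> nat \<times> nat"
    where "rk = (\<lambda>x. if x \<in> range b' then (0, the_inv b' x) else (1, the_inv c x))"
  have rkb: "rk (b' n) = (0, n)" for n using nb by (simp add: rk_def the_inv_f_f)
  have "c n \<notin> range b'" for n using nc(2)[of n] by blast
  then have rkc: "rk (c n) = (1, n)" for n using nc by (simp add: rk_def the_inv_f_f)
  let ?R = "less_than <*lex*> less_than" let ?F = "range b' \<union> range c"
  define \<alpha> where "\<alpha> = rank_order rk ?R ?F"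
  have wo: "Well_order \<alpha>" unfolding \<alpha>_def
    by (rule Well_order_rank_order)
      (auto simp: inj_on_def rkb rkc inj_eq[OF nb(1)] inj_eq[OF nc(1)] total_on_def trans_less_than)
  have F: "Field \<alpha> = ?F" by (simp add: \<alpha>_def)
  have irr: "irrefl ?R" by (auto simp: irrefl_def)
  have "realizes K s x (restr p (A' \<union> id ` underS \<alpha> x))" if "x \<in> ?F" for x
  proof (cases "x \<in> range b'")
    case True
    then obtain n where n: "x = b' n" by blast
    have u: "underS \<alpha> x \<subseteq> b' ` {..<n}"
      unfolding \<alpha>_def underS_rank_order[OF irr that] by (auto simp: n rkb rkc)
    have "realizes K s x (restr p (D \<union> A' \<union> b' ` {..<n}))"
      using b' unfolding n morley_def by (rule spec)
    then show ?thesis by (rule realizes_restr_mono) (use u in auto)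
  next
    case False
    with that have "x \<in> range c" by simp
    then obtain n where n: "x = c n" by (rule imageE)
    have u: "underS \<alpha> x \<subseteq> range b' \<union> c ` {..<n}"
      unfolding \<alpha>_def underS_rank_order[OF irr that] by (auto simp: n rkb rkc)
    have "realizes K s x (restr p (D \<union> A' \<union> (range b' \<union> h ` E) \<union> c ` {..<n}))"
      using c unfolding n morley_def by (rule spec)
    then show ?thesis by (rule realizes_restr_mono) (use u in auto)
  qed
  then have ms: "morley_seq K s p A' \<alpha> id" using wo F by (auto simp: morley_seq_def)
  have infb: "infinite (range b')" "infinite (range c)"
    using nb(1) nc(1) by (auto simp: range_inj_infinite)
  then have "infinite (Field \<alpha>)" using F by simp
  from alt[THEN spec, THEN spec, THEN mp, OF conjI[OF this ms], THEN bspec, OF \<phi>'F]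
  show False
  proof
    assume "finite {i\<in>Field \<alpha>. sat1 K (id i) \<phi>'}"
    moreover have "range c \<subseteq> {i\<in>Field \<alpha>. sat1 K (id i) \<phi>'}" using pos F by auto
    ultimately show False using infb finite_subset by blast
  next
    assume "finite {i\<in>Field \<alpha>. \<not> sat1 K (id i) \<phi>'}"
    moreover have "range b' \<subseteq> {i\<in>Field \<alpha>. \<not> sat1 K (id i) \<phi>'}" using neg' F by auto
    ultimately show False using infb finite_subset by blast
  qed
qed

text \<open>Otherwise the failing terms form a subsequence, again a Morley sequence, along which
  \<phi> fails throughout.\<close>

lemma stable_average:
  assumes p: "stable s p" and D: "base D" and b: "morley p s D b" and \<phi>: "\<phi> \<in> p"
  shows "finite {n. \<not> sat1 K (b n) \<phi>}"
proof (rule ccontr)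
  let ?S = "{n. \<not> sat1 K (b n) \<phi>}"
  assume inf: "infinite ?S"
  have sm: "strict_mono (enumerate ?S)" by (rule strict_mono_enumerate[OF inf])
  have "morley p s D (b \<circ> enumerate ?S)" unfolding morley_def
  proof
    fix n
    have sub: "(b \<circ> enumerate ?S) ` {..<n} \<subseteq> b ` {..<enumerate ?S n}"
      using strict_monoD[OF sm] by auto
    have "realizes K s ((b \<circ> enumerate ?S) n) (restr p (D \<union> b ` {..<enumerate ?S n}))"
      using b by (simp add: morley_def)
    then show "realizes K s ((b \<circ> enumerate ?S) n) (restr p (D \<union> (b \<circ> enumerate ?S) ` {..<n}))"
      by (rule realizes_restr_mono) (use sub in auto)
  qed
  then have "\<phi> \<notin> p"
  proof (rule stable_all[OF p D _ global_type_Fm[OF stableD(1)[OF p] \<phi>]])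
    show "\<not> sat1 K ((b \<circ> enumerate ?S) n) \<phi>" for n
      using enumerate_in_set[OF inf, of n] by simp
  qed
  then show False using \<phi> by contradiction
qed

section \<open>Definable relations and independent pairs\<close>

definition pair_asg :: "'a \<Rightarrow> 'a \<Rightarrow> nat \<times> 's \<Rightarrow> 'a" where
  "pair_asg a b = (\<lambda>v. if fst v = 0 then a else b)"

text \<open>Relations definable over \<open>D\<close>, kept as predicates on elements, so that
  arguments can be exchanged or turned into parameters without reasoning about variables.\<close>

definition drel :: "'a set \<Rightarrow> 's \<Rightarrow> 's \<Rightarrow> ('a \<Rightarrow> 'a \<Rightarrow> bool) \<Rightarrow> bool" where
  "drel D s t R \<longleftrightarrow> (\<exists>\<psi>\<in>F D {(0, s), (1, t)}. \<forall>a b. R a b \<longleftrightarrow> sat K (pair_asg a b) \<psi>)"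

lemma drelI: "\<psi> \<in> F D {(0, s), (1, t)} \<Longrightarrow> (\<And>a b. R a b \<longleftrightarrow> sat K (pair_asg a b) \<psi>) \<Longrightarrow> drel D s t R"
  unfolding drel_def by (rule bexI[of _ \<psi>]) simp_all

lemma drelE:
  assumes "drel D s t R"
  obtains \<psi> where "\<psi> \<in> F D {(0, s), (1, t)}" "\<And>a b. R a b \<longleftrightarrow> sat K (pair_asg a b) \<psi>"
proof -
  from assms obtain \<psi> where "\<psi> \<in> F D {(0, s), (1, t)}" "\<forall>a b. R a b \<longleftrightarrow> sat K (pair_asg a b) \<psi>"
    unfolding drel_def by (rule bexE)
  then show ?thesis by (intro that[of \<psi>]) simp_all
qed

lemma drel_mono: "drel D s t R \<Longrightarrow> D \<subseteq> D' \<Longrightarrow> drel D' s t R"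
  by (elim drelE, rule drelI, rule subsetD[OF Fm_mono]) auto

lemma drel_Neg: "drel D s t R \<Longrightarrow> drel D s t (\<lambda>a b. \<not> R a b)"
  by (elim drelE, rule drelI[of "Neg _"]) simp_all

lemma drel_swap:
  assumes "drel D s t R" "s \<in> sorts L" "t \<in> sorts L"
  shows "drel D t s (\<lambda>b a. R a b)"
proof -
  obtain \<psi> where \<psi>: "\<psi> \<in> F D {(0, s), (1, t)}" "\<And>a b. R a b \<longleftrightarrow> sat K (pair_asg a b) \<psi>"
    by (rule drelE[OF assms(1)]) (rule that)
  \<comment> \<open>On the two free variables this exchanges the indices 0 and 1 and keeps the
    sorts.\<close>
  define \<theta> :: "nat \<times> 's \<Rightarrow> ('f, nat \<times> 's, 'a) tm"
    where "\<theta> = (\<lambda>v. Var (if fst v = 0 then 1 else 0, snd v))"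
  have wf: "wf_fm L (srt K) \<psi>" using \<psi>(1) by (simp add: Fm_def)
  have "wf_tm L (srt K) (\<theta> v) \<and> tm_srt L (srt K) (\<theta> v) = snd v" if "v \<in> fv \<psi>" for v
  proof -
    have "v \<in> {(0, s), (1, t)}" using that \<psi>(1) by (auto simp: Fm_def)
    then show ?thesis using assms(2,3) by (auto simp: \<theta>_def)
  qed
  note \<theta> = this
  obtain \<chi> where \<chi>: "wf_fm L (srt K) \<chi>" "fv \<chi> \<subseteq> (\<Union>v\<in>fv \<psi>. tvars (\<theta> v))"
    "pars \<chi> \<subseteq> pars \<psi> \<union> (\<Union>v\<in>fv \<psi>. tpars (\<theta> v))"
    "\<And>M e. sat M e \<chi> \<longleftrightarrow> sat M (\<lambda>v. val M e (\<theta> v)) \<psi>" by (rule subst_fm[OF wf \<theta>], assumption) (rule that)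
  have "(\<Union>v\<in>fv \<psi>. tvars (\<theta> v)) \<subseteq> (\<Union>v\<in>{(0, s), (1, t)}. tvars (\<theta> v))"
    by (rule UN_mono) (use \<psi>(1) in \<open>auto simp: Fm_def\<close>)
  also have "\<dots> = {(1, s), (0, t)}" by (simp add: \<theta>_def insert_commute)
  finally have sub: "(\<Union>v\<in>fv \<psi>. tvars (\<theta> v)) \<subseteq> {(1, s), (0, t)}" .
  have "fv \<chi> \<subseteq> {(0, t), (1, s)}" using subset_trans[OF \<chi>(2) sub] by (simp only: insert_commute)
  moreover have "pars \<chi> \<subseteq> pars \<psi>" using \<chi>(3) by (simp add: \<theta>_def)
  then have "pars \<chi> \<subseteq> D" by (rule subset_trans) (use \<psi>(1) in \<open>simp add: Fm_def\<close>)
  ultimately have "\<chi> \<in> F D {(0, t), (1, s)}" using \<chi>(1) by (simp add: Fm_def)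
  moreover have "sat K (pair_asg b a) \<chi> \<longleftrightarrow> R a b" for a b
  proof -
    have "(\<lambda>v. val K (pair_asg b a) (\<theta> v)) = pair_asg a b"
      by (auto simp: \<theta>_def pair_asg_def fun_eq_iff)
    then show ?thesis by (simp add: \<chi>(4) \<psi>(2))
  qed
  ultimately show ?thesis by (intro drelI[of \<chi>]) simp_all
qed

text \<open>If \<phi> is \<phi>(x, b) over \<open>insert b D\<close> with \<open>b\<close> not in
  \<open>D\<close>, then \<open>map_fm id (mv b b') \<phi>\<close> is \<phi>(x, b').\<close>

abbreviation mv :: "'a \<Rightarrow> 'a \<Rightarrow> 'a \<Rightarrow> 'a" where "mv b b' \<equiv> id(b := b')"

lemma map_mv_id: "\<phi> \<in> F D X \<Longrightarrow> b \<notin> D \<Longrightarrow> map_fm id (mv b b') \<phi> = \<phi>"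
proof -
  assume "\<phi> \<in> F D X" "b \<notin> D"
  then have "map_fm id (mv b b') \<phi> = map_fm id id \<phi>"
    by (intro fm.map_cong) (auto simp: Fm_def)
  then show ?thesis by (simp only: fm.map_id)
qed

lemma mv_same: "map_fm id (mv b b) \<phi> = \<phi>"
proof -
  have "mv b b = id" by auto
  then show ?thesis by (simp only: fm.map_id)
qed

text \<open>Lets the second argument of \<phi>(x, b) vary, so that pairs over \<open>D\<close> can
  be compared for different choices of \<open>b\<close>. As \<open>b\<close> is not in
  \<open>D\<close>, abstracting it affects no other parameter.\<close>

lemma drel_of_fm:
  assumes "\<phi> \<in> F (insert b D) {(0, s)}" "b \<notin> D" "srt K b = t"
  shows "drel D s t (\<lambda>a b'. sat1 K a (map_fm id (mv b b') \<phi>))"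
proof -
  obtain \<psi> where \<psi>: "\<psi> \<in> F (D - {b}) (insert (1, t) {(0, s)})"
    and s: "\<And>(M :: ('f, 'r, 's, 'a) struct) h e.
      sat M e (map_fm id h \<phi>) \<longleftrightarrow> sat M (e((1, t) := h b)) (map_fm id h \<psi>)"
    by (rule abstract_param[OF assms(1), of "(1, t)"]) (use assms(3) in auto)
  have D: "D - {b} = D" "insert (1, t) {(0, s)} = {(0, s), (1, t)}" using assms(2) by auto
  have F: "\<psi> \<in> F D {(0, s), (1, t)}" using \<psi> unfolding D .
  have "sat1 K a (map_fm id (mv b b') \<phi>) \<longleftrightarrow> sat K (pair_asg a b') \<psi>" for a b'
  proof -
    have "sat1 K a (map_fm id (mv b b') \<phi>) \<longleftrightarrow> sat K ((\<lambda>_. a)((1, t) := mv b b' b)) (map_fm id (mv b b') \<psi>)"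
      unfolding sat1_def by (rule s)
    also have "map_fm id (mv b b') \<psi> = \<psi>" by (rule map_mv_id[OF F assms(2)])
    also have "sat K ((\<lambda>_. a)((1, t) := mv b b' b)) \<psi> \<longleftrightarrow> sat K (pair_asg a b') \<psi>"
      by (rule sat_cong) (use F in \<open>auto simp: Fm_def pair_asg_def\<close>)
    finally show ?thesis .
  qed
  then show ?thesis by (rule drelI[OF F])
qed

lemma fm_of_drel:
  assumes "drel D s t R" "b \<notin> D" "b \<in> U" "srt K b = t"
  obtains \<phi> where "\<phi> \<in> F (insert b D) {(0, s)}"
    "\<And>a b'. sat1 K a (map_fm id (mv b b') \<phi>) \<longleftrightarrow> R a b'"
proof -
  obtain \<psi> where \<psi>: "\<psi> \<in> F D {(0, s), (1, t)}" "\<And>a b. R a b \<longleftrightarrow> sat K (pair_asg a b) \<psi>"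
    by (rule drelE[OF assms(1)]) (rule that)
  define \<phi> where "\<phi> = inst_fm {(0, s)} (\<lambda>_. b) \<psi>"
  have "\<phi> \<in> F (D \<union> (\<lambda>_ :: nat \<times> 's. b) ` ({(0, s), (1, t)} - {(0, s)})) ({(0, s), (1, t)} \<inter> {(0, s)})"
    unfolding \<phi>_def by (rule Fm_inst[OF \<psi>(1)]) (use assms(4) in auto)
  then have F: "\<phi> \<in> F (insert b D) {(0, s)}" by auto
  have "sat1 K a (map_fm id (mv b b') \<phi>) \<longleftrightarrow> R a b'" for a b'
  proof -
    have "sat1 K a (map_fm id (mv b b') \<phi>) \<longleftrightarrow>
        sat K (\<lambda>v. if v \<in> {(0, s)} then a else (mv b b' \<circ> (\<lambda>_. b)) v) (map_fm id (mv b b') \<psi>)"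
      unfolding sat1_def \<phi>_def map_inst_fm_gen sat_inst by simp
    also have "map_fm id (mv b b') \<psi> = \<psi>" by (rule map_mv_id[OF \<psi>(1) assms(2)])
    also have "sat K (\<lambda>v. if v \<in> {(0, s)} then a else (mv b b' \<circ> (\<lambda>_. b)) v) \<psi> \<longleftrightarrow> sat K (pair_asg a b') \<psi>"
      by (rule sat_cong) (use \<psi>(1) in \<open>auto simp: Fm_def pair_asg_def\<close>)
    finally show ?thesis unfolding \<psi>(2) .
  qed
  then show ?thesis by (rule that[OF F])
qed

lemma drel_elem:
  assumes "drel D s t R" "elem S g" "D \<subseteq> S" "\<And>c. c \<in> D \<Longrightarrow> g c = c"
    and "a \<in> S" "srt K a = s" "b \<in> S" "srt K b = t"
  shows "R a b \<longleftrightarrow> R (g a) (g b)"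
proof -
  obtain \<psi> where \<psi>: "\<psi> \<in> F D {(0, s), (1, t)}" "\<And>a b. R a b \<longleftrightarrow> sat K (pair_asg a b) \<psi>"
    by (rule drelE[OF assms(1)]) (rule that)
  have F: "\<psi> \<in> F S {(0, s), (1, t)}" using \<psi>(1) assms(3) by (auto simp: Fm_def)
  have "sat K (pair_asg a b) \<psi> \<longleftrightarrow> sat K (g \<circ> pair_asg a b) (map_fm id g \<psi>)"
    by (rule elem_sat[OF assms(2) F]) (use assms in \<open>auto simp: pair_asg_def\<close>)
  also have "map_fm id g \<psi> = map_fm id id \<psi>"
    by (rule fm.map_cong) (use \<psi>(1) assms(4) in \<open>auto simp: Fm_def\<close>)
  also have "\<dots> = \<psi>" by (rule fm.map_id)
  also have "g \<circ> pair_asg a b = pair_asg (g a) (g b)" by (auto simp: pair_asg_def fun_eq_iff)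
  finally show ?thesis using \<psi>(2) by simp
qed

lemma elem_mv:
  assumes p: "stable s p" and D: "base D"
    and a: "realizes K s a (restr p D)" and a': "realizes K s a' (restr p D)"
  shows "elem (insert a D) (mv a a')"
  by (rule elem_insert_realizes[OF stableD(1-3)[OF p], where g=id])
    (use base_sub[OF D] a a' elem_id in auto)

text \<open>Uniqueness of realizations, applied to \<open>a\<close> over \<open>D\<close> and then
  to \<open>b\<close> over \<open>insert a D\<close>: independent pairs, chosen in this order, have
  one type over \<open>D\<close>.\<close>

lemma elem_mv2:
  assumes p: "stable s p" and q: "stable t q" and D: "base D"
    and a: "realizes K s a (restr p D)" "realizes K s a' (restr p D)"
    and b: "realizes K t b (restr q (insert a D))" "realizes K t b' (restr q (insert a' D))"
  shows "elem (insert b (insert a D)) (id(a := a', b := b'))" "a \<notin> D" "b \<notin> D" "b \<noteq> a"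
proof -
  have sub: "insert a D \<subseteq> U" "D \<subseteq> U" "A \<subseteq> D" using realizes_U[OF a(1)] base_sub[OF D] by auto
  show aD: "a \<notin> D" by (rule nonalgebraic_notin[OF stableD(1,2)[OF p] sub(2) a(1)])
  have "b \<notin> insert a D" by (rule nonalgebraic_notin[OF stableD(1,2)[OF q] sub(1) b(1)])
  then show "b \<notin> D" "b \<noteq> a" by auto
  have "mv a a' ` insert a D = insert a' D" using aD by auto
  then show "elem (insert b (insert a D)) (id(a := a', b := b'))"
  proof (intro elem_insert_realizes[OF stableD(1-3)[OF q] _ sub(1) elem_mv[OF p D a] _ b(1)])
    show "A \<subseteq> insert a D" using sub(3) by auto
    show "mv a a' c = c" if "c \<in> A" for c using that sub(3) aD by auto
    show "realizes K t b' (restr q (mv a a' ` insert a D))"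
      using b(2) \<open>mv a a' ` insert a D = insert a' D\<close> by (simp only:)
  qed
qed

lemma drel_mv2:
  assumes "stable s p" "stable t q" "base D"
    and "realizes K s a (restr p D)" "realizes K s a' (restr p D)"
    and "realizes K t b (restr q (insert a D))" "realizes K t b' (restr q (insert a' D))"
    and "drel D s t R"
  shows "R a b \<longleftrightarrow> R a' b'"
proof -
  note e = elem_mv2[OF assms(1-7)]
  have "R a b \<longleftrightarrow> R ((id(a := a', b := b')) a) ((id(a := a', b := b')) b)"
    by (rule drel_elem[OF assms(8) e(1)])
      (use e(2-4) realizes_U[OF assms(4)] realizes_U[OF assms(6)] in auto)
  then show ?thesis using e(4) by simp
qed

lemma invariant_mv:
  assumes p: "stable s p" and q: "stable t q" and D: "base D"
    and b: "realizes K t b (restr q D)" "realizes K t b' (restr q D)"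
    and \<phi>: "\<phi> \<in> F (insert b D) {(0, s)}"
  shows "\<phi> \<in> p \<longleftrightarrow> map_fm id (mv b b') \<phi> \<in> p"
proof (rule invariant_elem[OF stableD(3)[OF p] _ _ elem_mv[OF q D b] _ \<phi>])
  show "A \<subseteq> insert b D" "insert b D \<subseteq> U" using base_sub[OF D] realizes_U[OF b(1)] by auto
  have "b \<notin> D" by (rule nonalgebraic_notin[OF stableD(1,2)[OF q] _ b(1)]) (use base_sub[OF D] in auto)
  then show "mv b b' c = c" if "c \<in> A" for c using base_sub[OF D] that by auto
qed

text \<open>Let \<phi>(x, b) be in \<open>p\<close>. For a Morley sequence \<open>a'\<close> over
  \<open>D\<close> and \<open>b'\<close> generic over it, \<phi>(x, b') is in \<open>p\<close> by
  invariance, so some term \<open>a' n\<close> satisfies it by averaging; and the pairs (a, b) and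
  (a' n, b') have the same type over \<open>D\<close>.\<close>

lemma stable_symmetric:
  assumes p: "stable s p" and D: "base D"
    and a: "realizes K s a (restr p D)" and b: "realizes K s b (restr p (insert a D))"
  shows "realizes K s a (restr p (insert b D))"
proof (rule realizes_restrI[OF stableD(1)[OF p]])
  note aU = realizes_U[OF a] and bU = realizes_U[OF b]
  show "a \<in> U" "srt K a = s" using aU by auto
  show "insert b D \<subseteq> U" using bU base_sub[OF D] by auto
  have bD: "realizes K s b (restr p D)" by (rule realizes_restr_mono[OF b]) auto
  have bnD: "b \<notin> D" by (rule nonalgebraic_notin[OF stableD(1,2)[OF p] _ bD]) (use base_sub[OF D] in auto)
  fix \<phi> assume \<phi>: "\<phi> \<in> F (insert b D) {(0, s)}" "\<phi> \<in> p"
  obtain a' where a': "morley p s D a'" using morley_base[OF p D] .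
  have "range a' \<subseteq> U" using morley_U[OF a'] by auto
  then have "base (D \<union> range a')" by (intro base_Un[OF D]) simp_all
  from stable_realized[OF p this] obtain b' where b': "realizes K s b' (restr p (D \<union> range a'))" ..
  have b'D: "realizes K s b' (restr p D)" by (rule realizes_restr_mono[OF b']) auto
  define R where "R = (\<lambda>a b'. sat1 K a (map_fm id (mv b b') \<phi>))"
  have R: "drel D s s R" unfolding R_def by (rule drel_of_fm[OF \<phi>(1) bnD]) (use bU in simp)
  have "R a b \<longleftrightarrow> R (a' n) b'" for n
  proof (rule drel_mv2[OF p p D a morley_realizes[OF a'] b _ R])
    show "realizes K s b' (restr p (insert (a' n) D))" by (rule realizes_restr_mono[OF b']) auto
  qed
  moreover have "map_fm id (mv b b') \<phi> \<in> p" using invariant_mv[OF p p D bD b'D \<phi>(1)] \<phi>(2) by simp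
  from stable_average[OF p D a' this] have "finite {n. \<not> R (a' n) b'}" unfolding R_def .
  ultimately have "R a b" by (cases "R a b") simp_all
  then show "sat1 K a \<phi>" by (simp only: R_def mv_same)
qed

end

context small_base
begin

lemma stable_conjs:
  assumes p: "stable s p" and G: "finite G" "G \<subseteq> p"
  obtains \<theta> where "\<theta> \<in> p" "\<And>a. sat1 K a \<theta> \<longleftrightarrow> (\<forall>\<phi>\<in>G. sat1 K a \<phi>)" "pars \<theta> \<subseteq> \<Union> (pars ` G)"
proof -
  obtain l where l: "set l = G" using finite_list[OF G(1)] ..
  have "conjs s l \<in> F U {(0, s)}"
    by (rule Fm_conjs[OF stableD(4)[OF p]]) (use global_type_Fm[OF stableD(1)[OF p]] G l in auto)
  then have "conjs s l \<in> p"
    by (rule global_type_entails[OF stableD(1)[OF p] G(2,1)]) (simp add: l realizes_def)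
  moreover have "pars (conjs s l) \<subseteq> \<Union> (pars ` set l)" by (induction l) (auto simp: tt_def)
  ultimately show ?thesis by (intro that[of "conjs s l"]) (simp_all add: l)
qed

lemma stable_Neg: "stable s p \<Longrightarrow> \<phi> \<in> F U {(0, s)} \<Longrightarrow> Neg \<phi> \<in> p \<longleftrightarrow> \<phi> \<notin> p"
  by (rule global_type_Neg[OF stableD(1)])

lemma stable_realizes_iff:
  assumes "stable s p" "realizes K s a (restr p S)" "\<phi> \<in> F S {(0, s)}" "S \<subseteq> U"
  shows "\<phi> \<in> p \<longleftrightarrow> sat1 K a \<phi>"
  by (rule realizes_restr_iff[OF stableD(1)[OF assms(1)] assms(2-4)])

lemma stable_new:
  assumes "stable s p" "base D" "realizes K s a (restr p D)" shows "a \<notin> D"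
  by (rule nonalgebraic_notin[OF stableD(1,2)[OF assms(1)] _ assms(3)])
    (use base_sub[OF assms(2)] in simp)

lemma not_realizesE:
  assumes p: "stable s p" and "a \<in> U" "srt K a = s" "S \<subseteq> U" "\<not> realizes K s a (restr p S)"
  obtains \<phi> where "\<phi> \<in> F S {(0, s)}" "\<phi> \<in> p" "\<not> sat1 K a \<phi>"
  using realizes_restrI[OF stableD(1)[OF p] assms(2-4)] assms(5) that by metis

section \<open>Orthogonality\<close>

lemma not_finitely_satisfiable_insert:
  assumes "\<not> finitely_satisfiable K X (insert \<chi> r)"
  obtains G where "G \<subseteq> r" "finite G"
    "\<forall>e. assigns K X e \<longrightarrow> (\<forall>\<psi>\<in>G. sat K e \<psi>) \<longrightarrow> \<not> sat K e \<chi>"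
proof -
  obtain G where G: "G \<subseteq> insert \<chi> r" "finite G"
    "\<And>e. assigns K X e \<Longrightarrow> \<not> (\<forall>\<psi>\<in>G. sat K e \<psi>)"
    using assms unfolding finitely_satisfiable_def by metis
  show ?thesis
  proof (rule that[of "G - {\<chi>}"], goal_cases)
    case 3
    show ?case
    proof (intro allI impI notI)
      fix e assume e: "assigns K X e" "\<forall>\<psi>\<in>G - {\<chi>}. sat K e \<psi>" "sat K e \<chi>"
      then have "\<forall>\<psi>\<in>G. sat K e \<psi>" by (metis Diff_iff singletonD)
      then show False using G(3)[OF e(1)] by contradiction
    qed
  qed (use G in auto)
qed

text \<open>Lindenbaum's argument: a finitely satisfiable set that is maximal by Zorn's lemma
  decides every formula, since two finite subsets refuting \<phi> and its negation would have no
  common solution.\<close>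

lemma complete_extension:
  assumes \<Sigma>: "\<Sigma> \<subseteq> F U X" "finitely_satisfiable K X \<Sigma>"
  shows "\<exists>r. complete_type L K U X r \<and> \<Sigma> \<subseteq> r"
proof -
  let ?A = "{\<Delta>. \<Sigma> \<subseteq> \<Delta> \<and> \<Delta> \<subseteq> F U X \<and> finitely_satisfiable K X \<Delta>}"
  have "\<exists>r\<in>?A. \<forall>\<Delta>\<in>?A. r \<subseteq> \<Delta> \<longrightarrow> \<Delta> = r"
  proof (rule subset_Zorn_nonempty)
    show "?A \<noteq> {}" using \<Sigma> by auto
    fix C assume C: "C \<noteq> {}" "subset.chain ?A C"
    then have CA: "C \<subseteq> ?A" by (simp add: subset.chain_def)
    have "finitely_satisfiable K X (\<Union>C)" unfolding finitely_satisfiable_def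
    proof (intro allI impI)
      fix G assume G: "G \<subseteq> \<Union>C \<and> finite G"
      obtain B where B: "B \<in> C" "G \<subseteq> B"
        by (rule finite_subset_Union_chain[OF conjunct2[OF G] conjunct1[OF G] C]) (rule that)
      then have "finitely_satisfiable K X B" using CA by auto
      then show "\<exists>e. assigns K X e \<and> (\<forall>\<phi>\<in>G. sat K e \<phi>)"
        using B G unfolding finitely_satisfiable_def by simp
    qed
    moreover have "\<Sigma> \<subseteq> \<Union>C" using C(1) CA by auto
    moreover have "\<Union>C \<subseteq> F U X" using CA by auto
    ultimately show "\<Union>C \<in> ?A" by simp
  qed
  then obtain r where r: "r \<in> ?A" and max: "\<forall>\<Delta>\<in>?A. r \<subseteq> \<Delta> \<longrightarrow> \<Delta> = r" by (rule bexE)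
  have fs: "finitely_satisfiable K X r" and rF: "r \<subseteq> F U X" and \<Sigma>r: "\<Sigma> \<subseteq> r" using r by simp_all
  have nfs: "\<not> finitely_satisfiable K X (insert \<chi> r)" if \<chi>: "\<chi> \<in> F U X" "\<chi> \<notin> r" for \<chi>
  proof
    assume "finitely_satisfiable K X (insert \<chi> r)"
    then have "insert \<chi> r \<in> ?A" using rF \<Sigma>r \<chi>(1) by (simp add: subset_insertI2)
    from bspec[OF max this] have "insert \<chi> r = r" by (simp add: subset_insertI)
    then show False using \<chi>(2) by (metis insertI1)
  qed
  have "\<phi> \<in> r \<or> Neg \<phi> \<in> r" if \<phi>: "\<phi> \<in> F U X" for \<phi>
  proof (rule ccontr)
    assume "\<not> (\<phi> \<in> r \<or> Neg \<phi> \<in> r)"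
    then have no: "\<phi> \<notin> r" "Neg \<phi> \<notin> r" by simp_all
    obtain G where G: "G \<subseteq> r" "finite G"
      "\<forall>e. assigns K X e \<longrightarrow> (\<forall>\<psi>\<in>G. sat K e \<psi>) \<longrightarrow> \<not> sat K e \<phi>"
      by (rule not_finitely_satisfiable_insert[OF nfs[OF \<phi> no(1)]]) (rule that)
    have N: "Neg \<phi> \<in> F U X" using \<phi> by simp
    obtain H where H: "H \<subseteq> r" "finite H"
      "\<forall>e. assigns K X e \<longrightarrow> (\<forall>\<psi>\<in>H. sat K e \<psi>) \<longrightarrow> \<not> sat K e (Neg \<phi>)"
      by (rule not_finitely_satisfiable_insert[OF nfs[OF N no(2)]]) (rule that)
    have "G \<union> H \<subseteq> r \<and> finite (G \<union> H)" using G H by simp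
    with fs have "\<exists>e. assigns K X e \<and> (\<forall>\<psi>\<in>G \<union> H. sat K e \<psi>)"
      by (simp only: finitely_satisfiable_def)
    then obtain e where e: "assigns K X e" "\<forall>\<psi>\<in>G \<union> H. sat K e \<psi>" by (elim exE conjE)
    have "\<not> sat K e \<phi>" using G(3)[THEN spec, THEN mp, OF e(1)] e(2) by simp
    moreover have "\<not> sat K e (Neg \<phi>)" using H(3)[THEN spec, THEN mp, OF e(1)] e(2) by simp
    ultimately show False by simp
  qed
  then show ?thesis using \<Sigma>r fs rF by (intro exI[of _ r]) (simp add: complete_type_def)
qed

text \<open>Joint consistency of p(x), q(y) and R(x, y). Single formulas suffice, because complete
  types are closed under conjunction.\<close>

definition consistent_rel where
  "consistent_rel s p t q R \<longleftrightarrow>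
    (\<forall>\<theta>\<in>p. \<forall>\<chi>\<in>q. \<exists>a b. realizes K s a {\<theta>} \<and> realizes K t b {\<chi>} \<and> R a b)"

lemma consistent_relD:
  "consistent_rel s p t q R \<Longrightarrow> \<theta> \<in> p \<Longrightarrow> \<chi> \<in> q \<Longrightarrow>
    \<exists>a b. realizes K s a {\<theta>} \<and> realizes K t b {\<chi>} \<and> R a b"
  by (simp add: consistent_rel_def)

lemma consistent_rel_swap: "consistent_rel s p t q R \<Longrightarrow> consistent_rel t q s p (\<lambda>b a. R a b)"
  unfolding consistent_rel_def by metis

text \<open>Passes from elements to the complete types in which orthogonality is stated: the
  formulas of a finite set that come from each type are collected into one conjunction, and a pair
  that satisfies both conjunctions and \<open>R\<close> satisfies the set.\<close>

lemma consistent_rel_type: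
  assumes p: "stable s p" and q: "stable t q"
    and \<psi>: "\<psi> \<in> F U {(0, s), (1, t)}" "\<And>a b. R a b \<longleftrightarrow> sat K (pair_asg a b) \<psi>"
    and R: "consistent_rel s p t q R"
  shows "\<exists>r. complete_type L K U {(0, s), (1, t)} r \<and> insert \<psi> (p \<union> shift ` q) \<subseteq> r"
proof (rule complete_extension)
  have inj: "inj (apfst Suc :: nat \<times> 's \<Rightarrow> _)" by (auto simp: inj_def)
  have pF: "fv \<phi> \<subseteq> {(0, s)}" "\<phi> \<in> F U {(0, s), (1, t)}" if "\<phi> \<in> p" for \<phi>
    using global_type_Fm[OF stableD(1)[OF p] that] by (auto simp: Fm_def)
  have qF: "fv \<phi> \<subseteq> {(0, t)}" "shift \<phi> \<in> F U {(0, s), (1, t)}" if "\<phi> \<in> q" for \<phi>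
  proof -
    have \<phi>: "\<phi> \<in> F U {(0, t)}" by (rule global_type_Fm[OF stableD(1)[OF q] that])
    then show "fv \<phi> \<subseteq> {(0, t)}" by (simp add: Fm_def)
    have "wf_fm L (srt K) (shift \<phi>)" unfolding shift_def
      by (subst wf_fm_map) (use \<phi> in \<open>simp_all add: Fm_def\<close>)
    moreover have "fv (shift \<phi>) \<subseteq> {(1, t)}"
      using \<phi> unfolding shift_def fv_rename[OF inj] by (auto simp: Fm_def)
    moreover have "pars (shift \<phi>) = pars \<phi>" by (simp add: shift_def fm.set_map)
    ultimately show "shift \<phi> \<in> F U {(0, s), (1, t)}" using \<phi> by (auto simp: Fm_def)
  qed
  show "insert \<psi> (p \<union> shift ` q) \<subseteq> F U {(0, s), (1, t)}" using \<psi>(1) pF(2) qF(2) by auto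
  show "finitely_satisfiable K {(0, s), (1, t)} (insert \<psi> (p \<union> shift ` q))"
    unfolding finitely_satisfiable_def
  proof (intro allI impI)
    fix G assume G: "G \<subseteq> insert \<psi> (p \<union> shift ` q) \<and> finite G"
    have "finite (G \<inter> p)" "G \<inter> p \<subseteq> p" "finite (G \<inter> shift ` q)" "G \<inter> shift ` q \<subseteq> shift ` q"
      using G by auto
    note fin = this
    obtain \<theta> where \<theta>: "\<theta> \<in> p" "\<And>a. sat1 K a \<theta> \<longleftrightarrow> (\<forall>\<phi>\<in>G \<inter> p. sat1 K a \<phi>)"
      by (rule stable_conjs[OF p fin(1,2)]) (rule that)
    obtain H where H: "H \<subseteq> q" "finite H" "G \<inter> shift ` q = shift ` H"
      using finite_subset_image[OF fin(3,4)] by metis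
    obtain \<chi> where \<chi>: "\<chi> \<in> q" "\<And>a. sat1 K a \<chi> \<longleftrightarrow> (\<forall>\<phi>\<in>H. sat1 K a \<phi>)"
      by (rule stable_conjs[OF q H(2,1)]) (rule that)
    obtain a b where ab: "realizes K s a {\<theta>}" "realizes K t b {\<chi>}" "R a b"
      using consistent_relD[OF R \<theta>(1) \<chi>(1)] by metis
    let ?e = "pair_asg a b"
    have sp: "sat K ?e \<phi>" if "\<phi> \<in> G \<inter> p" for \<phi>
    proof -
      have "sat K ?e \<phi> \<longleftrightarrow> sat1 K (?e (0, s)) \<phi>" by (rule sat_iff_sat1) (use pF that in auto)
      also have "\<dots>" using ab(1) \<theta>(2)[of a] that by (simp add: realizes_def pair_asg_def)
      finally show ?thesis .
    qed
    have sq: "sat K ?e (shift \<phi>)" if "\<phi> \<in> H" for \<phi>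
    proof -
      have "sat K ?e (shift \<phi>) \<longleftrightarrow> sat K (?e \<circ> apfst Suc) \<phi>"
        unfolding shift_def by (rule sat_rename[OF inj]) simp
      also have "\<dots> \<longleftrightarrow> sat1 K ((?e \<circ> apfst Suc) (0, t)) \<phi>"
        by (rule sat_iff_sat1) (use qF(1) that H(1) in auto)
      also have "\<dots>" using ab(2) \<chi>(2)[of b] that by (simp add: realizes_def pair_asg_def)
      finally show ?thesis .
    qed
    have "sat K ?e \<phi>" if "\<phi> \<in> G" for \<phi>
    proof -
      consider "\<phi> = \<psi>" | "\<phi> \<in> G \<inter> p" | "\<phi> \<in> G \<inter> shift ` q" using \<open>\<phi> \<in> G\<close> G by auto
      then show ?thesis
      proof cases
        case 1
        then show ?thesis using \<psi>(2) ab(3) by simp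
      next
        case 2
        then show ?thesis by (rule sp)
      next
        case 3
        then obtain \<xi> where "\<xi> \<in> H" "\<phi> = shift \<xi>" unfolding H(3) by (elim imageE)
        then show ?thesis using sq by simp
      qed
    qed
    moreover have "assigns K {(0, s), (1, t)} ?e"
      using ab(1,2) by (simp add: assigns_def pair_asg_def realizes_def)
    ultimately show "\<exists>e. assigns K {(0, s), (1, t)} e \<and> (\<forall>\<phi>\<in>G. sat K e \<phi>)" by (intro exI[of _ ?e]) simp
  qed
qed

text \<open>The completion of p(x) and q(y) with \<open>R\<close> and the one with its negation
  coincide by orthogonality.\<close>

lemma orthogonal_determines:
  assumes p: "stable s p" and q: "stable t q" and o: "orthogonal L K s p t q"
    and D: "D \<subseteq> U" and R: "drel D s t R"
    and 1: "consistent_rel s p t q R" and 2: "consistent_rel s p t q (\<lambda>a b. \<not> R a b)"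
  shows False
proof -
  let ?X = "{(0 :: nat, s), (1, t)}"
  obtain \<psi> where \<psi>: "\<psi> \<in> F U ?X" "\<And>a b. R a b \<longleftrightarrow> sat K (pair_asg a b) \<psi>"
    by (rule drelE[OF drel_mono[OF R D]]) (rule that)
  have N: "Neg \<psi> \<in> F U ?X" "\<And>a b. \<not> R a b \<longleftrightarrow> sat K (pair_asg a b) (Neg \<psi>)" using \<psi> by simp_all
  obtain r where r: "complete_type L K U ?X r" "insert \<psi> (p \<union> shift ` q) \<subseteq> r"
    using consistent_rel_type[OF p q \<psi> 1] by metis
  obtain r' where r': "complete_type L K U ?X r'" "insert (Neg \<psi>) (p \<union> shift ` q) \<subseteq> r'"
    using consistent_rel_type[OF p q N 2] by metis
  have "r = r'"
    using o r r' unfolding orthogonal_def by (metis insert_subset)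
  then have "finitely_satisfiable K ?X r" "{\<psi>, Neg \<psi>} \<subseteq> r \<and> finite {\<psi>, Neg \<psi>}"
    using r r' by (auto simp: complete_type_def)
  then obtain e where "\<forall>\<phi>\<in>{\<psi>, Neg \<psi>}. sat K e \<phi>" unfolding finitely_satisfiable_def by metis
  then show False by simp
qed

text \<open>An independent pair may be taken generic over the parameters of any given \<theta> and
  \<chi>, where it satisfies both formulas; it still satisfies \<open>R\<close>, as independent
  pairs have one type over \<open>D\<close>.\<close>

lemma independent_consistent:
  assumes p: "stable s p" and q: "stable t q" and D: "base D"
    and b: "realizes K t b (restr q D)" and a: "realizes K s a (restr p (insert b D))"
    and R: "drel D s t R" "R a b"
  shows "consistent_rel s p t q R"
  unfolding consistent_rel_def
proof (intro ballI)
  fix \<theta> \<chi> assume \<theta>: "\<theta> \<in> p" and \<chi>: "\<chi> \<in> q"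
  have par: "pars \<theta> \<subseteq> U" "pars \<chi> \<subseteq> U"
    using global_type_Fm[OF stableD(1)[OF p] \<theta>] global_type_Fm[OF stableD(1)[OF q] \<chi>]
    by (simp_all add: Fm_def)
  let ?D = "D \<union> (pars \<theta> \<union> pars \<chi>)"
  have D': "base ?D" by (rule base_Un[OF D]) (use par in \<open>simp_all add: finite_pars countable_finite\<close>)
  obtain b' where b': "realizes K t b' (restr q ?D)" using stable_realized[OF q D'] ..
  have "base (insert b' ?D)" by (rule base_insert[OF D']) (use realizes_U[OF b'] in simp)
  from stable_realized[OF p this] obtain a' where a': "realizes K s a' (restr p (insert b' ?D))" ..
  have b'D: "realizes K t b' (restr q D)" by (rule realizes_restr_mono[OF b']) auto
  have a'D: "realizes K s a' (restr p (insert b' D))" by (rule realizes_restr_mono[OF a']) auto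
  have "stable s p" "stable t q" by fact+
  have "drel D t s (\<lambda>b a. R a b)" by (rule drel_swap[OF R(1) stableD(4)[OF p] stableD(4)[OF q]])
  from drel_mv2[OF q p D b b'D a a'D this] have "R a' b'" using R(2) by simp
  moreover have "realizes K s a' {\<theta>}"
    by (rule realizes_mono[OF a']) (use \<theta> in \<open>auto simp: restr_def\<close>)
  moreover have "realizes K t b' {\<chi>}"
    by (rule realizes_mono[OF b']) (use \<chi> in \<open>auto simp: restr_def\<close>)
  ultimately show "\<exists>a b. realizes K s a {\<theta>} \<and> realizes K t b {\<chi>} \<and> R a b" by metis
qed

text \<open>Otherwise some \<phi>(y, a) in \<open>q\<close> fails at \<open>b\<close>. Pairs that
  are independent in one order then satisfy the relation, and pairs that are independent in the
  other order its negation, so both are consistent with the two types.\<close>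

lemma orthogonal_commute:
  assumes p: "stable s p" and q: "stable t q" and o: "orthogonal L K s p t q" and D: "base D"
    and b: "realizes K t b (restr q D)" and a: "realizes K s a (restr p (insert b D))"
  shows "realizes K t b (restr q (insert a D))"
proof (rule ccontr)
  assume no: "\<not> realizes K t b (restr q (insert a D))"
  have aD: "realizes K s a (restr p D)" by (rule realizes_restr_mono[OF a]) auto
  have an: "a \<notin> D" by (rule stable_new[OF p D aD])
  have baseD: "base (insert a D)" by (rule base_insert[OF D]) (use realizes_U[OF a] in simp)
  have sub: "insert a D \<subseteq> U" using base_sub[OF baseD] by simp
  obtain \<phi> where \<phi>: "\<phi> \<in> F (insert a D) {(0, t)}" "\<phi> \<in> q" "\<not> sat1 K b \<phi>"
    by (rule not_realizesE[OF q _ _ sub no]) (use realizes_U[OF b] that in simp_all)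
  define R where "R = (\<lambda>b a'. sat1 K b (map_fm id (mv a a') \<phi>))"
  have R: "drel D t s R" unfolding R_def by (rule drel_of_fm[OF \<phi>(1) an]) (use realizes_U[OF a] in simp)
  have Ra: "R b' a \<longleftrightarrow> sat1 K b' \<phi>" for b' unfolding R_def mv_same ..
  obtain b'' where b'': "realizes K t b'' (restr q (insert a D))" using stable_realized[OF q baseD] ..
  have "R b'' a" unfolding Ra using stable_realizes_iff[OF q b'' \<phi>(1) sub] \<phi>(2) by simp
  from independent_consistent[OF q p D aD b'' R this]
  have 1: "consistent_rel s p t q (\<lambda>a b. R b a)" by (rule consistent_rel_swap)
  have R': "drel D s t (\<lambda>a b. R b a)" by (rule drel_swap[OF R stableD(4)[OF q] stableD(4)[OF p]])
  have "\<not> R b a" unfolding Ra by (rule \<phi>(3))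
  from independent_consistent[OF p q D b a drel_Neg[OF R'] this]
  have 2: "consistent_rel s p t q (\<lambda>a b. \<not> R b a)" .
  show False by (rule orthogonal_determines[OF p q o _ R' 1 2]) (use base_sub[OF D] in simp)
qed

section \<open>Making a realization generic over further elements without changing the type of a
  pair\<close>

text \<open>Equality of the types of (a, b) and (a', b') over \<open>D\<close>, expressed by
  definable relations.\<close>

definition same_rel where
  "same_rel D s t a b a' b' \<longleftrightarrow> (\<forall>R. drel D s t R \<longrightarrow> (R a b \<longleftrightarrow> R a' b'))"

lemma same_relD: "same_rel D s t a b a' b' \<Longrightarrow> drel D s t R \<Longrightarrow> R a b \<longleftrightarrow> R a' b'"
  by (simp add: same_rel_def)

lemma same_rel_refl: "same_rel D s t a b a b"
  by (simp add: same_rel_def)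

lemma same_rel_mono: "same_rel D' s t a b a' b' \<Longrightarrow> D \<subseteq> D' \<Longrightarrow> same_rel D s t a b a' b'"
  unfolding same_rel_def using drel_mono[of D s t _ D'] by simp

lemma same_rel_trans: "same_rel D s t a b a' b' \<Longrightarrow> same_rel D s t a' b' a'' b'' \<Longrightarrow> same_rel D s t a b a'' b''"
  unfolding same_rel_def by metis

text \<open>
  Otherwise some \<open>\<psi> \<in> tp(b/Da)\<close> would contradict \<open>\<chi>(y, c)\<close>, a formula of the type, hence also \<open>\<chi>(y, c')\<close>
  for all \<open>c'\<close> in a Morley sequence over \<open>Da\<close>. By averaging, \<open>b\<close> fails \<open>\<chi>(b, z)\<close> for \<open>z\<close> generic
  over \<open>Db\<close>, against symmetry.
\<close>

lemma stable_avoid: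
  assumes q: "stable t q" and D: "base D" and a: "a \<in> U" "srt K a = s"
    and c: "realizes K t c (restr q (insert a D))" and b: "realizes K t b (restr q D)"
  shows "\<exists>b'. realizes K t b' (restr q (insert c D)) \<and> same_rel D s t a b a b'"
\<comment> \<open>For \<open>b = a\<close> the type of the pair leaves no choice, so
  \<open>b\<close> itself has to be generic over \<open>c\<close>; this is symmetry.\<close>
proof (cases "b = a")
  case True
  have "realizes K t b (restr q (insert c D))"
    by (rule stable_symmetric[OF q D b]) (use c True in simp)
  then show ?thesis using same_rel_refl by metis
next
  case False
  let ?x = "(0 :: nat, t)"
  have t: "t \<in> sorts L" by (rule stableD(4)[OF q])
  have Da: "base (insert a D)" by (rule base_insert[OF D a(1)])
  have bD: "b \<notin> insert a D" using stable_new[OF q D b] False by simp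
  have cD: "c \<notin> insert a D" by (rule stable_new[OF q Da c])
  have bU: "b \<in> U" "srt K b = t" and cU: "c \<in> U" "srt K c = t"
    using realizes_U[OF b] realizes_U[OF c] by simp_all
  have Dac: "base (insert c (insert a D))" by (rule base_insert[OF Da cU(1)])
  have c_D: "realizes K t c (restr q D)" by (rule realizes_restr_mono[OF c]) auto
  have sub: "insert a D \<subseteq> U" "insert c D \<subseteq> U" "D \<subseteq> U" using base_sub[OF Dac] by auto
  \<comment> \<open>The type of \<open>b\<close> over \<open>insert a D\<close>, which is to be
    realized generically over \<open>insert c D\<close>.\<close>
  define T where "T = {\<phi>\<in>F (insert a D) {?x}. sat1 K b \<phi>}"
  have "\<exists>b'. realizes K t b' (T \<union> restr q (insert c D))"
  proof (rule realize_finite[OF base_small[OF Dac] t])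
    show "T \<union> restr q (insert c D) \<subseteq> F (insert c (insert a D)) {?x}"
    proof (rule Un_least)
      show "T \<subseteq> F (insert c (insert a D)) {?x}" by (auto simp: T_def Fm_def)
      show "restr q (insert c D) \<subseteq> F (insert c (insert a D)) {?x}"
        using global_type_Fm[OF stableD(1)[OF q]] by (auto simp: restr_def Fm_def)
    qed
    fix G assume G: "G \<subseteq> T \<union> restr q (insert c D)" "finite G"
    show "\<exists>b'. realizes K t b' G"
    proof (rule ccontr)
      assume none: "\<not> (\<exists>b'. realizes K t b' G)"
      obtain l where l: "set l = G \<inter> T" using finite_list[of "G \<inter> T"] G(2) by auto
      have lF: "conjs t l \<in> F (insert a D) {?x}"
        by (rule Fm_conjs[OF t]) (auto simp: l T_def)
      have lb: "sat1 K b (conjs t l)" by (auto simp: l T_def)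
      have fin: "finite (G \<inter> restr q (insert c D))" "G \<inter> restr q (insert c D) \<subseteq> q"
        using G(2) by (auto simp: restr_def)
      obtain \<chi> where \<chi>: "\<chi> \<in> q" "\<And>z. sat1 K z \<chi> \<longleftrightarrow> (\<forall>\<phi>\<in>G \<inter> restr q (insert c D). sat1 K z \<phi>)"
        "pars \<chi> \<subseteq> \<Union> (pars ` (G \<inter> restr q (insert c D)))"
        by (rule stable_conjs[OF q fin]) (rule that)
      have "\<Union> (pars ` (G \<inter> restr q (insert c D))) \<subseteq> insert c D" by (auto simp: restr_def)
      from subset_trans[OF \<chi>(3) this] have \<chi>F: "\<chi> \<in> F (insert c D) {?x}"
        by (rule Fm_pars[OF global_type_Fm[OF stableD(1)[OF q] \<chi>(1)]])
      \<comment> \<open>The sentence stating that the inconsistent finite set is realized. It is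
        false, and remains false with \<open>c' n\<close> in place of \<open>c\<close>; but
        \<open>b\<close> would make it true if it satisfied \<chi>(y, c' n).\<close>
      define \<xi> where "\<xi> = Ex ?x (Conj (conjs t l) \<chi>)"
      have "\<xi> \<in> F (insert c (insert a D)) {}" unfolding \<xi>_def
      proof (rule Fm_Ex)
        have "insert a D \<subseteq> insert c (insert a D)" "insert c D \<subseteq> insert c (insert a D)" by auto
        then show "Conj (conjs t l) \<chi> \<in> F (insert c (insert a D)) {?x}"
          using Fm_mono[of _ "insert c (insert a D)" "{?x}" "{?x}" L "srt K"] lF \<chi>F
          unfolding Fm_simps by (meson order_refl subsetD)
      qed (use t in simp)
      note \<xi>F = this
      have "\<not> sat K (\<lambda>_. b) \<xi>"
      proof
        assume "sat K (\<lambda>_. b) \<xi>"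
        then obtain z where z: "z \<in> U" "srt K z = t" "sat K ((\<lambda>_. b)(?x := z)) (conjs t l)"
          "sat K ((\<lambda>_. b)(?x := z)) \<chi>" unfolding \<xi>_def by auto
        have "fv (conjs t l) \<subseteq> {?x}" "fv \<chi> \<subseteq> {?x}" using lF \<chi>F by (simp_all add: Fm_def)
        from z(3,4)[unfolded sat_iff_sat1[OF this(1)] sat_iff_sat1[OF this(2)]]
        have "\<forall>\<phi>\<in>G. sat1 K z \<phi>" using G(1) l \<chi>(2) by auto
        then show False using none z(1,2) by (auto simp: realizes_def)
      qed
      then have nh: "\<not> holds K \<xi>" unfolding holds_def by metis
      obtain c' where c': "morley q t (insert a D) c'" by (rule morley_base[OF q Da]) (rule that)
      define R where "R = (\<lambda>b c'. sat1 K b (map_fm id (mv c c') \<chi>))"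
      have cnD: "c \<notin> D" using cD by simp
      have R: "drel D t t R" unfolding R_def by (rule drel_of_fm[OF \<chi>F cnD cU(2)])
      have nR: "\<not> R b (c' n)" for n
      proof
        assume Rb: "R b (c' n)"
        have e: "elem (insert c (insert a D)) (mv c (c' n))"
          by (rule elem_mv[OF q Da c morley_realizes[OF c']])
        have "map_fm id (mv c (c' n)) \<xi> = Ex ?x (Conj (conjs t l) (map_fm id (mv c (c' n)) \<chi>))"
          using map_mv_id[OF lF cD, of "c' n"] by (simp add: \<xi>_def id_def)
        moreover have "\<not> holds K (map_fm id (mv c (c' n)) \<xi>)"
          using e \<xi>F nh by (simp add: elementary_map_def)
        moreover have "sat K e (Ex ?x (Conj (conjs t l) (map_fm id (mv c (c' n)) \<chi>)))" for e
        proof -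
          have "fv (conjs t l) \<subseteq> {?x}" "fv (map_fm id (mv c (c' n)) \<chi>) \<subseteq> {?x}"
            using lF \<chi>F by (simp_all add: Fm_def fv_map_id)
          then have "sat K (e(?x := b)) (conjs t l)" "sat K (e(?x := b)) (map_fm id (mv c (c' n)) \<chi>)"
            using lb Rb sat_iff_sat1[of "conjs t l" ?x K "e(?x := b)"]
              sat_iff_sat1[of "map_fm id (mv c (c' n)) \<chi>" ?x K "e(?x := b)"]
            by (simp_all add: R_def)
          then show ?thesis using bU unfolding sat.simps by (intro bexI[of _ b]) simp_all
        qed
        ultimately show False by (simp only: holds_def simp_thms)
      qed
      have bnD: "b \<notin> D" using bD by simp
      obtain \<delta> where \<delta>: "\<delta> \<in> F (insert b D) {?x}"
        "\<And>z b'. sat1 K z (map_fm id (mv b b') \<delta>) \<longleftrightarrow> R b' z"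
        by (rule fm_of_drel[OF drel_swap[OF R t t] bnD bU]) (rule that)
      have \<delta>': "sat1 K z \<delta> \<longleftrightarrow> R b z" for z using \<delta>(2)[of z b] unfolding mv_same .
      have subb: "insert b D \<subseteq> U" using sub bU by simp
      then have \<delta>U: "\<delta> \<in> F U {?x}" using \<delta>(1) by (auto simp: Fm_def)
      have "\<delta> \<notin> q"
        by (rule stable_all[OF q D morley_subset[OF c'] \<delta>U]) (use nR \<delta>' in auto)
      have "base (insert b D)" by (rule base_insert[OF D bU(1)])
      from stable_realized[OF q this] obtain z where z: "realizes K t z (restr q (insert b D))" ..
      have "\<not> R b z" using stable_realizes_iff[OF q z \<delta>(1) subb] \<open>\<delta> \<notin> q\<close> \<delta>' by simp
      have zD: "realizes K t z (restr q D)" by (rule realizes_restr_mono[OF z]) auto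
      have zU: "z \<in> U" using realizes_U[OF z] by simp
      have bz: "realizes K t b (restr q (insert z D))" by (rule stable_symmetric[OF q D b z])
      have m: "map_fm id (mv c z) \<chi> \<in> q" using invariant_mv[OF q q D c_D zD \<chi>F] \<chi>(1) by simp
      have "map_fm id (mv c z) \<chi> \<in> restr q (insert z D)"
        using m \<chi>F by (auto simp: restr_def fm.set_map Fm_def)
      then have "R b z" using bz by (simp add: realizes_def R_def)
      then show False using \<open>\<not> R b z\<close> by contradiction
    qed
  qed
  then obtain b' where b': "realizes K t b' (T \<union> restr q (insert c D))" ..
  have e: "elem (insert b (insert a D)) (id(b := b'))"
  proof (rule elem_insert[OF elem_id[OF sub(1)] bD])
    show "b' \<in> U" "srt K b' = srt K b" using realizes_U[OF b'] bU by simp_all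
    fix \<phi> assume "\<phi> \<in> F (insert a D) {(0, srt K b)}"
    then have \<phi>: "\<phi> \<in> F (insert a D) {?x}" by (simp add: bU)
    have "sat1 K b' \<psi>" if "\<psi> \<in> T" for \<psi> using b' that by (simp add: realizes_def)
    from this[of \<phi>] this[of "Neg \<phi>"] show "sat1 K b \<phi> \<longleftrightarrow> sat1 K b' (map_fm id id \<phi>)"
      using \<phi> unfolding T_def fm.map_id by auto
  qed
  have "same_rel D s t a b a b'" unfolding same_rel_def
  proof (intro allI impI)
    fix R assume "drel D s t R"
    then have "R a b \<longleftrightarrow> R ((id(b := b')) a) ((id(b := b')) b)"
      by (rule drel_elem[OF _ e]) (use bD a bU in auto)
    then show "R a b \<longleftrightarrow> R a b'" using False by auto
  qed
  moreover have "realizes K t b' (restr q (insert c D))" by (rule realizes_mono[OF b']) simp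
  ultimately show ?thesis by metis
qed

text \<open>The terms \<open>c i\<close> are treated one after the other, the earlier ones joining
  the base. Orthogonality turns genericity of \<open>a\<close> over them into genericity of each
  \<open>c i\<close> over \<open>a\<close>, the form in which \<open>stable_avoid\<close> needs
  it.\<close>

lemma stable_avoid_sequence:
  fixes n :: nat
  assumes p: "stable s p" and q: "stable t q" and o: "orthogonal L K s p t q" and D: "base D"
    and b: "realizes K t b (restr q D)"
    and c: "\<And>i. i < n \<Longrightarrow> realizes K t (c i) (restr q (D \<union> c ` {..<i}))"
    and a: "realizes K s a (restr p (D \<union> c ` {..<n}))"
  shows "\<exists>b'. realizes K t b' (restr q (D \<union> c ` {..<n})) \<and> same_rel D s t a b a b'"
  using c a
proof (induction n)
  case 0
  then show ?case using b same_rel_refl by (intro exI[of _ b]) simp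
next
  case (Suc n)
  let ?D = "D \<union> c ` {..<n}"
  have ins: "D \<union> c ` {..<Suc n} = insert (c n) ?D" by (simp add: lessThan_Suc)
  have aS: "realizes K s a (restr p (insert (c n) ?D))" using Suc.prems(2) unfolding ins .
  have cn: "realizes K t (c n) (restr q ?D)" using Suc.prems(1) by simp
  have "c i \<in> U" if "i < n" for i using realizes_U[OF Suc.prems(1)[of i]] that by simp
  then have baseD: "base ?D" by (intro base_Un[OF D]) auto
  have "realizes K s a (restr p ?D)" by (rule realizes_restr_mono[OF aS]) auto
  with Suc.IH Suc.prems(1) obtain b1 where b1: "realizes K t b1 (restr q ?D)" "same_rel D s t a b a b1"
    by (metis less_Suc_eq)
  have ca: "realizes K t (c n) (restr q (insert a ?D))"
    by (rule orthogonal_commute[OF p q o baseD cn aS])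
  have aU: "a \<in> U" "srt K a = s" using realizes_U[OF aS] by simp_all
  obtain b2 where b2: "realizes K t b2 (restr q (insert (c n) ?D))" "same_rel ?D s t a b1 a b2"
    using stable_avoid[OF q baseD aU ca b1(1)] by metis
  have "same_rel D s t a b a b2"
    by (rule same_rel_trans[OF b1(2) same_rel_mono[OF b2(2)]]) simp
  then show ?case using b2(1) unfolding ins by metis
qed

end

context small_base
begin

lemma map_fixed:
  assumes "\<phi> \<in> F D X" "\<And>c. c \<in> D \<Longrightarrow> h c = c" shows "map_fm id h \<phi> = \<phi>"
proof -
  have "map_fm id h \<phi> = map_fm id id \<phi>"
    by (rule fm.map_cong) (use assms in \<open>auto simp: Fm_def\<close>)
  then show ?thesis by (simp only: fm.map_id)
qed

lemma elem_realizes: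
  assumes q: "stable t q" and D: "D \<subseteq> S" "D \<subseteq> U" and h: "elem S h" "\<And>c. c \<in> D \<Longrightarrow> h c = c"
    and b: "b \<in> S" "realizes K t b (restr q D)"
  shows "realizes K t (h b) (restr q D)"
proof (rule realizes_restrI[OF stableD(1)[OF q] _ _ D(2)])
  note bU = realizes_U[OF b(2)]
  show "h b \<in> U" "srt K (h b) = t" using elem_range[OF h(1) b(1)] bU by simp_all
  fix \<phi> assume \<phi>: "\<phi> \<in> F D {(0, t)}" "\<phi> \<in> q"
  have "sat1 K b \<phi>" using stable_realizes_iff[OF q b(2) \<phi>(1) D(2)] \<phi>(2) by simp
  moreover have "\<phi> \<in> F S {(0, t)}" using \<phi>(1) D(1) by (auto simp: Fm_def)
  ultimately show "sat1 K (h b) \<phi>"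
    using elem_sat1[OF h(1), of \<phi> "(0, t)" b] b(1) bU map_fixed[OF \<phi>(1) h(2)] by simp
qed

text \<open>The pairs are arranged so that the first components are Morley in \<open>p\<close>, the
  second ones are Morley in \<open>q\<close>, and every pair has the type of (a, b) over
  \<open>D\<close>. Averaging in both types at once finds, for \<theta> in \<open>p\<close> and
  \<chi> in \<open>q\<close>, a pair that satisfies both; hence the negation of \<open>R\<close> is
  consistent with the two types. An independent pair shows the same of \<open>R\<close>.\<close>

lemma orthogonal_independent:
  assumes p: "stable s p" and q: "stable t q" and o: "orthogonal L K s p t q" and D: "base D"
    and a: "realizes K s a (restr p D)" and b: "realizes K t b (restr q D)"
  shows "realizes K s a (restr p (insert b D))"
proof (rule ccontr)
  assume no: "\<not> realizes K s a (restr p (insert b D))"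
  have aU: "a \<in> U" "srt K a = s" and bU: "b \<in> U" "srt K b = t"
    using realizes_U[OF a] realizes_U[OF b] by simp_all
  have bD: "b \<notin> D" and aD: "a \<notin> D" by (rule stable_new[OF q D b], rule stable_new[OF p D a])
  have Db: "base (insert b D)" and Da: "base (insert a D)"
    by (rule base_insert[OF D bU(1)], rule base_insert[OF D aU(1)])
  have sub: "insert b D \<subseteq> U" "insert a D \<subseteq> U" "D \<subseteq> U" "A \<subseteq> D"
    using base_sub[OF Db] base_sub[OF Da] base_sub[OF D] by simp_all
  obtain \<phi> where \<phi>: "\<phi> \<in> F (insert b D) {(0, s)}" "\<phi> \<in> p" "\<not> sat1 K a \<phi>"
    by (rule not_realizesE[OF p aU sub(1) no]) (rule that)
  define R where "R = (\<lambda>a b'. sat1 K a (map_fm id (mv b b') \<phi>))"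
  have R: "drel D s t R" unfolding R_def by (rule drel_of_fm[OF \<phi>(1) bD bU(2)])
  have Rb: "R a' b \<longleftrightarrow> sat1 K a' \<phi>" for a' unfolding R_def mv_same ..
  obtain a1 where a1: "realizes K s a1 (restr p (insert b D))" using stable_realized[OF p Db] ..
  have "R a1 b" unfolding Rb using stable_realizes_iff[OF p a1 \<phi>(1) sub(1)] \<phi>(2) by simp
  from independent_consistent[OF p q D b a1 R this] have 1: "consistent_rel s p t q R" .
  \<comment> \<open>The first component is generic over all earlier pairs, the second one only over
    the earlier second components, since it may depend on its own partner.\<close>
  define P where "P = (\<lambda>(n :: nat) B r. realizes K s (fst r) (restr p (D \<union> fst ` B \<union> snd ` B)) \<and>
    realizes K t (snd r) (restr q (D \<union> snd ` B)) \<and> same_rel D s t a b (fst r) (snd r))"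
  have "\<exists>f. \<forall>n. P n (f ` {..<n}) (f n)"
  proof (rule dependent_nat_course)
    fix f and n :: nat assume f: "\<And>m. m < n \<Longrightarrow> P m (f ` {..<m}) (f m)"
    let ?c = "\<lambda>i. snd (f i)" and ?d = "\<lambda>i. fst (f i)"
    have im: "snd ` f ` {..<m} = ?c ` {..<m}" "fst ` f ` {..<m} = ?d ` {..<m}" for m
      by (simp_all add: image_image)
    have fr: "realizes K s (?d m) (restr p (D \<union> ?d ` {..<m} \<union> ?c ` {..<m}))"
      "realizes K t (?c m) (restr q (D \<union> ?c ` {..<m}))" if "m < n" for m
      using f[OF that] unfolding P_def im by simp_all
    have "?c m \<in> U" "?d m \<in> U" if "m < n" for m
      using realizes_U[OF fr(1)[OF that]] realizes_U[OF fr(2)[OF that]] by simp_all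
    then have "base (D \<union> (?d ` {..<n} \<union> ?c ` {..<n}))" by (intro base_Un[OF D]) auto
    from stable_realized[OF p this] obtain a'
      where a': "realizes K s a' (restr p (D \<union> (?d ` {..<n} \<union> ?c ` {..<n})))" ..
    have a'D: "realizes K s a' (restr p D)" and a's: "realizes K s a' (restr p (D \<union> ?c ` {..<n}))"
      by (rule realizes_restr_mono[OF a'], auto)+
    have "countable (insert a D)" using Da by (simp add: base_def)
    \<comment> \<open>The pair (a, b) is moved to (a', h b) over \<open>D\<close>. So far
      \<open>h b\<close> is generic over \<open>D\<close> alone; it is replaced below by
      \<open>b'\<close>, generic over the earlier second components, without changing the type of
      the pair.\<close>
    from elem_extend_finite[OF elem_mv[OF p D a a'D] this, of "{b}"] bU
    obtain h where h: "elem (insert a D \<union> {b}) h" "\<forall>c\<in>insert a D. h c = mv a a' c" by auto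
    have hD: "h c = c" if "c \<in> D" for c using h(2) that aD by auto
    have ha: "h a = a'" using h(2) by simp
    have b0: "realizes K t (h b) (restr q D)"
      by (rule elem_realizes[OF q _ sub(3) h(1) hD _ b]) auto
    have sr: "same_rel D s t a b a' (h b)" unfolding same_rel_def
    proof (intro allI impI)
      fix R assume "drel D s t R"
      then have "R a b \<longleftrightarrow> R (h a) (h b)"
        by (rule drel_elem[OF _ h(1) _ hD]) (use aU bU in auto)
      then show "R a b \<longleftrightarrow> R a' (h b)" unfolding ha .
    qed
    obtain b' where b': "realizes K t b' (restr q (D \<union> ?c ` {..<n}))" "same_rel D s t a' (h b) a' b'"
      using stable_avoid_sequence[OF p q o D b0 fr(2) a's] by auto
    have "P n (f ` {..<n}) (a', b')" unfolding P_def im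
      using a' b'(1) same_rel_trans[OF sr b'(2)] by (simp add: Un_assoc)
    then show "\<exists>r. P n (f ` {..<n}) r" by (rule exI)
  qed
  then obtain f where f: "\<And>n. P n (f ` {..<n}) (f n)" by auto
  let ?c = "\<lambda>i. snd (f i)" and ?d = "\<lambda>i. fst (f i)"
  have im: "snd ` f ` {..<m} = ?c ` {..<m}" "fst ` f ` {..<m} = ?d ` {..<m}" for m
    by (simp_all add: image_image)
  have fr: "realizes K s (?d m) (restr p (D \<union> ?d ` {..<m} \<union> ?c ` {..<m}))"
    "realizes K t (?c m) (restr q (D \<union> ?c ` {..<m}))" "same_rel D s t a b (?d m) (?c m)" for m
    using f[of m] unfolding P_def im by simp_all
  have md: "morley p s D ?d" unfolding morley_def
    by (rule allI, rule realizes_restr_mono[OF fr(1)]) auto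
  have mc: "morley q t D ?c" unfolding morley_def by (rule allI, rule fr(2))
  have 2: "consistent_rel s p t q (\<lambda>a b. \<not> R a b)" unfolding consistent_rel_def
  proof (intro ballI)
    fix \<theta> \<chi> assume \<theta>: "\<theta> \<in> p" and \<chi>: "\<chi> \<in> q"
    have "finite ({n. \<not> sat1 K (?d n) \<theta>} \<union> {n. \<not> sat1 K (?c n) \<chi>})"
      using stable_average[OF p D md \<theta>] stable_average[OF q D mc \<chi>] by simp
    from ex_new_if_finite[OF infinite_UNIV_nat this]
    obtain n where n: "sat1 K (?d n) \<theta>" "sat1 K (?c n) \<chi>" by auto
    have "\<not> R (?d n) (?c n)" using same_relD[OF fr(3)[of n] R] Rb \<phi>(3) by simp
    then show "\<exists>a b. realizes K s a {\<theta>} \<and> realizes K t b {\<chi>} \<and> \<not> R a b"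
      using n realizes_U[OF fr(1)[of n]] realizes_U[OF fr(2)[of n]]
      by (intro exI[of _ "?d n"] exI[of _ "?c n"]) (simp add: realizes_def)
  qed
  show False by (rule orthogonal_determines[OF p q o sub(3) R 1 2])
qed

section \<open>Isolation\<close>

text \<open>A finite subset of {\<phi>} is weaker than \<phi> or equal to it, so derivability from
  it is plain implication.\<close>

lemma isolated_iff:
  "isolated K s \<Sigma> \<longleftrightarrow> (\<exists>\<phi>\<in>\<Sigma>. \<forall>a. realizes K s a {\<phi>} \<longrightarrow> realizes K s a \<Sigma>)"
proof
  assume "isolated K s \<Sigma>"
  then obtain \<phi> where \<phi>: "\<phi> \<in> \<Sigma>" and pr: "\<forall>\<psi>\<in>\<Sigma>. \<exists>G. G \<subseteq> {\<phi>} \<and> finite G \<and>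
      (\<forall>a. realizes K s a G \<longrightarrow> realizes K s a {\<psi>})"
    unfolding isolated_def proves_def by (rule bexE)
  have "realizes K s a \<Sigma>" if a: "realizes K s a {\<phi>}" for a
  proof -
    have "sat1 K a \<psi>" if \<psi>: "\<psi> \<in> \<Sigma>" for \<psi>
    proof -
      from bspec[OF pr \<psi>] obtain G where G: "G \<subseteq> {\<phi>}" "\<forall>a. realizes K s a G \<longrightarrow> realizes K s a {\<psi>}"
        by (elim exE conjE)
      from G(2)[THEN spec, THEN mp, OF realizes_mono[OF a G(1)]] show ?thesis
        by (simp add: realizes_def)
    qed
    then show ?thesis using realizes_U[OF a] by (simp add: realizes_def)
  qed
  then show "\<exists>\<phi>\<in>\<Sigma>. \<forall>a. realizes K s a {\<phi>} \<longrightarrow> realizes K s a \<Sigma>" using \<phi> by (intro bexI[of _ \<phi>]) simp_all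
next
  assume "\<exists>\<phi>\<in>\<Sigma>. \<forall>a. realizes K s a {\<phi>} \<longrightarrow> realizes K s a \<Sigma>"
  then obtain \<phi> where \<phi>: "\<phi> \<in> \<Sigma>" "\<forall>a. realizes K s a {\<phi>} \<longrightarrow> realizes K s a \<Sigma>" by (rule bexE)
  have "proves K s {\<phi>} \<Sigma>" unfolding proves_def
    by (intro ballI exI[of _ "{\<phi>}"]) (use \<phi>(2) in \<open>auto simp: realizes_def\<close>)
  then show "isolated K s \<Sigma>" unfolding isolated_def using \<phi>(1) by (rule bexI)
qed

text \<open>
  If \<open>\<phi>(x, b)\<close> isolates \<open>p\<close> over \<open>Db\<close>, then \<open>\<phi>(a, y) \<in> q\<close> holds for all \<open>a \<Turnstile> p\<restriction>D\<close> and for no other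
  \<open>a\<close>. This set of \<open>a\<close> is open: compactness, applied to the condition that \<open>\<phi>(a, y)\<close> fails along a
  Morley sequence in \<open>q\<close>, gives a formula of \<open>p\<restriction>D\<close> isolating it.
\<close>

lemma isolated_descend:
  assumes p: "stable s p" and q: "stable t q" and D: "base D" and b: "realizes K t b (restr q D)"
    and comm: "\<And>a. realizes K s a (restr p (insert b D)) \<Longrightarrow> realizes K t b (restr q (insert a D))"
    and iso: "isolated K s (restr p (insert b D))"
  shows "isolated K s (restr p D)"
proof (rule ccontr)
  assume not_iso: "\<not> isolated K s (restr p D)"
  have bU: "b \<in> U" "srt K b = t" using realizes_U[OF b] by simp_all
  have bD: "b \<notin> D" by (rule stable_new[OF q D b])
  have Db: "base (insert b D)" by (rule base_insert[OF D bU(1)])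
  have sub: "insert b D \<subseteq> U" "D \<subseteq> U" "A \<subseteq> D" using base_sub[OF Db] base_sub[OF D] by simp_all
  have s: "s \<in> sorts L" and t: "t \<in> sorts L" by (rule stableD(4)[OF p], rule stableD(4)[OF q])
  let ?x = "(0 :: nat, s)"
  obtain \<phi> where \<phi>: "\<phi> \<in> restr p (insert b D)"
    and \<phi>i: "\<forall>a. realizes K s a {\<phi>} \<longrightarrow> realizes K s a (restr p (insert b D))"
    using iso unfolding isolated_iff by (rule bexE)
  have \<phi>p: "\<phi> \<in> p" and \<phi>F: "\<phi> \<in> F (insert b D) {?x}"
    using \<phi> Fm_pars[OF global_type_Fm[OF stableD(1)[OF p], of \<phi>]] by (simp_all add: restr_def)
  define R where "R = (\<lambda>a b'. sat1 K a (map_fm id (mv b b') \<phi>))"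
  have R: "drel D s t R" unfolding R_def by (rule drel_of_fm[OF \<phi>F bD bU(2)])
  have Rb: "R a' b \<longleftrightarrow> sat1 K a' \<phi>" for a' unfolding R_def mv_same ..
  \<comment> \<open>That \<phi>(x, b) implies \<xi>(x) is a sentence over \<open>insert b D\<close>,
    so it stays true for any other realization of the restriction of \<open>q\<close> to
    \<open>D\<close> in place of \<open>b\<close>.\<close>
  have key: "realizes K s a' (restr p D)"
    if a': "a' \<in> U" "srt K a' = s" and b': "realizes K t b' (restr q D)" and Rab: "R a' b'" for a' b'
  proof (rule realizes_restrI[OF stableD(1)[OF p] a' sub(2)])
    fix \<xi> assume \<xi>: "\<xi> \<in> F D {?x}" "\<xi> \<in> p"
    let ?\<eta> = "Ex ?x (Conj \<phi> (Neg \<xi>))" and ?h = "mv b b'"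
    have e: "elem (insert b D) ?h" by (rule elem_mv[OF q D b b'])
    have "\<xi> \<in> F (insert b D) {?x}" using \<xi>(1) by (auto simp: Fm_def)
    then have \<eta>F: "?\<eta> \<in> F (insert b D) {}" using \<phi>F s by (intro Fm_Ex) simp_all
    have fv: "fv \<phi> \<subseteq> {?x}" "fv \<xi> \<subseteq> {?x}" "fv (map_fm id ?h \<phi>) \<subseteq> {?x}"
      using \<phi>F \<xi> by (simp_all add: Fm_def fv_map_id)
    have "\<not> sat K e ?\<eta>" for e
    proof
      assume "sat K e ?\<eta>"
      then obtain z where z: "z \<in> U" "srt K z = s" "sat K (e(?x := z)) \<phi>" "\<not> sat K (e(?x := z)) \<xi>"
        by auto
      then have "sat1 K z \<phi>" "\<not> sat1 K z \<xi>"
        using sat_iff_sat1[OF fv(1), of K "e(?x := z)"] sat_iff_sat1[OF fv(2), of K "e(?x := z)"] by simp_all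
      moreover have "realizes K s z (restr p (insert b D))"
        using \<phi>i z(1,2) calculation(1) by (simp add: realizes_def)
      moreover have "\<xi> \<in> restr p (insert b D)" using \<xi> by (auto simp: restr_def Fm_def)
      ultimately show False by (simp add: realizes_def)
    qed
    then have "\<not> holds K ?\<eta>" by (simp add: holds_def del: sat.simps)
    then have "\<not> holds K (map_fm id ?h ?\<eta>)" using e \<eta>F by (simp add: elementary_map_def)
    moreover have "map_fm id ?h ?\<eta> = Ex ?x (Conj (map_fm id ?h \<phi>) (Neg \<xi>))"
      using map_mv_id[OF \<xi>(1) bD, of b'] by (simp add: id_def)
    ultimately obtain e where "\<not> sat K e (Ex ?x (Conj (map_fm id ?h \<phi>) (Neg \<xi>)))"
      unfolding holds_def by auto
    then have "\<not> sat K (e(?x := a')) (Conj (map_fm id ?h \<phi>) (Neg \<xi>))"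
      using a' by auto
    then show "sat1 K a' \<xi>"
      using Rab sat_iff_sat1[OF fv(3), of K "e(?x := a')"] sat_iff_sat1[OF fv(2), of K "e(?x := a')"]
      by (simp add: R_def)
  qed
  obtain c where c: "morley q t D c" by (rule morley_base[OF q D]) (rule that)
  have cU: "range c \<subseteq> U" using morley_U[OF c] by auto
  have Dc: "base (D \<union> range c)" by (rule base_Un[OF D _ cU]) simp
  \<comment> \<open>The sequence \<open>c\<close> is fixed beforehand, so that failure of \<phi>(x,
    y) along it becomes a set of formulas in \<open>x\<close>, to which saturation applies.\<close>
  define \<Phi> where "\<Phi> = (\<lambda>n. map_fm id (mv b (c n)) \<phi>)"
  have \<Phi>: "sat1 K a (\<Phi> n) \<longleftrightarrow> R a (c n)" for a n by (simp add: \<Phi>_def R_def)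
  have \<Phi>F: "\<Phi> n \<in> F (D \<union> range c) {?x}" for n
  proof -
    have "\<Phi> n \<in> F (mv b (c n) ` insert b D) {?x}" unfolding \<Phi>_def
      by (rule Fm_map[OF \<phi>F]) (use bU morley_U[OF c] in auto)
    then show ?thesis by (rule subsetD[OF Fm_mono, rotated 2]) auto
  qed
  have "\<exists>a. realizes K s a (restr p D \<union> range (\<lambda>n. Neg (\<Phi> n)))"
  proof (rule realize_finite[OF base_small[OF Dc] s])
    have "restr p D \<subseteq> F (D \<union> range c) {?x}"
      using global_type_Fm[OF stableD(1)[OF p]] by (auto simp: restr_def Fm_def)
    then show "restr p D \<union> range (\<lambda>n. Neg (\<Phi> n)) \<subseteq> F (D \<union> range c) {?x}" using \<Phi>F by auto
    fix G assume G: "G \<subseteq> restr p D \<union> range (\<lambda>n. Neg (\<Phi> n))" "finite G"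
    have fin: "finite (G \<inter> restr p D)" "G \<inter> restr p D \<subseteq> p" using G(2) by (auto simp: restr_def)
    obtain \<psi> where \<psi>: "\<psi> \<in> p" "\<And>a. sat1 K a \<psi> \<longleftrightarrow> (\<forall>\<phi>\<in>G \<inter> restr p D. sat1 K a \<phi>)"
      "pars \<psi> \<subseteq> \<Union> (pars ` (G \<inter> restr p D))"
      by (rule stable_conjs[OF p fin]) (rule that)
    have "\<Union> (pars ` (G \<inter> restr p D)) \<subseteq> D" by (auto simp: restr_def)
    with \<psi>(3) have \<psi>D: "pars \<psi> \<subseteq> D" by (rule subset_trans)
    then have "\<psi> \<in> restr p D" using \<psi>(1) by (simp add: restr_def)
    with not_iso[unfolded isolated_iff]
    obtain a where a: "realizes K s a {\<psi>}" "\<not> realizes K s a (restr p D)" by auto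
    have \<psi>F: "\<psi> \<in> F D {?x}" by (rule Fm_pars[OF global_type_Fm[OF stableD(1)[OF p] \<psi>(1)] \<psi>D])
    have aU: "a \<in> U" "srt K a = s" using realizes_U[OF a(1)] by simp_all
    \<comment> \<open>Since \<open>a\<close> satisfies \<psi> but does not realize \<open>p\<close>
      over \<open>D\<close>, by \<open>key\<close> it fails \<phi>(a, y) at every realization of
      \<open>q\<close> over \<open>D\<close>. A Morley sequence \<open>d\<close> of these is carried
      onto \<open>c\<close>, and \<open>a\<close> along with it.\<close>
    obtain d where d: "morley q t (insert a D) d"
      by (rule morley_base[OF q base_insert[OF D aU(1)]]) (rule that)
    have dD: "morley q t D d" by (rule morley_subset[OF d]) auto
    have nR: "\<not> R a (d n)" for n using key[OF aU morley_realizes[OF dD]] a(2) by metis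
    obtain g where g: "elem (D \<union> range d) g" "\<And>z. z \<in> D \<Longrightarrow> g z = z" "\<And>n. g (d n) = c n"
      by (rule morley_unique[OF stableD(1-3)[OF q] sub(3,2) dD c]) (rule that)
    have "countable (D \<union> range d)" using D by (simp add: base_def)
    from elem_extend_finite[OF g(1) this, of "{a}"] aU(1)
    obtain h where h: "elem (D \<union> range d \<union> {a}) h" "\<forall>z\<in>D \<union> range d. h z = g z" by auto
    have hD: "h z = z" if "z \<in> D" for z using h(2) g(2) that by simp
    have hd: "h (d n) = c n" for n using h(2) g(3) by simp
    have nR': "\<not> R (h a) (c n)" for n
    proof -
      have "R a (d n) \<longleftrightarrow> R (h a) (h (d n))"
        by (rule drel_elem[OF R h(1) _ hD]) (use aU morley_U[OF d] in auto)
      then show ?thesis using nR hd by simp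
    qed
    have "\<psi> \<in> F (D \<union> range d \<union> {a}) {?x}" using \<psi>F by (auto simp: Fm_def)
    from elem_sat1[OF h(1) this, of a] have "sat1 K (h a) \<psi>"
      using a(1) aU map_fixed[OF \<psi>F hD] by (simp add: realizes_def)
    moreover have "h a \<in> U" "srt K (h a) = s" using elem_range[OF h(1), of a] aU by simp_all
    moreover have "sat1 K (h a) \<zeta>" if "\<zeta> \<in> G" for \<zeta>
      using G(1) that \<open>sat1 K (h a) \<psi>\<close> \<psi>(2) nR' \<Phi> by (cases "\<zeta> \<in> restr p D") auto
    ultimately show "\<exists>a. realizes K s a G" by (intro exI[of _ "h a"]) (simp add: realizes_def)
  qed
  then obtain a where a: "realizes K s a (restr p D \<union> range (\<lambda>n. Neg (\<Phi> n)))" ..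
  have aD: "realizes K s a (restr p D)" by (rule realizes_mono[OF a]) simp
  have nR: "\<not> R a (c n)" for n using a \<Phi>[of a n] by (simp add: realizes_def ball_Un)
  have aU: "a \<in> U" "srt K a = s" using realizes_U[OF a] by simp_all
  have an: "a \<notin> D" by (rule stable_new[OF p D aD])
  have Da: "base (insert a D)" by (rule base_insert[OF D aU(1)])
  have suba: "insert a D \<subseteq> U" using base_sub[OF Da] by simp
  obtain \<delta> where \<delta>: "\<delta> \<in> F (insert a D) {(0, t)}"
    "\<And>z a'. sat1 K z (map_fm id (mv a a') \<delta>) \<longleftrightarrow> R a' z"
    by (rule fm_of_drel[OF drel_swap[OF R s t] an aU]) (rule that)
  have \<delta>': "sat1 K z \<delta> \<longleftrightarrow> R a z" for z using \<delta>(2)[of z a] unfolding mv_same .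
  have "\<delta> \<in> F U {(0, t)}" using \<delta>(1) suba by (auto simp: Fm_def)
  then have "\<delta> \<notin> q" by (rule stable_all[OF q D c]) (use nR \<delta>' in simp)
  obtain z where z: "realizes K t z (restr q (insert a D))" using stable_realized[OF q Da] ..
  have "\<not> R a z" using stable_realizes_iff[OF q z \<delta>(1) suba] \<open>\<delta> \<notin> q\<close> \<delta>' by simp
  obtain a0 where a0: "realizes K s a0 (restr p (insert b D))" using stable_realized[OF p Db] ..
  have "R a0 b" unfolding Rb using stable_realizes_iff[OF p a0 \<phi>F sub(1)] \<phi>p by simp
  \<comment> \<open>Both pairs are independent with the component in \<open>p\<close> chosen before
    the one in \<open>q\<close>; for (a0, b) this is the hypothesis \<open>comm\<close>.\<close>
  moreover have "R a0 b \<longleftrightarrow> R a z"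
    by (rule drel_mv2[OF p q D realizes_restr_mono[OF a0] aD comm[OF a0] z R]) auto
  ultimately show False using \<open>\<not> R a z\<close> by simp
qed

section \<open>Dimension\<close>

text \<open>Transitivity of the closure: \<open>c\<close> lies in the closure of \<open>X\<close>,
  so by regularity the restriction of \<open>p\<close> to \<open>X\<close> implies its restriction
  to \<open>insert c X\<close>.\<close>

lemma regular_transitive:
  assumes "regular L \<kappa> K s p A" "base X" "realizes K s c (restr p A)"
    "\<not> realizes K s c (restr p X)" "realizes K s b (restr p X)"
  shows "realizes K s b (restr p (insert c X))"
proof -
  have "proves K s (restr p X) (restr p (insert c X))"
    using assms(1,3,4) base_small[OF assms(2)] base_sub[OF assms(2)] unfolding regular_def by metis
  then have pr: "\<forall>\<phi>\<in>restr p (insert c X). \<exists>G. G \<subseteq> restr p X \<and> finite G \<and>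
      (\<forall>a. realizes K s a G \<longrightarrow> realizes K s a {\<phi>})" by (simp only: proves_def)
  have "sat1 K b \<phi>" if \<phi>: "\<phi> \<in> restr p (insert c X)" for \<phi>
  proof -
    from bspec[OF pr \<phi>] obtain G where G: "G \<subseteq> restr p X" "\<forall>a. realizes K s a G \<longrightarrow> realizes K s a {\<phi>}"
      by (elim exE conjE)
    from G(2)[THEN spec, THEN mp, OF realizes_mono[OF assms(5) G(1)]] show ?thesis
      by (simp add: realizes_def)
  qed
  then show ?thesis using realizes_U[OF assms(5)] by (simp add: realizes_def)
qed

lemma base_finite: "finite B \<Longrightarrow> B \<subseteq> U \<Longrightarrow> base (A \<union> B)"
  using countable_A A_sub by (simp add: base_def countable_finite)

definition independent :: "'s \<Rightarrow> ('f, 'r, 's, 'a) formula set \<Rightarrow> 'a set \<Rightarrow> bool" where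
  "independent s p S \<longleftrightarrow> (\<forall>x\<in>S. realizes K s x (restr p (A \<union> (S - {x}))))"

text \<open>Steinitz exchange, by induction on the number of elements of \<open>B\<close> outside
  \<open>S\<close>; the last premise says that \<open>B\<close> spans \<open>S\<close>. An element
  \<open>b\<close> of \<open>B\<close> outside \<open>S\<close> is dropped if the rest still spans
  \<open>S\<close>, and is otherwise replaced by an element of \<open>S\<close> that is generic over
  the rest.\<close>

lemma exchange_bound:
  assumes p: "stable s p" and reg: "regular L \<kappa> K s p A"
    and S: "finite S" "independent s p S"
  shows "finite B \<Longrightarrow> (\<And>x. x \<in> B \<Longrightarrow> realizes K s x (restr p A)) \<Longrightarrow>
    (\<And>x. x \<in> S \<Longrightarrow> \<not> realizes K s x (restr p (A \<union> B))) \<Longrightarrow> card S \<le> card B"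
proof (induction "card (B - S)" arbitrary: B rule: less_induct)
  case less
  note B = less.prems(1) and BA = less.prems(2) and span = less.prems(3)
  have BU: "B \<subseteq> U"
  proof
    fix x assume "x \<in> B"
    from realizes_U[OF BA[OF this]] show "x \<in> U" ..
  qed
  show ?case
  proof (cases "B \<subseteq> S")
    case True
    have "S \<subseteq> B"
    proof
      fix x assume x: "x \<in> S"
      show "x \<in> B"
      proof (rule ccontr)
        assume "x \<notin> B"
        have "realizes K s x (restr p (A \<union> (S - {x})))" using S(2) x by (simp add: independent_def)
        then have "realizes K s x (restr p (A \<union> B))"
          by (rule realizes_restr_mono) (use True \<open>x \<notin> B\<close> in auto)
        then show False using span[OF x] by contradiction
      qed
    qed
    then show ?thesis by (rule card_mono[OF B])
  next
    case False
    then obtain b where b: "b \<in> B" "b \<notin> S" by auto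
    let ?C = "B - {b}"
    have "?C - S \<subset> B - S" using b by auto
    then have dec: "card (?C - S) < card (B - S)" by (intro psubset_card_mono) (simp_all add: B)
    have "?C \<subseteq> U" using BU by auto
    then have CU: "base (A \<union> ?C)" by (intro base_finite) (simp_all add: B)
    show ?thesis
    proof (cases "\<forall>x\<in>S. \<not> realizes K s x (restr p (A \<union> ?C))")
      case True
      have "card S \<le> card ?C"
      proof (rule less.hyps[OF dec])
        show "finite ?C" using B by simp
        show "realizes K s y (restr p A)" if "y \<in> ?C" for y using that by (intro BA) simp
        show "\<not> realizes K s y (restr p (A \<union> ?C))" if "y \<in> S" for y using True that by simp
      qed
      also have "\<dots> \<le> card B" by (rule card_mono[OF B]) auto
      finally show ?thesis .
    next
      case False
      then obtain x where x: "x \<in> S" "realizes K s x (restr p (A \<union> ?C))" by metis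
      let ?B = "insert x ?C"
      have xC: "x \<notin> A \<union> ?C" by (rule stable_new[OF p CU x(2)])
      have xA: "realizes K s x (restr p A)" by (rule realizes_restr_mono[OF x(2)]) simp
      have xU: "x \<in> U" using realizes_U[OF x(2)] by simp
      have insb: "insert b (A \<union> ?C) = A \<union> B" "insert x (A \<union> ?C) = A \<union> ?B" using b by auto
      \<comment> \<open>By symmetry \<open>b\<close> lies in the closure of the new set, which
        therefore still spans \<open>S\<close> by transitivity.\<close>
      have nb: "\<not> realizes K s b (restr p (A \<union> ?B))"
      proof
        assume "realizes K s b (restr p (A \<union> ?B))"
        then have "realizes K s b (restr p (insert x (A \<union> ?C)))" unfolding insb .
        from stable_symmetric[OF p CU x(2) this] have "realizes K s x (restr p (A \<union> B))"
          unfolding insb .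
        then show False using span[OF x(1)] by contradiction
      qed
      have "?B \<subseteq> U" using BU xU by auto
      then have baseB: "base (A \<union> ?B)" by (intro base_finite) (simp_all add: B)
      have "card S \<le> card ?B"
      proof (rule less.hyps)
        have "?B - S = ?C - S" using x(1) by auto
        then show "card (?B - S) < card (B - S)" using dec by simp
        show "finite ?B" using B by simp
        show "realizes K s y (restr p A)" if "y \<in> ?B" for y
        proof (cases "y = x")
          case False
          then have "y \<in> B" using that by simp
          then show ?thesis by (rule BA)
        qed (simp add: xA)
        show "\<not> realizes K s y (restr p (A \<union> ?B))" if y: "y \<in> S" for y
        proof
          assume "realizes K s y (restr p (A \<union> ?B))"
          from regular_transitive[OF reg baseB BA[OF b(1)] nb this]
          have r: "realizes K s y (restr p (insert b (A \<union> ?B)))" .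
          have "A \<union> B \<subseteq> insert b (A \<union> ?B)" by auto
          from realizes_restr_mono[OF r this] have "realizes K s y (restr p (A \<union> B))" .
          then show False using span[OF y] by contradiction
        qed
      qed
      also have "card ?B = Suc (card ?C)" using B xC by (intro card_insert_disjoint) simp_all
      also have "\<dots> = card B" by (rule card_Suc_Diff1[OF B b(1)])
      finally show ?thesis .
    qed
  qed
qed

lemma Well_order_finite_max:
  assumes "Well_order r" "finite J" "J \<noteq> {}" "J \<subseteq> Field r"
  shows "\<exists>m\<in>J. \<forall>j\<in>J. (j, m) \<in> r"
  using assms(2-4)
proof (induction J rule: finite_ne_induct)
  case (singleton x)
  then show ?case using assms(1) by (auto simp: order_on_defs refl_on_def)
next
  case (insert x J)
  then obtain m where m: "m \<in> J" "\<forall>j\<in>J. (j, m) \<in> r" by auto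
  have tr: "trans r" and rf: "(x, x) \<in> r" using assms(1) insert.prems by (auto simp: order_on_defs refl_on_def)
  have "(x, m) \<in> r \<or> (m, x) \<in> r"
    using assms(1) insert.prems m(1) insert.hyps(3) by (auto simp: order_on_defs total_on_def)
  then show ?case
  proof
    assume "(x, m) \<in> r"
    then show ?thesis using m by (intro bexI[of _ m]) auto
  next
    assume xm: "(m, x) \<in> r"
    then have "(j, x) \<in> r" if "j \<in> J" for j using m(2) that transD[OF tr] by metis
    then show ?thesis using rf by (intro bexI[of _ x]) auto
  qed
qed

lemma morley_seq_new:
  assumes p: "stable s p" and m: "morley_seq K s p A \<alpha> a"
  shows "inj_on a (Field \<alpha>)" "i \<in> Field \<alpha> \<Longrightarrow> a i \<in> U"
proof -
  have r: "realizes K s (a i) (restr p (A \<union> a ` underS \<alpha> i))" if "i \<in> Field \<alpha>" for i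
    using m that by (simp add: morley_seq_def)
  show U: "a i \<in> U" if "i \<in> Field \<alpha>" for i using realizes_U[OF r[OF that]] by simp
  have wo: "Well_order \<alpha>" using m by (simp add: morley_seq_def)
  have "a ` underS \<alpha> i \<subseteq> U" for i using U by (auto simp: underS_def Field_def)
  then have n: "a i \<notin> A \<union> a ` underS \<alpha> i" if "i \<in> Field \<alpha>" for i
    by (intro nonalgebraic_notin[OF stableD(1,2)[OF p] _ r[OF that]]) (use A_sub in auto)
  show "inj_on a (Field \<alpha>)"
  proof (rule inj_onI, rule ccontr)
    fix i j assume ij: "i \<in> Field \<alpha>" "j \<in> Field \<alpha>" "a i = a j" "i \<noteq> j"
    then have "i \<in> underS \<alpha> j \<or> j \<in> underS \<alpha> i"
      using wo by (auto simp: order_on_defs total_on_def underS_def)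
    then have "a i \<in> a ` underS \<alpha> j \<or> a j \<in> a ` underS \<alpha> i" by (metis imageI)
    then show False using n[OF ij(1)] n[OF ij(2)] unfolding ij(3) by simp
  qed
qed

text \<open>The term of largest index in \<open>J\<close> is generic over the others; by symmetry it
  can be added to the base of each of them.\<close>

lemma morley_seq_independent:
  assumes p: "stable s p" and m: "morley_seq K s p A \<alpha> a"
    and J: "finite J" "J \<subseteq> Field \<alpha>"
  shows "independent s p (a ` J)"
  using J
proof (induction "card J" arbitrary: J)
  case 0
  then show ?case by (simp add: independent_def)
next
  case (Suc k)
  have wo: "Well_order \<alpha>" using m by (simp add: morley_seq_def)
  have "J \<noteq> {}" using Suc.hyps(2) by auto
  from Well_order_finite_max[OF wo Suc.prems(1) this Suc.prems(2)]
  obtain i where i: "i \<in> J" "\<forall>j\<in>J. (j, i) \<in> \<alpha>" by auto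
  let ?J = "J - {i}"
  have ind: "independent s p (a ` ?J)"
    by (rule Suc.hyps(1)) (use Suc.hyps(2) Suc.prems i in auto)
  have "?J \<subseteq> underS \<alpha> i" using i by (auto simp: underS_def)
  moreover have "realizes K s (a i) (restr p (A \<union> a ` underS \<alpha> i))"
    using m i(1) Suc.prems(2) by (auto simp: morley_seq_def)
  ultimately have ri: "realizes K s (a i) (restr p (A \<union> a ` ?J))"
    by (elim realizes_restr_mono) auto
  have JU: "a ` ?J \<subseteq> U" using morley_seq_new(2)[OF p m] Suc.prems by auto
  have "base (A \<union> a ` ?J)" by (rule base_finite) (use Suc.prems JU in auto)
  then have ai: "a i \<notin> A \<union> a ` ?J" using stable_new[OF p _ ri] by simp
  have im: "a ` J = insert (a i) (a ` ?J)" using i(1) by auto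
  show ?case unfolding independent_def
  proof
    fix x assume x: "x \<in> a ` J"
    show "realizes K s x (restr p (A \<union> (a ` J - {x})))"
    proof (cases "x = a i")
      case True
      have "a ` J - {a i} = a ` ?J" using im ai by auto
      then show ?thesis using ri True by simp
    next
      case False
      then have x': "x \<in> a ` ?J" using x im by auto
      let ?D = "A \<union> (a ` ?J - {x})"
      have D: "base ?D" by (rule base_finite) (use Suc.prems JU in auto)
      have rx: "realizes K s x (restr p ?D)" using ind x' unfolding independent_def by (rule bspec)
      have "insert x ?D = A \<union> a ` ?J" using x' by auto
      then have "realizes K s (a i) (restr p (insert x ?D))" using ri by simp
      from stable_symmetric[OF p D rx this]
      have "realizes K s x (restr p (insert (a i) ?D))" .
      moreover have "insert (a i) ?D = A \<union> (a ` J - {x})" using im False by auto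
      ultimately show ?thesis by simp
    qed
  qed
qed

text \<open>Maximality says that the first sequence spans \<open>N\<close>, so exchange bounds each
  finite part of the second by the length of the first; in particular the second is finite.\<close>

lemma maximal_morley_card_le:
  assumes p: "stable s p" and reg: "regular L \<kappa> K s p A"
    and \<alpha>: "maximal_morley_seq_in K s p A N \<alpha> a" "finite (Field \<alpha>)"
    and \<beta>: "morley_seq K s p A \<beta> b" "b ` Field \<beta> \<subseteq> N"
  shows "finite (Field \<beta>) \<and> card (Field \<beta>) \<le> card (Field \<alpha>)"
proof -
  have ma: "morley_seq K s p A \<alpha> a"
    and max: "\<not> (\<exists>x\<in>N. realizes K s x (restr p (A \<union> a ` Field \<alpha>)))"
    using \<alpha>(1) by (simp_all add: maximal_morley_seq_in_def)
  have *: "card J \<le> card (Field \<alpha>)" if J: "finite J" "J \<subseteq> Field \<beta>" for J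
  proof -
    have "card (b ` J) \<le> card (a ` Field \<alpha>)"
    proof (rule exchange_bound[OF p reg])
      show "independent s p (b ` J)" by (rule morley_seq_independent[OF p \<beta>(1) J])
      show "realizes K s x (restr p A)" if x: "x \<in> a ` Field \<alpha>" for x
      proof -
        obtain i where i: "i \<in> Field \<alpha>" "x = a i" using x by auto
        then have "realizes K s x (restr p (A \<union> a ` underS \<alpha> i))"
          using ma by (simp add: morley_seq_def)
        then show ?thesis by (rule realizes_restr_mono) simp
      qed
      show "\<not> realizes K s x (restr p (A \<union> a ` Field \<alpha>))" if "x \<in> b ` J" for x
        using max that J(2) \<beta>(2) by auto
    qed (use J \<alpha>(2) in simp_all)
    also have "card (b ` J) = card J"
      by (rule card_image[OF inj_on_subset[OF morley_seq_new(1)[OF p \<beta>(1)] J(2)]])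
    finally show ?thesis using card_image_le[OF \<alpha>(2), of a] by simp
  qed
  have "finite (Field \<beta>)"
  proof (rule ccontr)
    assume "infinite (Field \<beta>)"
    from infinite_arbitrarily_large[OF this, of "Suc (card (Field \<alpha>))"]
    obtain J where "finite J" "card J = Suc (card (Field \<alpha>))" "J \<subseteq> Field \<beta>" by auto
    then show False using * by force
  qed
  then show ?thesis using * by simp
qed

end

section \<open>Countability\<close>

text \<open>The types of symbols and elements may be uncountable. The code is claimed to be
  injective only on well-formed terms, whose symbols come from the countable language, with
  parameters from a countable set.\<close>

primrec enc_tm :: "('v \<Rightarrow> nat) \<Rightarrow> ('c \<Rightarrow> nat) \<Rightarrow> ('f \<Rightarrow> nat) \<Rightarrow> ('f, 'v, 'c) tm \<Rightarrow> nat" where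
  "enc_tm a b c (Var v) = prod_encode (0, a v)"
| "enc_tm a b c (Par p) = prod_encode (1, b p)"
| "enc_tm a b c (Fn f ts) = prod_encode (2, prod_encode (c f, list_encode (map (enc_tm a b c) ts)))"

primrec enc_fm :: "('v \<Rightarrow> nat) \<Rightarrow> ('c \<Rightarrow> nat) \<Rightarrow> ('f \<Rightarrow> nat) \<Rightarrow> ('r \<Rightarrow> nat) \<Rightarrow> ('f, 'r, 'v, 'c) fm \<Rightarrow> nat" where
  "enc_fm a b c d (Eq t u) = prod_encode (0, prod_encode (enc_tm a b c t, enc_tm a b c u))"
| "enc_fm a b c d (Rel r ts) = prod_encode (1, prod_encode (d r, list_encode (map (enc_tm a b c) ts)))"
| "enc_fm a b c d (Neg \<phi>) = prod_encode (2, enc_fm a b c d \<phi>)"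
| "enc_fm a b c d (Conj \<phi> \<psi>) = prod_encode (3, prod_encode (enc_fm a b c d \<phi>, enc_fm a b c d \<psi>))"
| "enc_fm a b c d (Ex v \<phi>) = prod_encode (4, prod_encode (a v, enc_fm a b c d \<phi>))"

lemma map_eq_inj:
  assumes "map h xs = map h ys" "\<And>x y. x \<in> set xs \<Longrightarrow> y \<in> set ys \<Longrightarrow> h x = h y \<Longrightarrow> x = y"
  shows "xs = ys"
proof (rule nth_equalityI)
  show len: "length xs = length ys" using assms(1) by (rule map_eq_imp_length_eq)
  fix i assume i: "i < length xs"
  have "h (xs ! i) = h (ys ! i)" using arg_cong[OF assms(1), of "\<lambda>l. l ! i"] i len by simp
  then show "xs ! i = ys ! i" using assms(2) i len by simp
qed

lemma enc_tm_inj: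
  assumes a: "inj_on a (UNIV \<times> sorts L)" and b: "inj_on b S" and c: "inj_on c (funs L)"
  shows "wf_tm L \<sigma> t \<Longrightarrow> tpars t \<subseteq> S \<Longrightarrow> wf_tm L \<sigma> u \<Longrightarrow> tpars u \<subseteq> S \<Longrightarrow>
    enc_tm a b c t = enc_tm a b c u \<Longrightarrow> t = u"
proof (induction t arbitrary: u)
  case (Var v)
  show ?case
  proof (cases u)
    case (Var w)
    have "v \<in> UNIV \<times> sorts L" "w \<in> UNIV \<times> sorts L"
      using Var.prems(1,3) Var by (simp_all add: mem_Times_iff)
    then show ?thesis using inj_onD[OF a, of v w] Var.prems(5) Var by simp
  qed (use Var.prems(5) in simp_all)
next
  case (Par x)
  show ?case
  proof (cases u)
    case (Par y)
    then show ?thesis using inj_onD[OF b, of x y] Par.prems by simp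
  qed (use Par.prems(5) in simp_all)
next
  case (Fn f ts)
  show ?case
  proof (cases u)
    case (Fn g us)
    have "c f = c g" using Fn.prems(5) unfolding Fn by simp
    then have "f = g" by (rule inj_onD[OF c]) (use Fn.prems(1,3) Fn in simp_all)
    moreover have "ts = us"
    proof (rule map_eq_inj[where h="enc_tm a b c"])
      show "map (enc_tm a b c) ts = map (enc_tm a b c) us"
        using Fn.prems(5) Fn by (simp add: list_encode_eq del: map_eq_conv)
      fix x y assume xy: "x \<in> set ts" "y \<in> set us" "enc_tm a b c x = enc_tm a b c y"
      have "wf_tm L \<sigma> x" "wf_tm L \<sigma> y" using Fn.prems(1,3) xy(1,2) Fn by simp_all
      note w = this
      have p: "tpars x \<subseteq> S" "tpars y \<subseteq> S" using Fn.prems(2,4) xy(1,2) unfolding Fn tm.set by auto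
      show "x = y" by (rule Fn.IH[OF xy(1) w(1) p(1) w(2) p(2) xy(3)])
    qed
    ultimately show ?thesis using Fn by simp
  qed (use Fn.prems(5) in simp_all)
qed

lemma enc_fm_inj:
  assumes a: "inj_on a (UNIV \<times> sorts L)" and b: "inj_on b S" and c: "inj_on c (funs L)"
    and d: "inj_on d (rels L)"
  shows "wf_fm L \<sigma> \<phi> \<Longrightarrow> pars \<phi> \<subseteq> S \<Longrightarrow> wf_fm L \<sigma> \<psi> \<Longrightarrow> pars \<psi> \<subseteq> S \<Longrightarrow>
    enc_fm a b c d \<phi> = enc_fm a b c d \<psi> \<Longrightarrow> \<phi> = \<psi>"
proof (induction \<phi> arbitrary: \<psi>)
  case (Eq t u)
  show ?case
  proof (cases \<psi>)
    case (Eq t' u')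
    have w: "wf_tm L \<sigma> t" "wf_tm L \<sigma> u" "wf_tm L \<sigma> t'" "wf_tm L \<sigma> u'"
      "tpars t \<subseteq> S" "tpars u \<subseteq> S" "tpars t' \<subseteq> S" "tpars u' \<subseteq> S"
      "enc_tm a b c t = enc_tm a b c t'" "enc_tm a b c u = enc_tm a b c u'"
      using Eq.prems unfolding Eq by simp_all
    have "t = t'" by (rule enc_tm_inj[OF a b c w(1,5,3,7,9)])
    moreover have "u = u'" by (rule enc_tm_inj[OF a b c w(2,6,4,8,10)])
    ultimately show ?thesis using Eq by simp
  qed (use Eq.prems(5) in simp_all)
next
  case (Rel r ts)
  show ?case
  proof (cases \<psi>)
    case (Rel r' us)
    have "d r = d r'" using Rel.prems(5) unfolding Rel by simp
    then have "r = r'" by (rule inj_onD[OF d]) (use Rel.prems(1,3) Rel in simp_all)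
    moreover have "ts = us"
    proof (rule map_eq_inj[where h="enc_tm a b c"])
      show "map (enc_tm a b c) ts = map (enc_tm a b c) us"
        using Rel.prems(5) Rel by (simp add: list_encode_eq del: map_eq_conv)
      fix x y assume xy: "x \<in> set ts" "y \<in> set us" "enc_tm a b c x = enc_tm a b c y"
      have "wf_tm L \<sigma> x" "wf_tm L \<sigma> y" using Rel.prems(1,3) xy(1,2) Rel by simp_all
      note w = this
      have p: "tpars x \<subseteq> S" "tpars y \<subseteq> S" using Rel.prems(2,4) xy(1,2) unfolding Rel fm.set by auto
      show "x = y" by (rule enc_tm_inj[OF a b c w(1) p(1) w(2) p(2) xy(3)])
    qed
    ultimately show ?thesis using Rel by simp
  qed (use Rel.prems(5) in simp_all)
next
  case (Neg \<phi>)
  show ?case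
  proof (cases \<psi>)
    case (Neg \<chi>)
    have "\<phi> = \<chi>" by (rule Neg.IH) (use Neg.prems Neg in simp_all)
    then show ?thesis using Neg by simp
  qed (use Neg.prems(5) in simp_all)
next
  case (Conj \<phi>1 \<phi>2)
  show ?case
  proof (cases \<psi>)
    case (Conj \<psi>1 \<psi>2)
    have "\<phi>1 = \<psi>1" by (rule Conj.IH(1)) (use Conj.prems Conj in simp_all)
    moreover have "\<phi>2 = \<psi>2" by (rule Conj.IH(2)) (use Conj.prems Conj in simp_all)
    ultimately show ?thesis using Conj by simp
  qed (use Conj.prems(5) in simp_all)
next
  case (Ex v \<phi>)
  show ?case
  proof (cases \<psi>)
    case (Ex w \<chi>)
    have "v \<in> UNIV \<times> sorts L" "w \<in> UNIV \<times> sorts L"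
      using Ex.prems(1,3) Ex by (simp_all add: mem_Times_iff)
    then have "v = w" using inj_onD[OF a, of v w] Ex.prems(5) Ex by simp
    moreover have "\<phi> = \<chi>" by (rule Ex.IH) (use Ex.prems Ex in simp_all)
    ultimately show ?thesis using Ex by simp
  qed (use Ex.prems(5) in simp_all)
qed

lemma countable_Fm:
  fixes L :: "('f, 'r, 's) language"
  assumes L: "countable_language L" and S: "countable S"
  shows "countable (Fm L \<sigma> S X)"
proof -
  have "countable ((UNIV :: nat set) \<times> sorts L)" "countable (funs L)" "countable (rels L)"
    using L by (simp_all add: countable_language_def)
  then obtain a :: "nat \<times> 's \<Rightarrow> nat" and c :: "'f \<Rightarrow> nat" and d :: "'r \<Rightarrow> nat"
    where abc: "inj_on a (UNIV \<times> sorts L)" "inj_on c (funs L)" "inj_on d (rels L)"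
    unfolding countable_def by (elim exE)
  obtain b :: "_ \<Rightarrow> nat" where b: "inj_on b S" using S unfolding countable_def by (elim exE)
  have "inj_on (enc_fm a b c d) (Fm L \<sigma> S X)"
    by (rule inj_onI, rule enc_fm_inj[OF abc(1) b abc(2,3), of \<sigma>]) (simp_all add: Fm_def)
  then show ?thesis by (rule countableI)
qed

section \<open>Elementary submodels\<close>

lemma val_univ_update [simp]: "val (M\<lparr>univ := N\<rparr>) e t = val M e t"
proof (induction t)
  case (Fn f ts)
  then have "map (val (M\<lparr>univ := N\<rparr>) e) ts = map (val M e) ts" by simp
  then show ?case by (simp del: map_eq_conv)
qed simp_all

text \<open>The witness condition concerns formulas with one free variable and parameters in
  \<open>N\<close>; closure under the functions is a consequence.\<close>

locale tarski_vaught =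
  fixes L :: "('f, 'r, 's) language" and M :: "('f, 'r, 's, 'a) struct" and N :: "'a set"
  assumes struct_M: "is_structure L M" and N_sub: "N \<subseteq> univ M"
    and witness: "\<And>\<phi> x. \<phi> \<in> Fm L (srt M) N {x} \<Longrightarrow> snd x \<in> sorts L \<Longrightarrow>
      \<exists>a. realizes M (snd x) a {\<phi>} \<Longrightarrow> \<exists>a\<in>N. realizes M (snd x) a {\<phi>}"
begin

lemma sat_submodel:
  "wf_fm L (srt M) \<phi> \<Longrightarrow> pars \<phi> \<subseteq> N \<Longrightarrow> (\<And>v. v \<in> fv \<phi> \<Longrightarrow> e v \<in> N \<and> srt M (e v) = snd v) \<Longrightarrow>
    sat (M\<lparr>univ := N\<rparr>) e \<phi> \<longleftrightarrow> sat M e \<phi>"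
proof (induction \<phi> arbitrary: e)
  case (Eq t u)
  show ?case by simp
next
  case (Rel r ts)
  have "map (val (M\<lparr>univ := N\<rparr>) e) ts = map (val M e) ts" by simp
  then show ?case by (simp del: map_eq_conv)
next
  case (Neg \<phi>)
  have "sat (M\<lparr>univ := N\<rparr>) e \<phi> \<longleftrightarrow> sat M e \<phi>" by (rule Neg.IH) (use Neg.prems in simp_all)
  then show ?case by simp
next
  case (Conj \<phi>1 \<phi>2)
  have "sat (M\<lparr>univ := N\<rparr>) e \<phi>1 \<longleftrightarrow> sat M e \<phi>1" by (rule Conj.IH(1)) (use Conj.prems in simp_all)
  moreover have "sat (M\<lparr>univ := N\<rparr>) e \<phi>2 \<longleftrightarrow> sat M e \<phi>2" by (rule Conj.IH(2)) (use Conj.prems in simp_all)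
  ultimately show ?case by simp
next
  case (Ex x \<phi>)
  have IH: "sat (M\<lparr>univ := N\<rparr>) (e(x := a)) \<phi> \<longleftrightarrow> sat M (e(x := a)) \<phi>"
    if "a \<in> N" "srt M a = snd x" for a
    by (rule Ex.IH) (use Ex.prems that in simp_all)
  have x: "snd x \<in> sorts L" using Ex.prems(1) by simp
  \<comment> \<open>The other free variables are filled in by their values, which lie in
    \<open>N\<close>, so that the witness condition applies.\<close>
  let ?\<phi> = "inst_fm {x} e \<phi>"
  have s: "sat1 M a ?\<phi> \<longleftrightarrow> sat M (e(x := a)) \<phi>" for a
    unfolding sat1_def sat_inst by (rule sat_cong) simp
  have "\<phi> \<in> Fm L (srt M) N (fv \<phi>)" using Ex.prems by (simp add: Fm_def)
  then have "?\<phi> \<in> Fm L (srt M) (N \<union> e ` (fv \<phi> - {x})) (fv \<phi> \<inter> {x})"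
    by (rule Fm_inst) (use Ex.prems(3) in simp)
  moreover have "N \<union> e ` (fv \<phi> - {x}) = N" using Ex.prems(3) by auto
  ultimately have "?\<phi> \<in> Fm L (srt M) N {x}" by (auto simp: Fm_def)
  note w = witness[OF this x]
  show ?case
  proof
    assume "sat (M\<lparr>univ := N\<rparr>) e (Ex x \<phi>)"
    then obtain a where "a \<in> N" "srt M a = snd x" "sat (M\<lparr>univ := N\<rparr>) (e(x := a)) \<phi>" by auto
    then show "sat M e (Ex x \<phi>)" using IH N_sub by (auto intro!: bexI[of _ a])
  next
    assume "sat M e (Ex x \<phi>)"
    then obtain a where "a \<in> univ M" "srt M a = snd x" "sat M (e(x := a)) \<phi>" by auto
    then have "realizes M (snd x) a {?\<phi>}" by (simp add: realizes_def s)
    then obtain b where b: "b \<in> N" "realizes M (snd x) b {?\<phi>}" using w by auto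
    then have "srt M b = snd x" "sat M (e(x := b)) \<phi>" by (simp_all add: realizes_def s)
    then show "sat (M\<lparr>univ := N\<rparr>) e (Ex x \<phi>)" using IH b(1) by (auto intro!: bexI[of _ b])
  qed
qed

text \<open>The witness condition applied to the equation x = f(as).\<close>

lemma closed_fint:
  assumes f: "f \<in> funs L" and as: "as \<in> tuples M (fdom L f)" "set as \<subseteq> N"
  shows "fint M f as \<in> N"
proof -
  let ?x = "(0 :: nat, fcod L f)" and ?t = "Fn f (map Par as)"
  have v: "fint M f as \<in> univ M" "srt M (fint M f as) = fcod L f"
    using struct_M f as(1) by (simp_all add: is_structure_def)
  have srt: "srt M a \<in> sorts L" if "a \<in> univ M" for a
    using struct_M that by (auto simp: is_structure_def)
  then have x: "snd ?x \<in> sorts L" using v by (metis snd_conv)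
  have "map (tm_srt L (srt M)) (map Par as) = fdom L f" using as(1) by (simp add: tuples_def o_def)
  moreover have "\<forall>t\<in>set (map Par as). wf_tm L (srt M) t" using as(1) srt by (auto simp: tuples_def)
  ultimately have "Eq (Var ?x) ?t \<in> Fm L (srt M) N {?x}"
    using f x as(2) by (auto simp: Fm_def)
  from witness[OF this x] obtain a where "a \<in> N" "realizes M (fcod L f) a {Eq (Var ?x) ?t}"
  proof -
    have "realizes M (snd ?x) (fint M f as) {Eq (Var ?x) ?t}"
      using v by (simp add: realizes_def sat1_def o_def)
    then show ?thesis using \<open>\<exists>a. realizes M (snd ?x) a _ \<Longrightarrow> _\<close> that by auto
  qed
  then show ?thesis by (simp add: realizes_def sat1_def o_def)
qed

lemma elementary: "elementary_submodel L M N"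
  unfolding elementary_submodel_def
proof (intro conjI ballI)
  show "N \<subseteq> univ M" by (rule N_sub)
  have "fint M f as \<in> N \<and> srt M (fint M f as) = fcod L f"
    if f: "f \<in> funs L" and as: "as \<in> tuples (M\<lparr>univ := N\<rparr>) (fdom L f)" for f as
  proof -
    have as': "as \<in> tuples M (fdom L f)" "set as \<subseteq> N" using as N_sub by (auto simp: tuples_def)
    then show ?thesis using closed_fint[OF f as'] struct_M f by (simp add: is_structure_def)
  qed
  moreover have "srt M ` N \<subseteq> sorts L" using struct_M N_sub by (auto simp: is_structure_def)
  ultimately show "is_structure L (M\<lparr>univ := N\<rparr>)" by (simp add: is_structure_def)
  fix \<phi> assume \<phi>: "\<phi> \<in> Fm L (srt M) N {}"
  then have fv: "fv \<phi> = {}" by (simp add: Fm_def)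
  have "sat (M\<lparr>univ := N\<rparr>) e \<phi> \<longleftrightarrow> sat M e \<phi>" for e
    by (rule sat_submodel) (use \<phi> fv in \<open>simp_all add: Fm_def\<close>)
  then show "holds (M\<lparr>univ := N\<rparr>) \<phi> \<longleftrightarrow> holds M \<phi>" by (simp add: holds_def)
qed

end

section \<open>Omitting types\<close>

lemma rename_variable:
  assumes \<phi>: "\<phi> \<in> Fm L \<sigma> S {x}" and y: "snd y = snd x"
  obtains \<psi> where "\<psi> \<in> Fm L \<sigma> S {y}" "\<And>M a. sat1 M a \<psi> \<longleftrightarrow> sat1 M a \<phi>"
proof
  define \<rho> where "\<rho> = (\<lambda>v. if v = x then y else if v = y then x else v)"
  have inj: "inj \<rho>" by (auto simp: inj_def \<rho>_def)
  have sr: "snd (\<rho> v) = snd v" for v using y by (simp add: \<rho>_def)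
  have "wf_fm L \<sigma> (map_fm \<rho> id \<phi>)" by (subst wf_fm_map) (use \<phi> sr in \<open>simp_all add: Fm_def\<close>)
  moreover have "fv (map_fm \<rho> id \<phi>) \<subseteq> {y}"
    unfolding fv_rename[OF inj] using \<phi> by (auto simp: Fm_def \<rho>_def)
  ultimately show "map_fm \<rho> id \<phi> \<in> Fm L \<sigma> S {y}" using \<phi> by (simp add: Fm_def fm.set_map)
  show "sat1 M a (map_fm \<rho> id \<phi>) \<longleftrightarrow> sat1 M a \<phi>" for M a
    unfolding sat1_def sat_rename[OF inj sr] by (simp add: comp_def)
qed

lemma finite_subset_chain:
  assumes "finite T" "T \<subseteq> (\<Union>n. C (n :: nat))" "\<And>n. C n \<subseteq> C (Suc n)"
  obtains n where "T \<subseteq> C n"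
proof -
  have mono: "m \<le> n \<Longrightarrow> C m \<subseteq> C n" for m n by (rule lift_Suc_mono_le[of C, OF assms(3)])
  have "\<exists>n. T \<subseteq> C n" using assms(1,2)
  proof (induction T rule: finite_induct)
    case (insert x T)
    then obtain n m where "T \<subseteq> C n" "x \<in> C m" by auto
    then have "insert x T \<subseteq> C (max n m)" using mono[of n "max n m"] mono[of m "max n m"] by auto
    then show ?case by (rule exI)
  qed simp
  then show ?thesis using that by auto
qed

context small_base
begin

lemma sat_pair_asg:
  assumes "\<psi> \<in> F S {(0, s), (1, u)}"
  shows "sat K ((\<lambda>_. c)((0, s) := a)) \<psi> \<longleftrightarrow> sat K (pair_asg a c) \<psi>"
    "sat K ((\<lambda>_. a)((1, u) := c)) \<psi> \<longleftrightarrow> sat K (pair_asg a c) \<psi>"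
proof -
  have v: "v = (0, s) \<or> v = (1, u)" if "v \<in> fv \<psi>" for v using assms that by (auto simp: Fm_def)
  show "sat K ((\<lambda>_. c)((0, s) := a)) \<psi> \<longleftrightarrow> sat K (pair_asg a c) \<psi>"
    by (rule sat_cong, drule v, elim disjE) (simp_all add: pair_asg_def)
  show "sat K ((\<lambda>_. a)((1, u) := c)) \<psi> \<longleftrightarrow> sat K (pair_asg a c) \<psi>"
    by (rule sat_cong, drule v, elim disjE) (simp_all add: pair_asg_def)
qed

text \<open>No consistent formula over \<open>C\<close> isolates the partial type
  \<open>P i\<close>. The sets \<open>P i\<close> stay fixed while \<open>C\<close> grows to a
  model, and this is the condition to be preserved.\<close>

definition non_isolating where
  "non_isolating I s P C \<longleftrightarrow> (\<forall>i\<in>I. \<forall>\<phi>\<in>F C {(0, s i)}. (\<exists>a. realizes K (s i) a {\<phi>}) \<longrightarrow>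
     (\<exists>\<chi>\<in>P i. \<exists>a. realizes K (s i) a {\<phi>} \<and> \<not> sat1 K a \<chi>))"

lemma non_isolatingD:
  assumes "non_isolating I s P C" "i \<in> I" "\<phi> \<in> F C {(0, s i)}" "realizes K (s i) a {\<phi>}"
  obtains \<chi> b where "\<chi> \<in> P i" "realizes K (s i) b {\<phi>}" "\<not> sat1 K b \<chi>"
  using assms unfolding non_isolating_def by metis

lemma non_isolating_chain:
  assumes "\<And>n. non_isolating I s P (C n)" "\<And>n. C n \<subseteq> C (Suc n)"
  shows "non_isolating I s P (\<Union>n. C (n :: nat))"
  unfolding non_isolating_def
proof (intro ballI impI)
  fix i \<phi> assume i: "i \<in> I" and \<phi>: "\<phi> \<in> F (\<Union>n. C n) {(0, s i)}" "\<exists>a. realizes K (s i) a {\<phi>}"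
  have "pars \<phi> \<subseteq> (\<Union>n. C n)" using \<phi>(1) by (simp add: Fm_def)
  from finite_subset_chain[OF finite_pars this assms(2)]
  obtain n where "pars \<phi> \<subseteq> C n" by metis
  then have "\<phi> \<in> F (C n) {(0, s i)}" by (rule Fm_pars[OF \<phi>(1)])
  then show "\<exists>\<chi>\<in>P i. \<exists>a. realizes K (s i) a {\<phi>} \<and> \<not> sat1 K a \<chi>"
    using assms(1)[of n] i \<phi>(2) by (simp add: non_isolating_def)
qed

text \<open>A property of \<theta> that prevents \<psi>(x, c) from isolating \<open>P i\<close> for
  all \<open>c\<close> satisfying \<theta>: either \<psi>(x, c) is always inconsistent, or one fixed
  \<chi> in \<open>P i\<close> never follows from it.\<close>

definition handled where
  "handled s P u i \<psi> \<theta> \<longleftrightarrow>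
    (\<forall>c a. realizes K u c {\<theta>} \<longrightarrow> a \<in> U \<longrightarrow> srt K a = s i \<longrightarrow> \<not> sat K (pair_asg a c) \<psi>) \<or>
    (\<exists>\<chi>\<in>P i. \<forall>c. realizes K u c {\<theta>} \<longrightarrow>
      (\<exists>a\<in>U. srt K a = s i \<and> sat K (pair_asg a c) \<psi> \<and> \<not> sat1 K a \<chi>))"

text \<open>The formula saying that \<psi>(x, y) holds for some \<open>y\<close> satisfying \<theta>
  is over \<open>C\<close>. If it is consistent, it does not imply some \<chi> in
  \<open>P i\<close>, and \<open>\<theta>'\<close> adds to \<theta> that \<psi>(x, y) has a solution
  violating \<chi>. If it is inconsistent, \<theta> itself will do.\<close>

lemma handle_step:
  assumes ni: "non_isolating I s P C" and PF: "\<forall>i\<in>I. P i \<subseteq> F C {(0, s i)}"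
    and so: "\<forall>i\<in>I. s i \<in> sorts L" and u: "u \<in> sorts L"
    and \<theta>: "\<theta> \<in> F C {(1, u)}" "realizes K u c0 {\<theta>}"
    and i: "i \<in> I" and \<psi>: "\<psi> \<in> F C {(0, s i), (1, u)}"
  shows "\<exists>\<theta>'. \<theta>' \<in> F C {(1, u)} \<and> (\<exists>c. realizes K u c {\<theta>'}) \<and>
    (\<forall>c. sat1 K c \<theta>' \<longrightarrow> sat1 K c \<theta>) \<and> handled s P u i \<psi> \<theta>'"
proof (cases "\<exists>c a. realizes K u c {\<theta>} \<and> a \<in> U \<and> srt K a = s i \<and> sat K (pair_asg a c) \<psi>")
  case False
  then have "handled s P u i \<psi> \<theta>" by (auto simp: handled_def)
  then show ?thesis using \<theta> by (intro exI[of _ \<theta>]) auto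
next
  case True
  then obtain c a where ca: "realizes K u c {\<theta>}" "a \<in> U" "srt K a = s i" "sat K (pair_asg a c) \<psi>"
    by (elim exE conjE)
  let ?x = "(0 :: nat, s i)" and ?y = "(1 :: nat, u)"
  have fv\<theta>: "fv \<theta> \<subseteq> {?y}" using \<theta>(1) by (simp add: Fm_def)
  define \<phi> where "\<phi> = Ex ?y (Conj \<theta> \<psi>)"
  have "\<theta> \<in> F C {?x, ?y}" using \<theta>(1) by (auto simp: Fm_def)
  then have "Conj \<theta> \<psi> \<in> F C (insert ?y {?x})" using \<psi> by (simp add: insert_commute)
  then have \<phi>F: "\<phi> \<in> F C {?x}" unfolding \<phi>_def by (rule Fm_Ex) (simp add: u)
  have \<phi>s: "sat1 K a \<phi> \<longleftrightarrow> (\<exists>c. realizes K u c {\<theta>} \<and> sat K (pair_asg a c) \<psi>)" for a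
  proof -
    have "sat1 K a \<phi> \<longleftrightarrow> (\<exists>c\<in>U. srt K c = u \<and> sat K ((\<lambda>_. a)(?y := c)) \<theta> \<and> sat K ((\<lambda>_. a)(?y := c)) \<psi>)"
      by (simp add: sat1_def \<phi>_def)
    also have "\<dots> \<longleftrightarrow> (\<exists>c\<in>U. srt K c = u \<and> sat1 K c \<theta> \<and> sat K (pair_asg a c) \<psi>)"
      unfolding sat_pair_asg(2)[OF \<psi>] sat_iff_sat1[OF fv\<theta>] by simp
    also have "\<dots> \<longleftrightarrow> (\<exists>c. realizes K u c {\<theta>} \<and> sat K (pair_asg a c) \<psi>)"
      by (auto simp: realizes_def)
    finally show ?thesis .
  qed
  have "sat1 K a \<phi>" unfolding \<phi>s using ca(1,4) by metis
  then have "realizes K (s i) a {\<phi>}" using ca(2,3) by (simp add: realizes_def)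
  from non_isolatingD[OF ni i \<phi>F this]
  obtain \<chi> b where \<chi>: "\<chi> \<in> P i" "realizes K (s i) b {\<phi>}" "\<not> sat1 K b \<chi>" by metis
  have \<chi>F: "\<chi> \<in> F C {?x}" using bspec[OF PF i] \<chi>(1) by (rule subsetD)
  then have fv\<chi>: "fv \<chi> \<subseteq> {?x}" by (simp add: Fm_def)
  define \<theta>' where "\<theta>' = Conj \<theta> (Ex ?x (Conj \<psi> (Neg \<chi>)))"
  have "\<chi> \<in> F C (insert ?x {?y})" using \<chi>F by (auto simp: Fm_def)
  then have "Ex ?x (Conj \<psi> (Neg \<chi>)) \<in> F C {?y}" using \<psi> bspec[OF so i] by (intro Fm_Ex) simp_all
  then have \<theta>'F: "\<theta>' \<in> F C {?y}" using \<theta>(1) by (simp add: \<theta>'_def)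
  have \<theta>'s: "sat1 K c \<theta>' \<longleftrightarrow> sat1 K c \<theta> \<and>
      (\<exists>a\<in>U. srt K a = s i \<and> sat K (pair_asg a c) \<psi> \<and> \<not> sat1 K a \<chi>)" for c
  proof -
    have "sat1 K c \<theta>' \<longleftrightarrow> sat1 K c \<theta> \<and> (\<exists>a\<in>U. srt K a = s i \<and>
        sat K ((\<lambda>_. c)(?x := a)) \<psi> \<and> \<not> sat K ((\<lambda>_. c)(?x := a)) \<chi>)"
      by (simp add: sat1_def \<theta>'_def)
    then show ?thesis unfolding sat_pair_asg(1)[OF \<psi>] sat_iff_sat1[OF fv\<chi>] by simp
  qed
  obtain d where d: "realizes K u d {\<theta>}" "sat K (pair_asg b d) \<psi>"
    using \<chi>(2) \<phi>s[of b] by (auto simp: realizes_def)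
  have "sat1 K d \<theta>'" unfolding \<theta>'s using d \<chi>(2,3) by (auto simp: realizes_def intro!: bexI[of _ b])
  then have "realizes K u d {\<theta>'}" using d(1) by (simp add: realizes_def)
  moreover have "handled s P u i \<psi> \<theta>'" unfolding handled_def
    by (rule disjI2, rule bexI[OF _ \<chi>(1)]) (simp add: realizes_def \<theta>'s)
  moreover have "\<forall>c. sat1 K c \<theta>' \<longrightarrow> sat1 K c \<theta>" by (simp add: \<theta>'s)
  ultimately show ?thesis using \<theta>'F by metis
qed

text \<open>
  A Baire category argument in the space of types over \<open>C\<close> in the variable of \<open>\<phi>\<close>: for each of
  countably many \<open>\<psi>(x, y)\<close>, the types of those \<open>c\<close> for which \<open>\<psi>(x, c)\<close> isolates \<open>P i\<close> form a nowhere
  dense set.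
\<close>

lemma non_isolating_extend:
  assumes ni: "non_isolating I s P C" and PF: "\<forall>i\<in>I. P i \<subseteq> F C {(0, s i)}"
    and so: "\<forall>i\<in>I. s i \<in> sorts L" and I: "countable I" and C: "countable C" "C \<subseteq> U"
    and x: "snd x \<in> sorts L" and \<phi>: "\<phi> \<in> F C {x}" "realizes K (snd x) c0 {\<phi>}"
  shows "\<exists>c. realizes K (snd x) c {\<phi>} \<and> non_isolating I s P (insert c C)"
proof -
  define u where "u = snd x"
  have u: "u \<in> sorts L" using x by (simp add: u_def)
  let ?y = "(1 :: nat, u)"
  \<comment> \<open>Index 1 keeps this variable apart from the variables (0, s i) of the types,
    which may have the same sort.\<close>
  obtain \<phi>' where \<phi>': "\<phi>' \<in> F C {?y}" and "\<And>(M :: ('f, 'r, 's, 'a) struct) a. sat1 M a \<phi>' \<longleftrightarrow> sat1 M a \<phi>"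
    by (rule rename_variable[OF \<phi>(1), of ?y], simp add: u_def, rule that)
  then have \<phi>'s: "sat1 K a \<phi>' \<longleftrightarrow> sat1 K a \<phi>" for a by simp
  define T where "T = (SIGMA i:I. F C {(0, s i), (1, u)})"
  have T: "countable T" unfolding T_def
    by (intro countable_SIGMA I countable_Fm countable_lang C)
  \<comment> \<open>If \<open>T\<close> is empty the values are arbitrary, hence the guards
    \<open>task n \<in> T\<close>.\<close>
  define task where "task = from_nat_into T"
  define good where "good = (\<lambda>\<theta>. \<theta> \<in> F C {?y} \<and> (\<exists>c. realizes K u c {\<theta>}) \<and> (\<forall>c. sat1 K c \<theta> \<longrightarrow> sat1 K c \<phi>))"
  have "\<exists>\<theta>. \<forall>n. good (\<theta> n) \<and> ((\<forall>c. sat1 K c (\<theta> (Suc n)) \<longrightarrow> sat1 K c (\<theta> n)) \<and>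
      (task n \<in> T \<longrightarrow> handled s P u (fst (task n)) (snd (task n)) (\<theta> (Suc n))))"
  proof (rule dependent_nat_choice)
    show "\<exists>\<theta>. good \<theta>"
      using \<phi>' \<phi>'s \<phi>(2) unfolding good_def by (intro exI[of _ \<phi>']) (auto simp: realizes_def u_def)
    fix \<theta> n assume \<theta>: "good \<theta>"
    then obtain c1 where c1: "\<theta> \<in> F C {?y}" "realizes K u c1 {\<theta>}" by (auto simp: good_def)
    show "\<exists>\<theta>'. good \<theta>' \<and> ((\<forall>c. sat1 K c \<theta>' \<longrightarrow> sat1 K c \<theta>) \<and>
      (task n \<in> T \<longrightarrow> handled s P u (fst (task n)) (snd (task n)) \<theta>'))"
    proof (cases "task n \<in> T")
      case False
      then show ?thesis using \<theta> by (intro exI[of _ \<theta>]) simp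
    next
      case True
      then have "fst (task n) \<in> I" "snd (task n) \<in> F C {(0, s (fst (task n))), (1, u)}"
        by (auto simp: T_def)
      from handle_step[OF ni PF so u c1 this]
      obtain \<theta>' c2 where \<theta>': "\<theta>' \<in> F C {?y}" "realizes K u c2 {\<theta>'}"
        "\<forall>c. sat1 K c \<theta>' \<longrightarrow> sat1 K c \<theta>" "handled s P u (fst (task n)) (snd (task n)) \<theta>'"
        by (elim exE conjE)
      moreover have "\<exists>c. realizes K u c {\<theta>'}" using \<theta>'(2) by (rule exI)
      then have "good \<theta>'" using \<theta> \<theta>'(1,3) by (simp add: good_def)
      ultimately show ?thesis by (intro exI[of _ \<theta>']) simp
    qed
  qed
  then obtain \<theta> where \<theta>: "\<And>n. good (\<theta> n)" "\<And>n c. sat1 K c (\<theta> (Suc n)) \<Longrightarrow> sat1 K c (\<theta> n)"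
    "\<And>n. task n \<in> T \<Longrightarrow> handled s P u (fst (task n)) (snd (task n)) (\<theta> (Suc n))" by metis
  have dec: "sat1 K c (\<theta> n) \<Longrightarrow> m \<le> n \<Longrightarrow> sat1 K c (\<theta> m)" for c m n
  proof (induction n)
    case (Suc n)
    then show ?case using \<theta>(2)[of c n] by (cases "m = Suc n") auto
  qed simp
  have "\<exists>c. realizes K u c (range \<theta>)"
  proof (rule realize_finite[OF small_countable[OF C] u])
    show "range \<theta> \<subseteq> F C {?y}" using \<theta>(1) by (auto simp: good_def)
    fix G assume G: "G \<subseteq> range \<theta>" "finite G"
    from finite_subset_image[OF G(2,1)] obtain J where J: "finite J" "G = \<theta> ` J" by metis
    obtain n where n: "\<forall>m\<in>J. m \<le> n" using J(1) finite_nat_set_iff_bounded_le by metis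
    obtain c where c: "realizes K u c {\<theta> n}" using \<theta>(1)[of n] by (auto simp: good_def)
    have "sat1 K c \<zeta>" if "\<zeta> \<in> G" for \<zeta>
      using that J(2) n dec[of c n] c by (auto simp: realizes_def)
    then show "\<exists>c. realizes K u c G" using c by (intro exI[of _ c]) (simp add: realizes_def)
  qed
  then obtain c where c: "realizes K u c (range \<theta>)" ..
  have cU: "c \<in> U" "srt K c = u" using realizes_U[OF c] by simp_all
  have cn: "realizes K u c {\<theta> n}" for n by (rule realizes_mono[OF c]) simp
  have "non_isolating I s P (insert c C)" unfolding non_isolating_def
  proof (intro ballI impI)
    fix i \<eta> assume i: "i \<in> I" and \<eta>: "\<eta> \<in> F (insert c C) {(0, s i)}" "\<exists>a. realizes K (s i) a {\<eta>}"
    obtain \<psi> where \<psi>0: "\<psi> \<in> F (C - {c}) (insert ?y {(0, s i)})"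
      and sat\<psi>: "\<And>(M :: ('f, 'r, 's, 'a) struct) h e. sat M e (map_fm id h \<eta>) \<longleftrightarrow> sat M (e(?y := h c)) (map_fm id h \<psi>)"
      by (rule abstract_param[OF \<eta>(1), of ?y]) (use cU(2) in auto)
    have \<psi>: "\<psi> \<in> F C {(0, s i), (1, u)}" using \<psi>0 by (auto simp: Fm_def)
    have eq: "sat1 K a \<eta> \<longleftrightarrow> sat K (pair_asg a c) \<psi>" for a
      using sat\<psi>[of K "\<lambda>_. a" id] unfolding fm.map_id id_apply sat_pair_asg(2)[OF \<psi>] sat1_def .
    obtain a where a: "realizes K (s i) a {\<eta>}" using \<eta>(2) ..
    \<comment> \<open>A formula over \<open>insert c C\<close> is \<psi>(x, c) for one of the tasks,
      and \<open>c\<close> satisfies the formula by which this task was handled.\<close>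
    have "(i, \<psi>) \<in> T" using i \<psi> by (simp add: T_def)
    then obtain n where n: "task n = (i, \<psi>)" unfolding task_def
      using from_nat_into_surj[OF T] by metis
    from \<theta>(3)[of n] \<open>(i, \<psi>) \<in> T\<close> have h: "handled s P u i \<psi> (\<theta> (Suc n))" unfolding n by simp
    have "sat K (pair_asg a c) \<psi>" "a \<in> U" "srt K a = s i" using a eq by (simp_all add: realizes_def)
    with h cn[of "Suc n"] have "\<exists>\<chi>\<in>P i. \<exists>a\<in>U. srt K a = s i \<and> sat K (pair_asg a c) \<psi> \<and> \<not> sat1 K a \<chi>"
      unfolding handled_def by metis
    then show "\<exists>\<chi>\<in>P i. \<exists>a. realizes K (s i) a {\<eta>} \<and> \<not> sat1 K a \<chi>"
      using eq by (auto simp: realizes_def)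
  qed
  moreover have "realizes K (snd x) c {\<phi>}"
    using cn[of 0] \<theta>(1)[of 0] by (simp add: realizes_def good_def u_def)
  ultimately show ?thesis by metis
qed

text \<open>Witnesses are added one at a time, for the consistent formulas over \<open>C\<close>
  only; formulas over the new elements are left to the next round.\<close>

lemma non_isolating_closure:
  assumes ni: "non_isolating I s P C" and PF: "\<forall>i\<in>I. P i \<subseteq> F C {(0, s i)}"
    and so: "\<forall>i\<in>I. s i \<in> sorts L" and I: "countable I" and C: "countable C" "C \<subseteq> U"
  shows "\<exists>C'. countable C' \<and> C \<subseteq> C' \<and> C' \<subseteq> U \<and> non_isolating I s P C' \<and>
    (\<forall>x \<phi>. \<phi> \<in> F C {x} \<longrightarrow> snd x \<in> sorts L \<longrightarrow> (\<exists>a. realizes K (snd x) a {\<phi>}) \<longrightarrow>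
      (\<exists>a\<in>C'. realizes K (snd x) a {\<phi>}))"
proof -
  define T where "T = {(x, \<phi>). \<phi> \<in> F C {x} \<and> snd x \<in> sorts L \<and> (\<exists>a. realizes K (snd x) a {\<phi>})}"
  have "T \<subseteq> (SIGMA x:UNIV \<times> sorts L. F C {x})" by (auto simp: T_def)
  moreover have "countable (SIGMA x:(UNIV :: nat set) \<times> sorts L. F C {x})"
    by (intro countable_SIGMA countable_Fm countable_lang C)
      (use countable_lang in \<open>simp_all add: countable_language_def\<close>)
  ultimately have T: "countable T" by (rule countable_subset)
  define task where "task = from_nat_into T"
  define good where "good = (\<lambda>E. countable E \<and> C \<subseteq> E \<and> E \<subseteq> U \<and> non_isolating I s P E)"
  have "\<exists>E. \<forall>n. good (E n) \<and> (E n \<subseteq> E (Suc n) \<and>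
    (task n \<in> T \<longrightarrow> (\<exists>a\<in>E (Suc n). realizes K (snd (fst (task n))) a {snd (task n)})))"
  proof (rule dependent_nat_choice)
    show "\<exists>E. good E" using ni C by (intro exI[of _ C]) (simp add: good_def)
    fix E n assume E: "good E"
    show "\<exists>E'. good E' \<and> (E \<subseteq> E' \<and>
      (task n \<in> T \<longrightarrow> (\<exists>a\<in>E'. realizes K (snd (fst (task n))) a {snd (task n)})))"
    proof (cases "task n \<in> T")
      case False
      then show ?thesis using E by (intro exI[of _ E]) simp
    next
      case True
      obtain x \<phi> where t: "task n = (x, \<phi>)" by (cases "task n")
      with True have x\<phi>: "\<phi> \<in> F C {x}" "snd x \<in> sorts L" "\<exists>a. realizes K (snd x) a {\<phi>}"
        by (simp_all add: T_def)
      obtain a0 where a0: "realizes K (snd x) a0 {\<phi>}" using x\<phi>(3) ..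
      have E': "countable E" "C \<subseteq> E" "E \<subseteq> U" "non_isolating I s P E" using E by (simp_all add: good_def)
      have mono: "F C X \<subseteq> F E X" for X by (rule Fm_mono[OF E'(2)]) simp
      have PE: "\<forall>i\<in>I. P i \<subseteq> F E {(0, s i)}" using subset_trans[OF bspec[OF PF] mono] by simp
      have \<phi>E: "\<phi> \<in> F E {x}" using mono x\<phi>(1) by (rule subsetD)
      from non_isolating_extend[OF E'(4) PE so I E'(1,3) x\<phi>(2) \<phi>E a0]
      obtain c where c: "realizes K (snd x) c {\<phi>}" "non_isolating I s P (insert c E)" by (elim exE conjE)
      have "good (insert c E)" using E' c(2) realizes_U[OF c(1)] by (auto simp: good_def)
      then show ?thesis using c(1) unfolding t by (intro exI[of _ "insert c E"]) auto
    qed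
  qed
  then obtain E where E: "\<And>n. good (E n)" "\<And>n. E n \<subseteq> E (Suc n)"
    "\<And>n. task n \<in> T \<Longrightarrow> \<exists>a\<in>E (Suc n). realizes K (snd (fst (task n))) a {snd (task n)}" by metis
  have g: "countable (E n)" "C \<subseteq> E n" "E n \<subseteq> U" "non_isolating I s P (E n)" for n
    using E(1)[of n] by (simp_all add: good_def)
  have "countable (\<Union>n. E n)" using g(1) by simp
  moreover have "C \<subseteq> (\<Union>n. E n)" using g(2)[of 0] by auto
  moreover have "(\<Union>n. E n) \<subseteq> U" using g(3) by auto
  moreover have "non_isolating I s P (\<Union>n. E n)" by (rule non_isolating_chain[of I s P E, OF g(4) E(2)])
  moreover have "\<exists>a\<in>\<Union>n. E n. realizes K (snd x) a {\<phi>}"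
    if "\<phi> \<in> F C {x}" "snd x \<in> sorts L" "\<exists>a. realizes K (snd x) a {\<phi>}" for x \<phi>
  proof -
    have "(x, \<phi>) \<in> T" using that by (simp add: T_def)
    then obtain n where n: "task n = (x, \<phi>)" unfolding task_def using from_nat_into_surj[OF T] by metis
    from E(3)[of n] \<open>(x, \<phi>) \<in> T\<close> show ?thesis unfolding n by auto
  qed
  ultimately show ?thesis by (intro exI[of _ "\<Union>n. E n"]) simp
qed

text \<open>After \<omega> rounds of adding witnesses the union passes the Tarski-Vaught test. No
  element \<open>a\<close> of it realizes \<open>P i\<close>, because x = a would isolate
  \<open>P i\<close>.\<close>

lemma omitting_types:
  assumes ni: "non_isolating I s P C" and PF: "\<forall>i\<in>I. P i \<subseteq> F C {(0, s i)}"
    and so: "\<forall>i\<in>I. s i \<in> sorts L" and I: "countable I" and C: "countable C" "C \<subseteq> U"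
  shows "\<exists>N. countable N \<and> C \<subseteq> N \<and> tarski_vaught L K N \<and>
    (\<forall>i\<in>I. \<not> (\<exists>a\<in>N. realizes K (s i) a (P i)))"
proof -
  define good where "good = (\<lambda>E. countable E \<and> C \<subseteq> E \<and> E \<subseteq> U \<and> non_isolating I s P E)"
  have "\<exists>E. \<forall>n :: nat. good (E n) \<and> (E n \<subseteq> E (Suc n) \<and>
    (\<forall>x \<phi>. \<phi> \<in> F (E n) {x} \<longrightarrow> snd x \<in> sorts L \<longrightarrow> (\<exists>a. realizes K (snd x) a {\<phi>}) \<longrightarrow>
      (\<exists>a\<in>E (Suc n). realizes K (snd x) a {\<phi>})))"
  proof (rule dependent_nat_choice)
    show "\<exists>E. good E" using ni C by (intro exI[of _ C]) (simp add: good_def)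
    fix E and n :: nat assume E: "good E"
    have E': "countable E" "C \<subseteq> E" "E \<subseteq> U" "non_isolating I s P E" using E by (simp_all add: good_def)
    have mono: "F C X \<subseteq> F E X" for X by (rule Fm_mono[OF E'(2)]) simp
    have PE: "\<forall>i\<in>I. P i \<subseteq> F E {(0, s i)}" using subset_trans[OF bspec[OF PF] mono] by simp
    from non_isolating_closure[OF E'(4) PE so I E'(1,3)]
    obtain E1 where E1: "countable E1" "E \<subseteq> E1" "E1 \<subseteq> U" "non_isolating I s P E1"
      "\<forall>x \<phi>. \<phi> \<in> F E {x} \<longrightarrow> snd x \<in> sorts L \<longrightarrow> (\<exists>a. realizes K (snd x) a {\<phi>}) \<longrightarrow>
      (\<exists>a\<in>E1. realizes K (snd x) a {\<phi>})" by (elim exE conjE)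
    have "good E1" using E1(1-4) E'(2) by (auto simp: good_def)
    then show "\<exists>E'. good E' \<and> (E \<subseteq> E' \<and>
      (\<forall>x \<phi>. \<phi> \<in> F E {x} \<longrightarrow> snd x \<in> sorts L \<longrightarrow> (\<exists>a. realizes K (snd x) a {\<phi>}) \<longrightarrow>
      (\<exists>a\<in>E'. realizes K (snd x) a {\<phi>})))" using E1(2,5) by (intro exI[of _ E1] conjI)
  qed
  then obtain E where all: "\<forall>n :: nat. good (E n) \<and> (E n \<subseteq> E (Suc n) \<and>
    (\<forall>x \<phi>. \<phi> \<in> F (E n) {x} \<longrightarrow> snd x \<in> sorts L \<longrightarrow> (\<exists>a. realizes K (snd x) a {\<phi>}) \<longrightarrow>
      (\<exists>a\<in>E (Suc n). realizes K (snd x) a {\<phi>})))" ..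
  have g: "countable (E n)" "C \<subseteq> E n" "E n \<subseteq> U" "non_isolating I s P (E n)" "E n \<subseteq> E (Suc n)" for n
    using all[THEN spec, of n] by (simp_all add: good_def)
  have w: "\<exists>a\<in>E (Suc n). realizes K (snd x) a {\<phi>}"
    if "\<phi> \<in> F (E n) {x}" "snd x \<in> sorts L" "\<exists>a. realizes K (snd x) a {\<phi>}" for x \<phi> n
    using all[THEN spec, THEN conjunct2, THEN conjunct2, of n, THEN spec, THEN spec, THEN mp, OF that(1),
      THEN mp, OF that(2), THEN mp, OF that(3)] .
  let ?N = "\<Union>n. E n"
  have NU: "?N \<subseteq> U" using g(3) by auto
  have nN: "non_isolating I s P ?N" by (rule non_isolating_chain[of I s P E, OF g(4,5)])
  have "tarski_vaught L K ?N"
  proof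
    show "is_structure L K" by (rule struct)
    show "?N \<subseteq> U" by (rule NU)
    fix \<phi> x assume \<phi>: "\<phi> \<in> F ?N {x}" "snd x \<in> sorts L" "\<exists>a. realizes K (snd x) a {\<phi>}"
    have "pars \<phi> \<subseteq> ?N" using \<phi>(1) by (simp add: Fm_def)
    from finite_subset_chain[OF finite_pars this g(5)] obtain n where "pars \<phi> \<subseteq> E n" by metis
    from w[OF Fm_pars[OF \<phi>(1) this] \<phi>(2,3)] show "\<exists>a\<in>?N. realizes K (snd x) a {\<phi>}" by auto
  qed
  moreover have "\<not> realizes K (s i) a (P i)" if i: "i \<in> I" and a: "a \<in> ?N" for i a
  proof
    assume ra: "realizes K (s i) a (P i)"
    then have aU: "a \<in> U" "srt K a = s i" using realizes_U by simp_all
    let ?e = "Eq (Var (0, s i)) (Par a)"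
    have "?e \<in> F ?N {(0, s i)}" by (rule Fm_eq) (use a aU bspec[OF so i] in simp_all)
    moreover have "realizes K (s i) a {?e}" using aU by (simp add: realizes_def sat1_def)
    ultimately obtain \<chi> b where "\<chi> \<in> P i" "realizes K (s i) b {?e}" "\<not> sat1 K b \<chi>"
      using non_isolatingD[OF nN i] by metis
    moreover from this(2) have "b = a" by (simp add: realizes_def sat1_def)
    ultimately show False using ra by (simp add: realizes_def)
  qed
  moreover have "countable ?N" using g(1) by simp
  moreover have "C \<subseteq> ?N" using g(2)[of 0] by auto
  ultimately show ?thesis by (intro exI[of _ ?N]) simp
qed

end

section \<open>Saturation in several variables\<close>

definition exs :: "'v list \<Rightarrow> ('f, 'r, 'v, 'c) fm \<Rightarrow> ('f, 'r, 'v, 'c) fm" where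
  "exs ws \<phi> = foldr Ex ws \<phi>"

lemma exs_simps [simp]: "exs [] \<phi> = \<phi>" "exs (w # ws) \<phi> = Ex w (exs ws \<phi>)"
  by (simp_all add: exs_def)

lemma fv_exs: "fv (exs ws \<phi>) = fv \<phi> - set ws"
  by (induction ws) auto

lemma pars_exs: "pars (exs ws \<phi>) = pars \<phi>"
  by (induction ws) auto

lemma wf_exs: "wf_fm L \<sigma> (exs ws \<phi>) \<longleftrightarrow> snd ` set ws \<subseteq> sorts L \<and> wf_fm L \<sigma> \<phi>"
  by (induction ws) auto

lemma sat_exs: "sat M e (exs ws \<phi>) \<longleftrightarrow>
  (\<exists>e'. assigns M (set ws) e' \<and> (\<forall>v. v \<notin> set ws \<longrightarrow> e' v = e v) \<and> sat M e' \<phi>)"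
proof (induction ws arbitrary: e)
  case Nil
  have "(\<forall>v. e' v = e v) \<longleftrightarrow> e' = e" for e' by (auto simp: fun_eq_iff)
  then show ?case by (simp add: assigns_def)
next
  case (Cons w ws)
  show ?case
  proof
    assume "sat M e (exs (w # ws) \<phi>)"
    then obtain a where a: "a \<in> univ M" "srt M a = snd w" "sat M (e(w := a)) (exs ws \<phi>)" by auto
    from a(3)[unfolded Cons.IH] obtain e' where e': "assigns M (set ws) e'"
      "\<forall>v. v \<notin> set ws \<longrightarrow> e' v = (e(w := a)) v" "sat M e' \<phi>" by (elim exE conjE)
    have "e' w \<in> univ M \<and> srt M (e' w) = snd w"
    proof (cases "w \<in> set ws")
      case True
      then show ?thesis using e'(1) by (simp add: assigns_def)
    next
      case False
      from e'(2)[THEN spec, THEN mp, OF this] show ?thesis using a(1,2) by simp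
    qed
    then have "assigns M (set (w # ws)) e'" using e'(1) by (simp add: assigns_def)
    moreover have "\<forall>v. v \<notin> set (w # ws) \<longrightarrow> e' v = e v" using e'(2) by simp
    ultimately show "\<exists>e'. assigns M (set (w # ws)) e' \<and> (\<forall>v. v \<notin> set (w # ws) \<longrightarrow> e' v = e v) \<and> sat M e' \<phi>"
      using e'(3) by (intro exI[of _ e'] conjI)
  next
    assume "\<exists>e'. assigns M (set (w # ws)) e' \<and> (\<forall>v. v \<notin> set (w # ws) \<longrightarrow> e' v = e v) \<and> sat M e' \<phi>"
    then obtain e' where e': "assigns M (set (w # ws)) e'" "\<forall>v. v \<notin> set (w # ws) \<longrightarrow> e' v = e v" "sat M e' \<phi>"
      by (elim exE conjE)
    have "sat M (e(w := e' w)) (exs ws \<phi>)" unfolding Cons.IH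
      by (rule exI[of _ e']) (use e' in \<open>auto simp: assigns_def\<close>)
    moreover have "e' w \<in> univ M \<and> srt M (e' w) = snd w" using e'(1) by (simp add: assigns_def)
    ultimately show "sat M e (exs (w # ws) \<phi>)" by (auto intro!: bexI[of _ "e' w"])
  qed
qed

context saturated_structure
begin

text \<open>Induction on the variables: the first one is made to satisfy the existential closures of
  all finite conjunctions from \<Sigma>; once its value is filled in as a parameter, the rest is
  again finitely satisfiable. Tuples are needed because they represent imaginaries.\<close>

lemma realize_finite_tuple:
  assumes "small \<kappa> K S" "\<forall>w\<in>set ws. snd w \<in> sorts L" "\<Sigma> \<subseteq> F S (set ws)"
    and "\<forall>G. G \<subseteq> \<Sigma> \<longrightarrow> finite G \<longrightarrow> (\<exists>e. assigns K (set ws) e \<and> (\<forall>\<phi>\<in>G. sat K e \<phi>))"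
  shows "\<exists>e. assigns K (set ws) e \<and> (\<forall>\<phi>\<in>\<Sigma>. sat K e \<phi>)"
  using assms
proof (induction ws arbitrary: S \<Sigma>)
  case Nil
  have "sat K e \<phi>" if \<phi>: "\<phi> \<in> \<Sigma>" for e \<phi>
  proof -
    have "{\<phi>} \<subseteq> \<Sigma>" "finite {\<phi>}" using \<phi> by simp_all
    from Nil.prems(4)[THEN spec, THEN mp, OF this(1), THEN mp, OF this(2)]
    obtain e' where "sat K e' \<phi>" by auto
    moreover have "fv \<phi> = {}" using Nil.prems(3) \<phi> by (auto simp: Fm_def)
    ultimately show ?thesis using sat_cong[of \<phi> e e' K] by simp
  qed
  then show ?case by (simp add: assigns_def)
next
  case (Cons w ws)
  show ?case
  proof (cases "w \<in> set ws")
    case True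
    then have "set (w # ws) = set ws" by auto
    then show ?thesis using Cons.IH[OF Cons.prems(1)] Cons.prems(2-4) by simp
  next
    case False
    have sw: "snd w \<in> sorts L" using Cons.prems(2) by simp
    define X where "X = (\<lambda>l :: ('f, 'r, 's, 'a) formula list. exs ws (conjs (snd w) l))"
    define \<Sigma>1 where "\<Sigma>1 = {X l | l. set l \<subseteq> \<Sigma>}"
    have "\<exists>a. realizes K (snd w) a \<Sigma>1"
    proof (rule realize_finite[OF Cons.prems(1) sw, of _ "fst w"])
      have "X l \<in> F S {w}" if "set l \<subseteq> \<Sigma>" for l
      proof -
        have "conjs (snd w) l \<in> F S (set (w # ws))"
          by (rule Fm_conjs[OF sw]) (use that Cons.prems(3) in simp)
        then show ?thesis using Cons.prems(2) unfolding X_def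
          by (auto simp: Fm_def fv_exs pars_exs wf_exs)
      qed
      then show "\<Sigma>1 \<subseteq> F S {(fst w, snd w)}" by (auto simp: \<Sigma>1_def)
      fix G assume G: "G \<subseteq> \<Sigma>1" "finite G"
      have "\<Sigma>1 = X ` {l. set l \<subseteq> \<Sigma>}" by (auto simp: \<Sigma>1_def)
      with G have "G \<subseteq> X ` {l. set l \<subseteq> \<Sigma>}" by simp
      from finite_subset_image[OF G(2) this]
      obtain H where H: "H \<subseteq> {l. set l \<subseteq> \<Sigma>}" "finite H" "G = X ` H" by metis
      have "\<Union> (set ` H) \<subseteq> \<Sigma>" "finite (\<Union> (set ` H))" using H(1,2) by auto
      from Cons.prems(4)[THEN spec, THEN mp, OF this(1), THEN mp, OF this(2)]
      obtain e where e: "assigns K (set (w # ws)) e" "\<forall>\<phi>\<in>\<Union> (set ` H). sat K e \<phi>" by (elim exE conjE)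
      have "sat1 K (e w) (X l)" if l: "l \<in> H" for l
      proof -
        have "sat K e (X l)" unfolding X_def sat_exs
          by (rule exI[of _ e]) (use e l in \<open>auto simp: assigns_def\<close>)
        moreover have "fv (X l) \<subseteq> {w}"
          using \<open>\<And>l. set l \<subseteq> \<Sigma> \<Longrightarrow> X l \<in> F S {w}\<close>[of l] H(1) l by (auto simp: Fm_def)
        ultimately show ?thesis using sat_iff_sat1 by metis
      qed
      then show "\<exists>a. realizes K (snd w) a G"
        using e(1) H(3) by (intro exI[of _ "e w"]) (simp add: realizes_def assigns_def)
    qed
    then obtain a where a: "realizes K (snd w) a \<Sigma>1" ..
    have aU: "a \<in> U" "srt K a = snd w" using a by (simp_all add: realizes_def)
    define ia where "ia = (\<lambda>\<phi> :: ('f, 'r, 's, 'a) formula. inst_fm (set ws) (\<lambda>_. a) \<phi>)"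
    have iF: "ia \<phi> \<in> F (insert a S) (set ws)" if "\<phi> \<in> \<Sigma>" for \<phi>
    proof -
      have "\<phi> \<in> F S (set (w # ws))" using Cons.prems(3) that by auto
      then have "ia \<phi> \<in> F (S \<union> (\<lambda>_. a) ` (set (w # ws) - set ws)) (set (w # ws) \<inter> set ws)"
        unfolding ia_def by (rule Fm_inst) (use aU in auto)
      moreover have "S \<union> (\<lambda>_. a) ` (set (w # ws) - set ws) \<subseteq> insert a S" by auto
      ultimately show ?thesis by (auto simp: Fm_def)
    qed
    have ias: "sat K e (ia \<phi>) \<longleftrightarrow> sat K (e(w := a)) \<phi>" if "\<phi> \<in> \<Sigma>" for e \<phi>
      unfolding ia_def sat_inst
    proof (rule sat_cong)
      fix v assume "v \<in> fv \<phi>"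
      then have "v \<in> set (w # ws)" using Cons.prems(3) that by (auto simp: Fm_def)
      then show "(if v \<in> set ws then e v else a) = (e(w := a)) v" using False by auto
    qed
    have "small \<kappa> K {a}" by (rule small_countable) (use aU in simp_all)
    from small_Un[OF this Cons.prems(1)] have sm: "small \<kappa> K (insert a S)" by simp
    have "\<exists>e. assigns K (set ws) e \<and> (\<forall>\<phi>\<in>ia ` \<Sigma>. sat K e \<phi>)"
    proof (rule Cons.IH[OF sm])
      show "\<forall>w\<in>set ws. snd w \<in> sorts L" using Cons.prems(2) by simp
      show "ia ` \<Sigma> \<subseteq> F (insert a S) (set ws)" using iF by auto
      show "\<forall>G. G \<subseteq> ia ` \<Sigma> \<longrightarrow> finite G \<longrightarrow> (\<exists>e. assigns K (set ws) e \<and> (\<forall>\<phi>\<in>G. sat K e \<phi>))"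
      proof (intro allI impI)
        fix G assume G: "G \<subseteq> ia ` \<Sigma>" "finite G"
        from finite_subset_image[OF G(2,1)] obtain H where H: "H \<subseteq> \<Sigma>" "finite H" "G = ia ` H" by metis
        obtain l where l: "set l = H" using finite_list[OF H(2)] ..
        then have "X l \<in> \<Sigma>1" using H(1) by (auto simp: \<Sigma>1_def)
        then have "sat K (\<lambda>_. a) (X l)" using a by (simp add: realizes_def sat1_def)
        then obtain e where e: "assigns K (set ws) e" "\<forall>v. v \<notin> set ws \<longrightarrow> e v = a" "sat K e (conjs (snd w) l)"
          unfolding X_def sat_exs by (elim exE conjE)
        from e(2)[THEN spec, THEN mp, OF False] have "e(w := a) = e" by (metis fun_upd_triv)
        then have "sat K e \<phi>" if "\<phi> \<in> G" for \<phi>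
          using e(3) l ias H(1,3) that by auto
        then show "\<exists>e. assigns K (set ws) e \<and> (\<forall>\<phi>\<in>G. sat K e \<phi>)" using e(1) by metis
      qed
    qed
    then obtain e where e: "assigns K (set ws) e" "\<forall>\<phi>\<in>ia ` \<Sigma>. sat K e \<phi>" by (elim exE conjE)
    have "assigns K (set (w # ws)) (e(w := a))" using e(1) aU False by (auto simp: assigns_def)
    moreover have "\<forall>\<phi>\<in>\<Sigma>. sat K (e(w := a)) \<phi>" using e(2) ias by auto
    ultimately show ?thesis by metis
  qed
qed

end

section \<open>Imaginaries\<close>

text \<open>Elements of \<open>M\<^sup>e\<^sup>q\<close> are handled through tuples of reals: a real
  element as a list of length one, a class as any of its members. Decoding is
  \<open>imag_of\<close>.\<close>

fun sort_list :: "'s + ('f, 'r, 's, 'a) isort \<Rightarrow> 's list" where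
  "sort_list (Inl s) = [s]"
| "sort_list (Inr i) = fst i"

fun imag_of :: "('f, 'r, 's, 'a) struct \<Rightarrow> 's + ('f, 'r, 's, 'a) isort \<Rightarrow> 'a list \<Rightarrow> ('f, 'r, 's, 'a) imag" where
  "imag_of M (Inl s) as = Real (hd as)"
| "imag_of M (Inr i) as = Class i (irel M i `` {as})"

context saturated_structure
begin

abbreviation "Le \<equiv> eq_language L K"
abbreviation "Ke \<equiv> eq_struct L K"

lemma eq_simps [simp]:
  "sorts Le = sorts L <+> isorts L K" "funs Le = funs L <+> isorts L K" "rels Le = rels L"
  "fdom Le (Inl f) = map Inl (fdom L f)" "fdom Le (Inr i) = map Inl (fst i)"
  "fcod Le (Inl f) = Inl (fcod L f)" "fcod Le (Inr i) = Inr i" "rdom Le r = map Inl (rdom L r)"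
  "univ Ke = eq_univ L K U" "srt Ke (Real a) = Inl (srt K a)" "srt Ke (Class i C) = Inr i"
  "fint Ke (Inl f) cs = Real (fint K f (map the_real cs))"
  "fint Ke (Inr i) cs = Class i (irel K i `` {map the_real cs})"
  "rint Ke r cs = rint K r (map the_real cs)"
  by (simp_all add: eq_language_def eq_struct_def)

lemma isorts_sorts: "i \<in> isorts L K \<Longrightarrow> set (fst i) \<subseteq> sorts L"
  by (auto simp: isorts_def)

lemma sort_list_sorts: "\<sigma> \<in> sorts Le \<Longrightarrow> set (sort_list \<sigma>) \<subseteq> sorts L"
  using isorts_sorts by (cases \<sigma>) auto

lemma imag_of_in:
  assumes "\<sigma> \<in> sorts Le" "as \<in> tuples K (sort_list \<sigma>)"
  shows "imag_of K \<sigma> as \<in> univ Ke \<and> srt Ke (imag_of K \<sigma> as) = \<sigma>"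
proof (cases \<sigma>)
  case (Inl s)
  then obtain a where "as = [a]" "a \<in> U" "srt K a = s" using assms(2) by (auto simp: tuples_def)
  then show ?thesis using Inl by (simp add: eq_univ_def)
next
  case (Inr i)
  then show ?thesis using assms by (auto simp: eq_univ_def tuples_def)
qed

lemma imag_of_surj:
  assumes "c \<in> univ Ke"
  obtains as where "as \<in> tuples K (sort_list (srt Ke c))" "imag_of K (srt Ke c) as = c" "srt Ke c \<in> sorts Le"
proof -
  have "c \<in> eq_univ L K U" using assms by simp
  then consider a where "c = Real a" "a \<in> U"
    | i as where "c = Class i (irel K i `` {as})" "i \<in> isorts L K" "as \<in> tuples K (fst i)"
    unfolding eq_univ_def by blast
  then show ?thesis
  proof cases
    case 1
    have "Inl (srt K a) \<in> sorts Le" using srt_in_sorts[OF 1(2)] by (simp add: InlI)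
    then show ?thesis by (intro that[of "[a]"]) (use 1 in \<open>simp_all add: tuples_def\<close>)
  next
    case 2
    have "Inr i \<in> sorts Le" using 2(2) by (simp add: InrI)
    then show ?thesis by (intro that[of as]) (use 2 in simp_all)
  qed
qed

lemma tuples_eq: "cs \<in> tuples Ke (map Inl ss) \<Longrightarrow> \<exists>as\<in>tuples K ss. cs = map Real as"
proof (induction cs arbitrary: ss)
  case Nil
  then show ?case by (auto simp: tuples_def)
next
  case (Cons c cs)
  then obtain s ss' where ss: "ss = s # ss'" by (cases ss) (auto simp: tuples_def)
  have c: "c \<in> eq_univ L K U" "srt Ke c = Inl s" and cs: "cs \<in> tuples Ke (map Inl ss')"
    using Cons.prems ss by (simp_all add: tuples_def)
  obtain as where as: "as \<in> tuples K ss'" "cs = map Real as" using Cons.IH[OF cs] by (rule bexE)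
  have "\<exists>a\<in>U. c = Real a"
  proof (cases c)
    case (Real a)
    then show ?thesis using c(1) by (auto simp: eq_univ_def)
  next
    case (Class i C)
    then show ?thesis using c(2) by simp
  qed
  then obtain a where "a \<in> U" "c = Real a" by (rule bexE)
  then show ?case using as c(2) ss by (intro bexI[of _ "a # as"]) (simp_all add: tuples_def)
qed

lemma language_eq: "is_language Le"
  unfolding is_language_def
proof (intro conjI ballI)
  fix g assume g: "g \<in> funs Le"
  show "set (fdom Le g) \<subseteq> sorts Le" "fcod Le g \<in> sorts Le"
    using g language isorts_sorts unfolding is_language_def by (cases g; auto)+
next
  fix r assume "r \<in> rels Le"
  then show "set (rdom Le r) \<subseteq> sorts Le" using language by (auto simp: is_language_def)
qed

lemma countable_isorts: "countable (isorts L K)"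
proof (rule countable_subset)
  show "isorts L K \<subseteq> lists (sorts L) \<times> F {} UNIV" by (auto simp: isorts_def Fm_def)
  show "countable (lists (sorts L) \<times> F {} UNIV)"
    by (intro countable_SIGMA countable_lists countable_Fm countable_lang)
      (use countable_lang in \<open>simp_all add: countable_language_def\<close>)
qed

lemma countable_eq: "countable_language Le"
  using countable_lang countable_isorts by (simp add: countable_language_def Plus_def)

lemma structure_eq: "is_structure Le Ke"
  unfolding is_structure_def
proof (intro conjI ballI)
  show "srt Ke ` univ Ke \<subseteq> sorts Le"
  proof
    fix \<sigma> assume "\<sigma> \<in> srt Ke ` univ Ke"
    then obtain c where "c \<in> univ Ke" "\<sigma> = srt Ke c" by (elim imageE)
    then show "\<sigma> \<in> sorts Le" using imag_of_surj by metis
  qed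
  fix g cs assume g: "g \<in> funs Le" and cs: "cs \<in> tuples Ke (fdom Le g)"
  have "fint Ke g cs \<in> univ Ke \<and> srt Ke (fint Ke g cs) = fcod Le g"
  proof (cases g)
    case (Inl f)
    then obtain as where "as \<in> tuples K (fdom L f)" "cs = map Real as" using tuples_eq cs by auto
    moreover have "f \<in> funs L" using g Inl by auto
    ultimately have "fint K f as \<in> U \<and> srt K (fint K f as) = fcod L f"
      using struct by (simp add: is_structure_def)
    then show ?thesis using Inl \<open>cs = map Real as\<close> by (simp add: o_def eq_univ_def)
  next
    case (Inr i)
    then obtain as where as: "as \<in> tuples K (fst i)" "cs = map Real as" using tuples_eq cs by auto
    have "Inr i \<in> sorts Le" using g Inr by auto
    from imag_of_in[OF this, of as] show ?thesis using as Inr by (simp add: o_def)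
  qed
  then show "fint Ke g cs \<in> univ Ke" "srt Ke (fint Ke g cs) = fcod Le g" by simp_all
qed

section \<open>Translating formulas about imaginaries\<close>

definition rep :: "('f, 'r, 's, 'a) imag \<Rightarrow> 'a list" where
  "rep c = (SOME as. as \<in> tuples K (sort_list (srt Ke c)) \<and> imag_of K (srt Ke c) as = c)"

lemma rep:
  assumes "c \<in> univ Ke"
  shows "rep c \<in> tuples K (sort_list (srt Ke c))" "imag_of K (srt Ke c) (rep c) = c"
proof -
  have "\<exists>as. as \<in> tuples K (sort_list (srt Ke c)) \<and> imag_of K (srt Ke c) as = c"
    by (rule imag_of_surj[OF assms]) metis
  from someI_ex[OF this] show "rep c \<in> tuples K (sort_list (srt Ke c))" "imag_of K (srt Ke c) (rep c) = c"
    unfolding rep_def by simp_all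
qed

definition reps :: "('f, 'r, 's, 'a) imag set \<Rightarrow> 'a set" where
  "reps B = (\<Union>c\<in>B. set (rep c))"

lemma reps_mono: "B \<subseteq> C \<Longrightarrow> reps B \<subseteq> reps C"
  unfolding reps_def by (rule UN_mono) simp_all

lemma reps_sub: "B \<subseteq> univ Ke \<Longrightarrow> reps B \<subseteq> U"
  unfolding reps_def by (rule UN_least) (use rep(1) in \<open>auto simp: tuples_def\<close>)

text \<open>Every element has a finite representative, so for infinite \<open>B\<close> the
  cardinality does not grow, and for finite \<open>B\<close> the set is finite.\<close>

lemma small_reps:
  assumes "small \<kappa> Ke B" shows "small \<kappa> K (reps B)"
proof -
  have B: "B \<subseteq> univ Ke" "|B| <o \<kappa>" using assms by (simp_all add: small_def)
  have sub: "reps B \<subseteq> U" by (rule reps_sub[OF B(1)])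
  show ?thesis
  proof (cases "finite B")
    case True
    then have "finite (reps B)" by (simp add: reps_def)
    then show ?thesis by (intro small_countable sub countable_finite)
  next
    case False
    have "|reps B| \<le>o |B|" unfolding reps_def
    proof (rule card_of_UNION_ordLeq_infinite[OF False])
      show "|B| \<le>o |B|" by (rule ordLeq_refl[OF card_of_Card_order])
      have "|set (rep c)| <o |B|" for c
        by (rule finite_ordLess_infinite[OF card_of_Well_order card_of_Well_order]) (simp_all add: False Field_card_of)
      then show "\<forall>c\<in>B. |set (rep c)| \<le>o |B|" by (simp add: ordLess_imp_ordLeq)
    qed
    then show ?thesis using sub B(2) by (auto simp: small_def intro: ordLeq_ordLess_trans)
  qed
qed

text \<open>
  A layout \<open>vl\<close> assigns to a variable of \<open>L\<^sup>e\<^sup>q\<close> the list of variables of \<open>L\<close> that stand for a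
  representative of its value.
\<close>

definition quot :: "(nat \<times> ('s + ('f, 'r, 's, 'a) isort) \<Rightarrow> (nat \<times> 's) list) \<Rightarrow> (nat \<times> 's \<Rightarrow> 'a) \<Rightarrow>
    nat \<times> ('s + ('f, 'r, 's, 'a) isort) \<Rightarrow> ('f, 'r, 's, 'a) imag" where
  "quot vl e v = imag_of K (snd v) (map e (vl v))"

text \<open>A term of an imaginary sort is coded by terms of \<open>L\<close> for the entries of a
  representative, a term of a real sort by a single term.\<close>

definition tm_code where
  "tm_code vl t us \<longleftrightarrow> (\<forall>u\<in>set us. wf_tm L (srt K) u \<and> tpars u \<subseteq> reps (tpars t) \<and>
      tvars u \<subseteq> (\<Union>v\<in>tvars t. set (vl v))) \<and>
    map (tm_srt L (srt K)) us = sort_list (tm_srt Le (srt Ke) t) \<and>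
    (\<forall>e. val Ke (quot vl e) t = imag_of K (tm_srt Le (srt Ke) t) (map (val K e) us))"

text \<open>All symbols of the language of \<open>M\<^sup>e\<^sup>q\<close> take real arguments, so
  each argument is coded by one term and the codes line up as an argument list for a symbol of
  \<open>L\<close>.\<close>

lemma real_tm_codes:
  assumes "\<forall>t\<in>set ts. \<exists>us. tm_code vl t us" "map (tm_srt Le (srt Ke)) ts = map Inl ss"
  shows "\<exists>us. (\<forall>u\<in>set us. wf_tm L (srt K) u \<and> tpars u \<subseteq> reps (\<Union> (tpars ` set ts)) \<and>
      tvars u \<subseteq> (\<Union>v\<in>\<Union> (tvars ` set ts). set (vl v))) \<and>
    map (tm_srt L (srt K)) us = ss \<and>
    (\<forall>e. map (val Ke (quot vl e)) ts = map Real (map (val K e) us))"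
  using assms
proof (induction ts arbitrary: ss)
  case Nil
  then show ?case by simp
next
  case (Cons t ts)
  then obtain s ss' where ss: "ss = s # ss'" and t: "tm_srt Le (srt Ke) t = Inl s"
    and ts: "map (tm_srt Le (srt Ke)) ts = map Inl ss'" by (cases ss) auto
  obtain us where us: "tm_code vl t us" using Cons.prems(1) by auto
  then have "map (tm_srt L (srt K)) us = [s]" unfolding tm_code_def t by simp
  then obtain u where u: "us = [u]" "tm_srt L (srt K) u = s" by auto
  have uw: "wf_tm L (srt K) u" "tpars u \<subseteq> reps (tpars t)" "tvars u \<subseteq> (\<Union>v\<in>tvars t. set (vl v))"
    "\<forall>e. val Ke (quot vl e) t = Real (val K e u)"
    using us unfolding tm_code_def u(1) t by simp_all
  have "\<forall>t\<in>set ts. \<exists>us. tm_code vl t us" using Cons.prems(1) by simp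
  from Cons.IH[OF this ts] obtain vs where
    vs: "\<forall>u\<in>set vs. wf_tm L (srt K) u \<and> tpars u \<subseteq> reps (\<Union> (tpars ` set ts)) \<and>
      tvars u \<subseteq> (\<Union>v\<in>\<Union> (tvars ` set ts). set (vl v))"
    "map (tm_srt L (srt K)) vs = ss'"
    "\<forall>e. map (val Ke (quot vl e)) ts = map Real (map (val K e) vs)" by (elim exE conjE)
  have r: "reps (\<Union> (tpars ` set (t # ts))) = reps (tpars t) \<union> reps (\<Union> (tpars ` set ts))"
    "(\<Union>v\<in>\<Union> (tvars ` set (t # ts)). set (vl v)) =
      (\<Union>v\<in>tvars t. set (vl v)) \<union> (\<Union>v\<in>\<Union> (tvars ` set ts). set (vl v))"
    by (simp_all add: reps_def UN_Un)
  show ?case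
  proof (rule exI[of _ "u # vs"], intro conjI allI ballI)
    fix x assume "x \<in> set (u # vs)"
    then show "wf_tm L (srt K) x" "tpars x \<subseteq> reps (\<Union> (tpars ` set (t # ts)))"
      "tvars x \<subseteq> (\<Union>v\<in>\<Union> (tvars ` set (t # ts)). set (vl v))"
      unfolding r using uw(1-3) vs(1) by (auto simp del: UN_iff UN_simps)
  next
    show "map (tm_srt L (srt K)) (u # vs) = ss" using ss u(2) vs(2) by simp
    show "map (val Ke (quot vl e)) (t # ts) = map Real (map (val K e) (u # vs))" for e
      using uw(4)[THEN spec, of e] vs(3)[THEN spec, of e] by (simp only: list.map)
  qed
qed

lemma tm_code_ex:
  "wf_tm Le (srt Ke) t \<Longrightarrow> tpars t \<subseteq> univ Ke \<Longrightarrow> \<forall>v\<in>tvars t. map snd (vl v) = sort_list (snd v) \<Longrightarrow>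
    \<exists>us. tm_code vl t us"
proof (induction t)
  case (Var v)
  have v: "snd v \<in> sorts Le" "map snd (vl v) = sort_list (snd v)" using Var.prems(1,3) by simp_all
  have "snd ` set (vl v) = set (sort_list (snd v))" using arg_cong[OF v(2), of set] by simp
  then have "snd ` set (vl v) \<subseteq> sorts L" using sort_list_sorts[OF v(1)] by simp
  then have "tm_code vl (Var v) (map Var (vl v))"
    using v(2) by (auto simp: tm_code_def quot_def o_def)
  then show ?case by (rule exI)
next
  case (Par c)
  have c: "c \<in> univ Ke" using Par.prems(2) by simp
  have "map (srt K) (rep c) = sort_list (srt Ke c)" "set (rep c) \<subseteq> U" using rep(1)[OF c] by (simp_all add: tuples_def)
  then have "tm_code vl (Par c) (map Par (rep c))"
    using rep(2)[OF c] srt_in_sorts by (auto simp: tm_code_def reps_def o_def)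
  then show ?case by (rule exI)
next
  case (Fn g ts)
  have g: "g \<in> funs Le" "map (tm_srt Le (srt Ke)) ts = fdom Le g" using Fn.prems(1) by simp_all
  have "\<forall>t\<in>set ts. \<exists>us. tm_code vl t us"
  proof
    fix t assume t: "t \<in> set ts"
    show "\<exists>us. tm_code vl t us"
    proof (rule Fn.IH[OF t])
      show "wf_tm Le (srt Ke) t" using Fn.prems(1) t by simp
      show "tpars t \<subseteq> univ Ke" using Fn.prems(2) t by auto
      show "\<forall>v\<in>tvars t. map snd (vl v) = sort_list (snd v)" using Fn.prems(3) t by auto
    qed
  qed
  note codes = real_tm_codes[OF this]
  obtain ss where ss: "fdom Le g = map Inl ss" by (cases g) auto
  from codes[of ss] g(2) ss obtain us where us: "\<forall>u\<in>set us. wf_tm L (srt K) u \<and>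
      tpars u \<subseteq> reps (\<Union> (tpars ` set ts)) \<and> tvars u \<subseteq> (\<Union>v\<in>\<Union> (tvars ` set ts). set (vl v))"
    "map (tm_srt L (srt K)) us = ss"
    "\<forall>e. map (val Ke (quot vl e)) ts = map Real (map (val K e) us)" by auto
  have re: "map the_real (map (val Ke (quot vl e)) ts) = map (val K e) us" for e
    unfolding us(3)[THEN spec] by (simp add: o_def)
  have st: "tpars (Fn g ts) = \<Union> (tpars ` set ts)" "tvars (Fn g ts) = \<Union> (tvars ` set ts)" by simp_all
  show ?case
  proof (cases g)
    case (Inl f)
    then have ssf: "ss = fdom L f" using ss by (simp add: inj_map_eq_map)
    have f: "f \<in> funs L" using g(1) Inl by auto
    have pv: "(\<Union>u\<in>set us. tpars u) \<subseteq> reps (\<Union> (tpars ` set ts))"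
      "(\<Union>u\<in>set us. tvars u) \<subseteq> (\<Union>v\<in>\<Union> (tvars ` set ts). set (vl v))"
      by (rule UN_least, use us(1) in simp)+
    have "val Ke (quot vl e) (Fn g ts) = Real (fint K f (map (val K e) us))" for e
      using re[of e] Inl by (simp del: map_map)
    moreover have "wf_tm L (srt K) (Fn f us)" using f us(1,2) ssf by simp
    ultimately have "tm_code vl (Fn g ts) [Fn f us]"
      unfolding tm_code_def st using pv Inl by simp
    then show ?thesis by (rule exI)
  next
    case (Inr i)
    then have ssf: "ss = fst i" using ss by (simp add: inj_map_eq_map)
    have "val Ke (quot vl e) (Fn g ts) = imag_of K (Inr i) (map (val K e) us)" for e
      using re[of e] Inr by (simp del: map_map)
    then have "tm_code vl (Fn g ts) us"
      unfolding tm_code_def st using us(1,2) ssf Inr by simp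
    then show ?thesis by (rule exI)
  qed
qed

text \<open>The equivalence is restricted to assignments that respect sorts: for other tuples the
  formula of an imaginary sort need not express equality of classes.\<close>

definition fm_code where
  "fm_code vl \<phi> \<psi> \<longleftrightarrow> wf_fm L (srt K) \<psi> \<and> pars \<psi> \<subseteq> reps (pars \<phi>) \<and>
    fv \<psi> \<subseteq> (\<Union>v\<in>fv \<phi>. set (vl v)) \<and>
    (\<forall>e. (\<forall>v\<in>fv \<phi>. assigns K (set (vl v)) e) \<longrightarrow> (sat Ke (quot vl e) \<phi> \<longleftrightarrow> sat K e \<psi>))"

lemma fm_codeD:
  assumes "fm_code vl \<phi> \<psi>"
  shows "wf_fm L (srt K) \<psi>" "pars \<psi> \<subseteq> reps (pars \<phi>)" "fv \<psi> \<subseteq> (\<Union>v\<in>fv \<phi>. set (vl v))"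
    "\<forall>v\<in>fv \<phi>. assigns K (set (vl v)) e \<Longrightarrow> sat Ke (quot vl e) \<phi> \<longleftrightarrow> sat K e \<psi>"
  using assms unfolding fm_code_def by simp_all

text \<open>Equality of imaginaries is \<open>E\<close>, with the codes of the two terms substituted in it.\<close>

lemma fm_code_Eq:
  assumes wf: "wf_fm Le (srt Ke) (Eq t u)" and p: "tpars t \<union> tpars u \<subseteq> univ Ke"
    and vl: "\<forall>v\<in>tvars t \<union> tvars u. map snd (vl v) = sort_list (snd v)"
  shows "\<exists>\<psi>. fm_code vl (Eq t u) \<psi>"
proof -
  let ?\<sigma> = "tm_srt Le (srt Ke) t"
  have \<sigma>: "tm_srt Le (srt Ke) u = ?\<sigma>" using wf by simp
  obtain us where us: "tm_code vl t us" using tm_code_ex[of t vl] wf p vl by auto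
  obtain ws where ws: "tm_code vl u ws" using tm_code_ex[of u vl] wf p vl by auto
  let ?R = "reps (tpars t \<union> tpars u)"
  let ?V = "\<Union>v\<in>tvars t \<union> tvars u. set (vl v)"
  have R: "?R = reps (tpars t) \<union> reps (tpars u)" by (simp add: reps_def UN_Un)
  have V: "?V = (\<Union>v\<in>tvars t. set (vl v)) \<union> (\<Union>v\<in>tvars u. set (vl v))" by (simp add: UN_Un)
  have all: "wf_tm L (srt K) x" "tpars x \<subseteq> ?R" "tvars x \<subseteq> ?V" if "x \<in> set (us @ ws)" for x
  proof -
    have "wf_tm L (srt K) x \<and> (tpars x \<subseteq> reps (tpars t) \<or> tpars x \<subseteq> reps (tpars u)) \<and>
      (tvars x \<subseteq> (\<Union>v\<in>tvars t. set (vl v)) \<or> tvars x \<subseteq> (\<Union>v\<in>tvars u. set (vl v)))"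
      using that us ws unfolding tm_code_def set_append Un_iff by metis
    then show "wf_tm L (srt K) x" "tpars x \<subseteq> ?R" "tvars x \<subseteq> ?V"
      unfolding R V by (simp, metis le_supI1 le_supI2, metis le_supI1 le_supI2)
  qed
  have srts: "map (tm_srt L (srt K)) us = sort_list ?\<sigma>" "map (tm_srt L (srt K)) ws = sort_list ?\<sigma>"
    using us ws \<sigma> by (simp_all add: tm_code_def)
  have vals: "val Ke (quot vl e) t = imag_of K ?\<sigma> (map (val K e) us)"
    "val Ke (quot vl e) u = imag_of K ?\<sigma> (map (val K e) ws)" for e
    using us ws \<sigma> by (simp_all add: tm_code_def)
  show ?thesis
  proof (cases ?\<sigma>)
    case (Inl s)
    then obtain a b where ab: "us = [a]" "ws = [b]" using srts by auto
    have srt: "tm_srt L (srt K) a = s" "tm_srt L (srt K) b = s" using srts ab Inl by simp_all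
    have "fm_code vl (Eq t u) (Eq a b)" unfolding fm_code_def fm.set fv.simps
    proof (intro conjI allI impI)
      show "wf_fm L (srt K) (Eq a b)" using all(1) ab srt by simp
      show "tpars a \<union> tpars b \<subseteq> ?R" using all(2)[of a] all(2)[of b] ab by simp
      show "tvars a \<union> tvars b \<subseteq> ?V" using all(3)[of a] all(3)[of b] ab by simp
      show "sat Ke (quot vl e) (Eq t u) \<longleftrightarrow> sat K e (Eq a b)" for e
        using vals[of e] ab Inl by simp
    qed
    then show ?thesis by (rule exI)
  next
    case (Inr i)
    let ?n = "length (fst i)" and ?ts = "us @ ws" and ?ss = "fst i @ fst i"
    have len: "length us = ?n" "length ws = ?n" using arg_cong[OF srts(1), of length] arg_cong[OF srts(2), of length] Inr by simp_all
    have wt: "wf_tm Le (srt Ke) t" using wf by simp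
    have "?\<sigma> \<in> sorts Le"
    proof (cases t)
      case (Var v)
      then show ?thesis using wt by simp
    next
      case (Par c)
      then show ?thesis using wt by simp
    next
      case (Fn g ts)
      then show ?thesis using wt language_eq by (simp add: is_language_def del: eq_simps)
    qed
    then have i: "i \<in> isorts L K" using Inr by auto
    have E: "snd i \<in> F {} {(k, ?ss ! k) | k. k < 2 * ?n}" and eqv: "equiv (tuples K (fst i)) (irel K i)"
      using i by (auto simp: isorts_def)
    \<comment> \<open>By the convention on imaginary sorts, the variable of index \<open>k\<close>
      receives the k-th entry of the two codes in a row, that of \<open>t\<close> coming
      first.\<close>
    define \<theta> where "\<theta> = (\<lambda>v :: nat \<times> 's. ?ts ! fst v)"
    have fvE: "fst v < 2 * ?n \<and> snd v = ?ss ! fst v" if "v \<in> fv (snd i)" for v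
    proof -
      have "v \<in> {(k, ?ss ! k) | k. k < 2 * ?n}" using E that by (auto simp: Fm_def)
      then show ?thesis by auto
    qed
    have \<theta>in: "\<theta> v \<in> set ?ts \<and> tm_srt L (srt K) (\<theta> v) = snd v" if "v \<in> fv (snd i)" for v
    proof -
      have l: "fst v < length ?ts" using fvE[OF that] len by simp
      have "map (tm_srt L (srt K)) ?ts = ?ss" using srts Inr by simp
      from arg_cong[OF this, of "\<lambda>l. l ! fst v"] have "tm_srt L (srt K) (?ts ! fst v) = ?ss ! fst v"
        using l by (simp only: nth_map)
      then show ?thesis using fvE[OF that] nth_mem[OF l] unfolding \<theta>_def by simp
    qed
    have wfE: "wf_fm L (srt K) (snd i)" using E by (simp add: Fm_def)
    have \<theta>wf: "wf_tm L (srt K) (\<theta> v) \<and> tm_srt L (srt K) (\<theta> v) = snd v" if "v \<in> fv (snd i)" for v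
      using \<theta>in[OF that] all(1) by simp
    obtain \<psi> where \<psi>: "wf_fm L (srt K) \<psi>" "fv \<psi> \<subseteq> (\<Union>v\<in>fv (snd i). tvars (\<theta> v))"
      "pars \<psi> \<subseteq> pars (snd i) \<union> (\<Union>v\<in>fv (snd i). tpars (\<theta> v))"
      "\<And>M e. sat M e \<psi> \<longleftrightarrow> sat M (\<lambda>v. val M e (\<theta> v)) (snd i)"
      by (rule subst_fm[OF wfE \<theta>wf], assumption) (rule that)
    have "fm_code vl (Eq t u) \<psi>" unfolding fm_code_def fm.set fv.simps
    proof (intro conjI allI impI)
      show "wf_fm L (srt K) \<psi>" by fact
      have "(\<Union>v\<in>fv (snd i). tpars (\<theta> v)) \<subseteq> ?R"
        by (rule UN_least, rule all(2)) (use \<theta>in in simp)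
      moreover have "pars (snd i) = {}" using E by (simp add: Fm_def)
      ultimately show "pars \<psi> \<subseteq> ?R" using \<psi>(3) by simp
      have "(\<Union>v\<in>fv (snd i). tvars (\<theta> v)) \<subseteq> ?V"
        by (rule UN_least, rule all(3)) (use \<theta>in in simp)
      then show "fv \<psi> \<subseteq> ?V" by (rule subset_trans[OF \<psi>(2)])
      fix e assume e: "\<forall>v\<in>tvars t \<union> tvars u. assigns K (set (vl v)) e"
      let ?as = "map (val K e) us" and ?bs = "map (val K e) ws"
      have asg: "assigns K ?V e" using e by (simp add: assigns_def) blast
      have v: "val K e x \<in> U \<and> srt K (val K e x) = tm_srt L (srt K) x" if x: "x \<in> set ?ts" for x
      proof (rule val_in[OF struct all(1)[OF x]])
        show "tpars x \<subseteq> U" using all(2)[OF x] reps_sub[OF p] by (rule subset_trans)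
        show "assigns K (tvars x) e" using asg all(3)[OF x] unfolding assigns_def by (meson subsetD)
      qed
      have "map (srt K) ?as = map (tm_srt L (srt K)) us" "map (srt K) ?bs = map (tm_srt L (srt K)) ws"
        using v by simp_all
      then have tup: "?as \<in> tuples K (fst i)" "?bs \<in> tuples K (fst i)"
        using v srts Inr by (auto simp: tuples_def)
      have "sat Ke (quot vl e) (Eq t u) \<longleftrightarrow> irel K i `` {?as} = irel K i `` {?bs}"
        using vals[of e] Inr by simp
      also have "\<dots> \<longleftrightarrow> (?as, ?bs) \<in> irel K i" using eq_equiv_class_iff[OF eqv tup] .
      also have "\<dots> \<longleftrightarrow> sat K (\<lambda>(k, s). (?as @ ?bs) ! k) (snd i)" using tup by (simp add: irel_def)
      also have "\<dots> \<longleftrightarrow> sat K (\<lambda>v. val K e (\<theta> v)) (snd i)"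
      proof (rule sat_cong)
        fix v assume "v \<in> fv (snd i)"
        from fvE[OF this] have "fst v < length ?ts" using len by simp
        then have "map (val K e) ?ts ! fst v = val K e (?ts ! fst v)" by (rule nth_map)
        then show "(case v of (k, s) \<Rightarrow> (?as @ ?bs) ! k) = val K e (\<theta> v)"
          by (simp add: \<theta>_def split_beta)
      qed
      also have "\<dots> \<longleftrightarrow> sat K e \<psi>" by (rule \<psi>(4)[symmetric])
      finally show "sat Ke (quot vl e) (Eq t u) \<longleftrightarrow> sat K e \<psi>" .
    qed
    then show ?thesis by (rule exI)
  qed
qed

text \<open>A quantifier over a sort becomes a block of quantifiers over representatives. The layout
  varies in the induction because the bound variable is given a block of fresh variables.\<close>

lemma fm_code_ex:
  "wf_fm Le (srt Ke) \<phi> \<Longrightarrow> pars \<phi> \<subseteq> univ Ke \<Longrightarrow> \<forall>v\<in>fv \<phi>. map snd (vl v) = sort_list (snd v) \<Longrightarrow>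
    \<exists>\<psi>. fm_code vl \<phi> \<psi>"
proof (induction \<phi> arbitrary: vl)
  case (Eq t u)
  show ?case by (rule fm_code_Eq[OF Eq.prems(1)]) (use Eq.prems(2,3) in simp_all)
next
  case (Rel r ts)
  have r: "r \<in> rels L" "map (tm_srt Le (srt Ke)) ts = map Inl (rdom L r)" using Rel.prems(1) by simp_all
  have "\<forall>t\<in>set ts. \<exists>us. tm_code vl t us"
  proof
    fix t assume t: "t \<in> set ts"
    show "\<exists>us. tm_code vl t us"
    proof (rule tm_code_ex)
      show "wf_tm Le (srt Ke) t" using Rel.prems(1) t by simp
      show "tpars t \<subseteq> univ Ke" using Rel.prems(2) t by auto
      show "\<forall>v\<in>tvars t. map snd (vl v) = sort_list (snd v)" using Rel.prems(3) t by auto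
    qed
  qed
  from real_tm_codes[OF this r(2)] obtain us where us: "\<forall>u\<in>set us. wf_tm L (srt K) u \<and>
      tpars u \<subseteq> reps (\<Union> (tpars ` set ts)) \<and> tvars u \<subseteq> (\<Union>v\<in>\<Union> (tvars ` set ts). set (vl v))"
    "map (tm_srt L (srt K)) us = rdom L r"
    "\<forall>e. map (val Ke (quot vl e)) ts = map Real (map (val K e) us)" by (elim exE conjE)
  have re: "map the_real (map (val Ke (quot vl e)) ts) = map (val K e) us" for e
    unfolding us(3)[THEN spec] by (simp add: o_def)
  have "fm_code vl (Rel r ts) (Rel r us)" unfolding fm_code_def
  proof (intro conjI allI impI)
    show "wf_fm L (srt K) (Rel r us)" using r(1) us(1,2) by simp
    have "(\<Union>u\<in>set us. tpars u) \<subseteq> reps (\<Union> (tpars ` set ts))"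
      by (rule UN_least) (use us(1) in simp)
    then show "pars (Rel r us) \<subseteq> reps (pars (Rel r ts))" by simp
    have "(\<Union>u\<in>set us. tvars u) \<subseteq> (\<Union>v\<in>\<Union> (tvars ` set ts). set (vl v))"
      by (rule UN_least) (use us(1) in simp)
    then show "fv (Rel r us) \<subseteq> (\<Union>v\<in>fv (Rel r ts). set (vl v))" by simp
    show "sat Ke (quot vl e) (Rel r ts) \<longleftrightarrow> sat K e (Rel r us)" for e
      using re[of e] by (simp del: map_map)
  qed
  then show ?case by (rule exI)
next
  case (Neg \<phi>)
  have "\<exists>\<psi>. fm_code vl \<phi> \<psi>" by (rule Neg.IH) (use Neg.prems in simp_all)
  then obtain \<psi> where "fm_code vl \<phi> \<psi>" ..
  then have "fm_code vl (Neg \<phi>) (Neg \<psi>)" by (simp add: fm_code_def)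
  then show ?case by (rule exI)
next
  case (Conj \<phi>1 \<phi>2)
  have "\<exists>\<psi>. fm_code vl \<phi>1 \<psi>" by (rule Conj.IH(1)) (use Conj.prems in simp_all)
  then obtain \<psi>1 where 1: "fm_code vl \<phi>1 \<psi>1" ..
  have "\<exists>\<psi>. fm_code vl \<phi>2 \<psi>" by (rule Conj.IH(2)) (use Conj.prems in simp_all)
  then obtain \<psi>2 where 2: "fm_code vl \<phi>2 \<psi>2" ..
  have "fm_code vl (Conj \<phi>1 \<phi>2) (Conj \<psi>1 \<psi>2)" unfolding fm_code_def
  proof (intro conjI allI impI)
    show "wf_fm L (srt K) (Conj \<psi>1 \<psi>2)" using fm_codeD(1)[OF 1] fm_codeD(1)[OF 2] by simp
    show "pars (Conj \<psi>1 \<psi>2) \<subseteq> reps (pars (Conj \<phi>1 \<phi>2))"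
      using Un_mono[OF fm_codeD(2)[OF 1] fm_codeD(2)[OF 2]] by (simp only: fm.set reps_def UN_Un)
    show "fv (Conj \<psi>1 \<psi>2) \<subseteq> (\<Union>v\<in>fv (Conj \<phi>1 \<phi>2). set (vl v))"
      using Un_mono[OF fm_codeD(3)[OF 1] fm_codeD(3)[OF 2]] by (simp only: fv.simps UN_Un)
    show "sat Ke (quot vl e) (Conj \<phi>1 \<phi>2) \<longleftrightarrow> sat K e (Conj \<psi>1 \<psi>2)"
      if "\<forall>v\<in>fv (Conj \<phi>1 \<phi>2). assigns K (set (vl v)) e" for e
      using fm_codeD(4)[OF 1, of e] fm_codeD(4)[OF 2, of e] that by simp
  qed
  then show ?case by (rule exI)
next
  case (Ex x \<phi>)
  let ?\<sigma> = "snd x" and ?V = "\<Union>v\<in>fv (Ex x \<phi>). set (vl v)"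
  have \<sigma>: "?\<sigma> \<in> sorts Le" using Ex.prems(1) by simp
  have "finite ?V" by (rule finite_UN_I[OF finite_fv]) simp
  then have "finite (fst ` ?V)" by (rule finite_imageI)
  then obtain N where N: "\<forall>k\<in>fst ` ?V. k < N" using finite_nat_set_iff_bounded by metis
  \<comment> \<open>\<open>N\<close> exceeds every index in the layouts of the free variables, so
    the block overlaps none of them.\<close>
  define ws where "ws = map (\<lambda>k. (N + k, sort_list ?\<sigma> ! k)) [0..<length (sort_list ?\<sigma>)]"
  have ws: "map snd ws = sort_list ?\<sigma>" "distinct ws"
    by (simp_all add: ws_def o_def map_nth distinct_map inj_on_def)
  have fresh: "w \<notin> ?V" if "w \<in> set ws" for w
  proof
    assume "w \<in> ?V"
    then have "fst w < N" using N by (metis imageI)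
    then show False using that by (auto simp: ws_def)
  qed
  define vl' where "vl' = vl(x := ws)"
  have vl': "\<forall>v\<in>fv \<phi>. map snd (vl' v) = sort_list (snd v)"
  proof
    fix v assume "v \<in> fv \<phi>"
    then show "map snd (vl' v) = sort_list (snd v)"
      using Ex.prems(3) ws(1) by (cases "v = x") (simp_all add: vl'_def)
  qed
  have "\<exists>\<psi>. fm_code vl' \<phi> \<psi>" by (rule Ex.IH[OF _ _ vl']) (use Ex.prems in simp_all)
  then obtain \<psi> where \<psi>: "fm_code vl' \<phi> \<psi>" ..
  have "fm_code vl (Ex x \<phi>) (exs ws \<psi>)" unfolding fm_code_def
  proof (intro conjI allI impI)
    have "snd ` set ws = set (sort_list ?\<sigma>)" using arg_cong[OF ws(1), of set] by simp
    then show "wf_fm L (srt K) (exs ws \<psi>)"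
      using sort_list_sorts[OF \<sigma>] fm_codeD(1)[OF \<psi>] by (simp add: wf_exs)
    show "pars (exs ws \<psi>) \<subseteq> reps (pars (Ex x \<phi>))" using fm_codeD(2)[OF \<psi>] by (simp add: pars_exs)
    have "(\<Union>v\<in>fv \<phi>. set (vl' v)) \<subseteq> set ws \<union> ?V"
    proof (rule UN_least)
      fix v assume "v \<in> fv \<phi>"
      then show "set (vl' v) \<subseteq> set ws \<union> ?V" by (cases "v = x") (auto simp: vl'_def)
    qed
    from subset_trans[OF fm_codeD(3)[OF \<psi>] this]
    show "fv (exs ws \<psi>) \<subseteq> ?V" unfolding fv_exs Diff_subset_conv .
    fix e assume e: "\<forall>v\<in>fv (Ex x \<phi>). assigns K (set (vl v)) e"
    have asg: "\<forall>v\<in>fv \<phi>. assigns K (set (vl' v)) e'"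
      and q: "sat Ke (quot vl' e') \<phi> \<longleftrightarrow> sat Ke ((quot vl e)(x := imag_of K ?\<sigma> (map e' ws))) \<phi>"
      if e': "assigns K (set ws) e'" "\<forall>v. v \<notin> set ws \<longrightarrow> e' v = e v" for e'
    proof -
      have eq: "map e' (vl v) = map e (vl v)" "v \<in> fv (Ex x \<phi>)" if "v \<in> fv \<phi>" "v \<noteq> x" for v
      proof -
        show v: "v \<in> fv (Ex x \<phi>)" using that by simp
        have "e' w = e w" if "w \<in> set (vl v)" for w
        proof -
          have "w \<in> ?V" using v that by (rule UN_I)
          then show ?thesis using fresh e'(2) by metis
        qed
        then show "map e' (vl v) = map e (vl v)" by simp
      qed
      show "\<forall>v\<in>fv \<phi>. assigns K (set (vl' v)) e'"
      proof
        fix v assume v: "v \<in> fv \<phi>"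
        show "assigns K (set (vl' v)) e'"
        proof (cases "v = x")
          case False
          have "assigns K (set (vl v)) e" using bspec[OF e eq(2)[OF v False]] .
          then show ?thesis using eq(1)[OF v False] False by (simp add: vl'_def assigns_def)
        qed (simp add: vl'_def e'(1))
      qed
      show "sat Ke (quot vl' e') \<phi> \<longleftrightarrow> sat Ke ((quot vl e)(x := imag_of K ?\<sigma> (map e' ws))) \<phi>"
      proof (rule sat_cong)
        fix v assume v: "v \<in> fv \<phi>"
        show "quot vl' e' v = ((quot vl e)(x := imag_of K ?\<sigma> (map e' ws))) v"
        proof (cases "v = x")
          case False
          then show ?thesis using eq(1)[OF v False] by (simp add: quot_def vl'_def del: map_eq_conv)
        qed (simp add: quot_def vl'_def)
      qed
    qed
    show "sat Ke (quot vl e) (Ex x \<phi>) \<longleftrightarrow> sat K e (exs ws \<psi>)"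
    proof
      assume "sat Ke (quot vl e) (Ex x \<phi>)"
      then obtain c where c: "c \<in> univ Ke" "srt Ke c = ?\<sigma>" "sat Ke ((quot vl e)(x := c)) \<phi>"
        by (simp only: sat.simps) metis
      from imag_of_surj[OF c(1)] c(2) obtain as
        where as: "as \<in> tuples K (sort_list ?\<sigma>)" "imag_of K ?\<sigma> as = c" by metis
      have len: "length as = length ws" using as(1) arg_cong[OF ws(1), of length] by (auto simp: tuples_def dest: arg_cong[where f=length])
      \<comment> \<open>The block is filled with a representative of the witness, and
        \<open>e\<close> is kept elsewhere.\<close>
      define e' where "e' = (\<lambda>v. case map_of (zip ws as) v of None \<Rightarrow> e v | Some a \<Rightarrow> a)"
      have e'ws: "e' (ws ! k) = as ! k" if "k < length ws" for k
        using that len ws(2) by (simp add: e'_def map_of_zip_nth)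
      have m: "map e' ws = as" by (rule nth_equalityI) (simp_all add: len e'ws)
      have 1: "assigns K (set ws) e'" unfolding assigns_def
      proof
        fix w assume "w \<in> set ws"
        then obtain k where k: "k < length ws" "w = ws ! k" by (metis in_set_conv_nth)
        have "as ! k \<in> U" using as(1) k len by (auto simp: tuples_def)
        moreover have "map (srt K) as = map snd ws" using as(1) ws(1) by (simp add: tuples_def)
        from arg_cong[OF this, of "\<lambda>l. l ! k"] have "srt K (as ! k) = snd (ws ! k)" using k len by simp
        ultimately show "e' w \<in> U \<and> srt K (e' w) = snd w" using e'ws k by simp
      qed
      have 2: "\<forall>v. v \<notin> set ws \<longrightarrow> e' v = e v"
        using len by (auto simp: e'_def split: option.splits dest!: map_of_SomeD set_zip_leftD)
      have "sat Ke (quot vl' e') \<phi>" unfolding q[OF 1 2] m as(2) by (rule c(3))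
      then have "sat K e' \<psi>" using fm_codeD(4)[OF \<psi> asg[OF 1 2]] by simp
      then show "sat K e (exs ws \<psi>)" unfolding sat_exs using 1 2 by metis
    next
      assume "sat K e (exs ws \<psi>)"
      then obtain e' where e': "assigns K (set ws) e'" "\<forall>v. v \<notin> set ws \<longrightarrow> e' v = e v" "sat K e' \<psi>"
        unfolding sat_exs by (elim exE conjE)
      have "sat Ke (quot vl' e') \<phi>" using fm_codeD(4)[OF \<psi> asg[OF e'(1,2)]] e'(3) by simp
      then have s: "sat Ke ((quot vl e)(x := imag_of K ?\<sigma> (map e' ws))) \<phi>" unfolding q[OF e'(1,2)] .
      have "map (srt K) (map e' ws) = map snd ws" using e'(1) by (simp add: assigns_def)
      then have "map e' ws \<in> tuples K (sort_list ?\<sigma>)" using e'(1) ws(1) by (auto simp: tuples_def assigns_def)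
      from imag_of_in[OF \<sigma> this] s show "sat Ke (quot vl e) (Ex x \<phi>)"
        by (simp only: sat.simps) metis
    qed
  qed
  then show ?case by (rule exI)
qed

text \<open>A type in one imaginary variable translates into a type of tuples over representatives
  of its parameters. It is finitely satisfiable because every imaginary has a representative, and
  decoding a realization of it realizes the original type.\<close>

lemma saturated_eq: "Defs.saturated Le \<kappa> Ke"
  unfolding saturated_def
proof (intro allI impI)
  fix B x \<Sigma>
  assume B: "small \<kappa> Ke B"
    and \<Sigma>: "snd x \<in> sorts Le \<and> \<Sigma> \<subseteq> Fm Le (srt Ke) B {x} \<and> finitely_satisfiable Ke {x} \<Sigma>"
  let ?\<sigma> = "snd x"
  have \<sigma>: "?\<sigma> \<in> sorts Le" and \<Sigma>F: "\<Sigma> \<subseteq> Fm Le (srt Ke) B {x}"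
    and fs: "finitely_satisfiable Ke {x} \<Sigma>" using \<Sigma> by blast+
  define ws where "ws = map (\<lambda>k. (k, sort_list ?\<sigma> ! k)) [0..<length (sort_list ?\<sigma>)]"
  have ws: "map snd ws = sort_list ?\<sigma>" by (simp add: ws_def o_def map_nth)
  have wss: "\<forall>w\<in>set ws. snd w \<in> sorts L"
    using sort_list_sorts[OF \<sigma>] arg_cong[OF ws, of set] by auto
  \<comment> \<open>A constant layout suffices, since \<open>x\<close> is the only free
    variable.\<close>
  define vl where "vl = (\<lambda>v :: nat \<times> ('s + ('f, 'r, 's, 'a) isort). ws)"
  have BU: "B \<subseteq> univ Ke" using B by (simp add: small_def)
  have fvx: "fv \<phi> \<subseteq> {x}" if "\<phi> \<in> \<Sigma>" for \<phi> using \<Sigma>F that by (auto simp: Fm_def)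
  have "\<forall>\<phi>\<in>\<Sigma>. \<exists>\<psi>. fm_code vl \<phi> \<psi>"
  proof
    fix \<phi> assume \<phi>: "\<phi> \<in> \<Sigma>"
    then have "\<phi> \<in> Fm Le (srt Ke) B {x}" using \<Sigma>F by (rule subsetD[rotated])
    then have "wf_fm Le (srt Ke) \<phi>" "pars \<phi> \<subseteq> univ Ke" using BU by (auto simp: Fm_def)
    then show "\<exists>\<psi>. fm_code vl \<phi> \<psi>"
      by (rule fm_code_ex) (use fvx[OF \<phi>] ws in \<open>auto simp: vl_def\<close>)
  qed
  then obtain tr where tr: "\<forall>\<phi>\<in>\<Sigma>. fm_code vl \<phi> (tr \<phi>)" by metis
  have tr_sat: "sat K e (tr \<phi>) \<longleftrightarrow> sat1 Ke (imag_of K ?\<sigma> (map e ws)) \<phi>"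
    if "\<phi> \<in> \<Sigma>" "assigns K (set ws) e" for e \<phi>
  proof -
    have "sat Ke (quot vl e) \<phi> \<longleftrightarrow> sat K e (tr \<phi>)"
      by (rule fm_codeD(4)[OF bspec[OF tr that(1)]]) (simp add: vl_def that(2))
    moreover have "quot vl e x = imag_of K ?\<sigma> (map e ws)" by (simp add: quot_def vl_def)
    ultimately show ?thesis using sat_iff_sat1[OF fvx[OF that(1)], of Ke "quot vl e"] by simp
  qed
  have "\<exists>e. assigns K (set ws) e \<and> (\<forall>\<phi>\<in>tr ` \<Sigma>. sat K e \<phi>)"
  proof (rule realize_finite_tuple[OF small_reps[OF B] wss])
    show "tr ` \<Sigma> \<subseteq> F (reps B) (set ws)"
    proof
      fix \<psi> assume "\<psi> \<in> tr ` \<Sigma>"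
      then obtain \<phi> where \<phi>: "\<phi> \<in> \<Sigma>" "\<psi> = tr \<phi>" by (elim imageE)
      note c = fm_codeD[OF bspec[OF tr \<phi>(1)]]
      have "pars \<phi> \<subseteq> B" using \<Sigma>F \<phi>(1) by (auto simp: Fm_def)
      from subset_trans[OF c(2) reps_mono[OF this]] have "pars \<psi> \<subseteq> reps B" unfolding \<phi>(2) .
      moreover have "fv \<psi> \<subseteq> set ws"
        unfolding \<phi>(2) by (rule subset_trans[OF c(3)], rule UN_least) (simp add: vl_def)
      ultimately show "\<psi> \<in> F (reps B) (set ws)" using c(1) \<phi>(2) by (simp add: Fm_def)
    qed
    show "\<forall>G. G \<subseteq> tr ` \<Sigma> \<longrightarrow> finite G \<longrightarrow> (\<exists>e. assigns K (set ws) e \<and> (\<forall>\<phi>\<in>G. sat K e \<phi>))"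
    proof (intro allI impI)
      fix G assume G: "G \<subseteq> tr ` \<Sigma>" "finite G"
      from finite_subset_image[OF G(2,1)] obtain H where H: "H \<subseteq> \<Sigma>" "finite H" "G = tr ` H" by metis
      from fs[unfolded finitely_satisfiable_def, THEN spec, THEN mp, OF conjI[OF H(1,2)]]
      obtain e0 where e0: "assigns Ke {x} e0" "\<forall>\<phi>\<in>H. sat Ke e0 \<phi>" by (elim exE conjE)
      have c: "e0 x \<in> univ Ke" "srt Ke (e0 x) = ?\<sigma>" using e0(1) by (simp_all add: assigns_def del: eq_simps)
      from imag_of_surj[OF c(1)] c(2) obtain as
        where as: "as \<in> tuples K (sort_list ?\<sigma>)" "imag_of K ?\<sigma> as = e0 x" by metis
      have len: "length as = length (sort_list ?\<sigma>)" using as(1) by (auto simp: tuples_def dest: arg_cong[where f=length])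
      define e where "e = (\<lambda>v :: nat \<times> 's. as ! fst v)"
      have m: "map e ws = as" by (rule nth_equalityI) (simp_all add: e_def ws_def len)
      have asg: "assigns K (set ws) e" unfolding assigns_def
      proof
        fix w assume "w \<in> set ws"
        then obtain k where k: "k < length as" "w = (k, sort_list ?\<sigma> ! k)" by (auto simp: ws_def len)
        have "map (srt K) as = sort_list ?\<sigma>" using as(1) by (simp add: tuples_def)
        from arg_cong[OF this, of "\<lambda>l. l ! k"] have "srt K (as ! k) = sort_list ?\<sigma> ! k" using k(1) by simp
        moreover have "as ! k \<in> U" using as(1) k(1) by (auto simp: tuples_def)
        ultimately show "e w \<in> U \<and> srt K (e w) = snd w" by (simp add: e_def k(2))
      qed
      have "sat K e (tr \<phi>)" if "\<phi> \<in> H" for \<phi>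
      proof -
        have \<phi>: "\<phi> \<in> \<Sigma>" using H(1) that by (rule subsetD)
        have "sat1 Ke (e0 x) \<phi>" using sat_iff_sat1[OF fvx[OF \<phi>], of Ke e0] e0(2) that by simp
        then show ?thesis using tr_sat[OF \<phi> asg] m as(2) by simp
      qed
      then show "\<exists>e. assigns K (set ws) e \<and> (\<forall>\<phi>\<in>G. sat K e \<phi>)"
        using asg H(3) by (intro exI[of _ e]) simp
    qed
  qed
  then obtain e where e: "assigns K (set ws) e" "\<forall>\<phi>\<in>tr ` \<Sigma>. sat K e \<phi>" by (elim exE conjE)
  let ?c = "imag_of K ?\<sigma> (map e ws)"
  have "map (srt K) (map e ws) = map snd ws" using e(1) by (simp add: assigns_def)
  then have "map e ws \<in> tuples K (sort_list ?\<sigma>)" using e(1) ws by (auto simp: tuples_def assigns_def)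
  from imag_of_in[OF \<sigma> this] have "?c \<in> univ Ke" "srt Ke ?c = ?\<sigma>" by simp_all
  moreover have "\<forall>\<phi>\<in>\<Sigma>. sat1 Ke ?c \<phi>" using e(2) tr_sat[OF _ e(1)] by simp
  ultimately show "\<exists>a\<in>univ Ke. srt Ke a = snd x \<and> (\<forall>\<phi>\<in>\<Sigma>. sat1 Ke a \<phi>)" by (intro bexI[of _ ?c] conjI)
qed

lemma saturated_structure_eq: "saturated_structure Le Ke \<kappa>"
  using language_eq countable_eq structure_eq card_\<kappa> saturated_eq by unfold_locales

end

section \<open>Real elements inside the imaginaries\<close>

primrec emb_tm :: "('f, nat \<times> 's, 'a) tm \<Rightarrow> ('f + ('f, 'r, 's, 'a) isort,
    nat \<times> ('s + ('f, 'r, 's, 'a) isort), ('f, 'r, 's, 'a) imag) tm" where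
  "emb_tm (Var v) = Var (apsnd Inl v)"
| "emb_tm (Par a) = Par (Real a)"
| "emb_tm (Fn f ts) = Fn (Inl f) (map emb_tm ts)"

primrec emb_fm :: "('f, 'r, 's, 'a) formula \<Rightarrow> ('f + ('f, 'r, 's, 'a) isort, 'r,
    's + ('f, 'r, 's, 'a) isort, ('f, 'r, 's, 'a) imag) formula" where
  "emb_fm (Eq t u) = Eq (emb_tm t) (emb_tm u)"
| "emb_fm (Rel r ts) = Rel r (map emb_tm ts)"
| "emb_fm (Neg \<phi>) = Neg (emb_fm \<phi>)"
| "emb_fm (Conj \<phi> \<psi>) = Conj (emb_fm \<phi>) (emb_fm \<psi>)"
| "emb_fm (Ex v \<phi>) = Ex (apsnd Inl v) (emb_fm \<phi>)"

lemma tvars_emb: "tvars (emb_tm t) = apsnd Inl ` tvars t"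
  by (induction t) auto

lemma inj_apsnd_Inl: "inj (apsnd Inl :: 'k \<times> 's \<Rightarrow> 'k \<times> ('s + 'i))"
  by (auto simp: inj_def)

lemma fv_emb: "fv (emb_fm \<phi>) = apsnd Inl ` fv \<phi>"
proof (induction \<phi>)
  case (Ex v \<phi>)
  then show ?case by (simp add: image_set_diff[OF inj_apsnd_Inl])
qed (auto simp: tvars_emb)

lemma tpars_emb: "tpars (emb_tm t) = Real ` tpars t"
  by (induction t) auto

lemma pars_emb: "pars (emb_fm \<phi>) = Real ` pars \<phi>"
  by (induction \<phi>) (auto simp: tpars_emb)

context saturated_structure
begin

lemma tm_srt_emb: "tm_srt Le (srt Ke) (emb_tm t) = Inl (tm_srt L (srt K) t)"
  by (cases t) simp_all

lemma wf_tm_emb: "wf_tm L (srt K) t \<Longrightarrow> wf_tm Le (srt Ke) (emb_tm t)"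
proof (induction t)
  case (Fn f ts)
  have "map (tm_srt Le (srt Ke)) (map emb_tm ts) = map Inl (map (tm_srt L (srt K)) ts)"
    by (simp add: tm_srt_emb)
  also have "\<dots> = map Inl (fdom L f)" using Fn.prems by simp
  finally have "map (tm_srt Le (srt Ke)) (map emb_tm ts) = fdom Le (Inl f)" by simp
  moreover have "\<forall>t\<in>set (map emb_tm ts). wf_tm Le (srt Ke) t" using Fn by simp
  moreover have "Inl f \<in> funs Le" using Fn.prems by (simp add: InlI)
  ultimately show ?case by (simp only: emb_tm.simps wf_tm.simps simp_thms)
qed (simp_all add: InlI)

lemma wf_fm_emb: "wf_fm L (srt K) \<phi> \<Longrightarrow> wf_fm Le (srt Ke) (emb_fm \<phi>)"
proof (induction \<phi>)
  case (Rel r ts)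
  have "map (tm_srt Le (srt Ke)) (map emb_tm ts) = map Inl (map (tm_srt L (srt K)) ts)"
    by (simp add: tm_srt_emb)
  also have "\<dots> = map Inl (rdom L r)" using Rel.prems by simp
  finally have "map (tm_srt Le (srt Ke)) (map emb_tm ts) = rdom Le r" by simp
  moreover have "\<forall>t\<in>set (map emb_tm ts). wf_tm Le (srt Ke) t" using Rel.prems by (simp add: wf_tm_emb)
  moreover have "r \<in> rels Le" using Rel.prems by simp
  ultimately show ?case by (simp only: emb_fm.simps wf_fm.simps simp_thms)
next
  case (Eq t u)
  then show ?case by (simp add: wf_tm_emb tm_srt_emb)
next
  case (Ex v \<phi>)
  then show ?case by (simp add: InlI)
qed simp_all

lemma val_emb: "(\<And>v. v \<in> tvars t \<Longrightarrow> e' (apsnd Inl v) = Real (e v)) \<Longrightarrow> val Ke e' (emb_tm t) = Real (val K e t)"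
proof (induction t)
  case (Fn f ts)
  have "val Ke e' (emb_tm t) = Real (val K e t)" if t: "t \<in> set ts" for t
  proof (rule Fn.IH[OF t])
    show "e' (apsnd Inl v) = Real (e v)" if "v \<in> tvars t" for v
      by (rule Fn.prems) (use that t in auto)
  qed
  then have "map the_real (map (val Ke e') (map emb_tm ts)) = map (val K e) ts" by simp
  then show ?case by (simp del: map_map)
qed simp_all

lemma eq_univ_real: "c \<in> univ Ke \<Longrightarrow> srt Ke c = Inl s \<Longrightarrow> \<exists>a\<in>U. c = Real a \<and> srt K a = s"
  by (cases c) (auto simp: eq_univ_def)

lemma Real_in_univ: "Real a \<in> univ Ke \<longleftrightarrow> a \<in> U"
  by (auto simp: eq_univ_def)

lemma sat_emb: "(\<And>v. v \<in> fv \<phi> \<Longrightarrow> e' (apsnd Inl v) = Real (e v)) \<Longrightarrow> sat Ke e' (emb_fm \<phi>) \<longleftrightarrow> sat K e \<phi>"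
proof (induction \<phi> arbitrary: e e')
  case (Eq t u)
  have "val Ke e' (emb_tm t) = Real (val K e t)" by (rule val_emb, rule Eq.prems) simp
  moreover have "val Ke e' (emb_tm u) = Real (val K e u)" by (rule val_emb, rule Eq.prems) simp
  ultimately show ?case by simp
next
  case (Rel r ts)
  have "val Ke e' (emb_tm t) = Real (val K e t)" if "t \<in> set ts" for t
    by (rule val_emb, rule Rel.prems) (use that in auto)
  then have "map the_real (map (val Ke e') (map emb_tm ts)) = map (val K e) ts" by simp
  then show ?case by (simp del: map_map)
next
  case (Neg \<phi>)
  have "sat Ke e' (emb_fm \<phi>) \<longleftrightarrow> sat K e \<phi>" by (rule Neg.IH, rule Neg.prems) simp
  then show ?case by simp
next
  case (Conj \<phi>1 \<phi>2)
  have "sat Ke e' (emb_fm \<phi>1) \<longleftrightarrow> sat K e \<phi>1" by (rule Conj.IH(1), rule Conj.prems) simp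
  moreover have "sat Ke e' (emb_fm \<phi>2) \<longleftrightarrow> sat K e \<phi>2" by (rule Conj.IH(2), rule Conj.prems) simp
  ultimately show ?case by simp
next
  case (Ex v \<phi>)
  have IH: "sat Ke (e'(apsnd Inl v := Real a)) (emb_fm \<phi>) \<longleftrightarrow> sat K (e(v := a)) \<phi>" for a
  proof (rule Ex.IH)
    fix w assume w: "w \<in> fv \<phi>"
    show "(e'(apsnd Inl v := Real a)) (apsnd Inl w) = Real ((e(v := a)) w)"
    proof (cases "w = v")
      case False
      then have "(apsnd Inl w :: nat \<times> ('s + ('f, 'r, 's, 'a) isort)) \<noteq> apsnd Inl v" by (simp add: inj_eq[OF inj_apsnd_Inl])
      then show ?thesis using Ex.prems[of w] w False by simp
    qed simp
  qed
  show ?case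
  proof
    assume "sat Ke e' (emb_fm (Ex v \<phi>))"
    then obtain c where c: "c \<in> univ Ke" "srt Ke c = snd (apsnd Inl v)" "sat Ke (e'(apsnd Inl v := c)) (emb_fm \<phi>)"
      by (simp only: emb_fm.simps sat.simps) metis
    have "srt Ke c = Inl (snd v)" using c(2) by simp
    from eq_univ_real[OF c(1) this] obtain a where a: "a \<in> U" "c = Real a" "srt K a = snd v" by metis
    then show "sat K e (Ex v \<phi>)" using c(3) IH[of a] by (simp only: sat.simps) metis
  next
    assume "sat K e (Ex v \<phi>)"
    then obtain a where a: "a \<in> U" "srt K a = snd v" "sat K (e(v := a)) \<phi>"
      by (simp only: sat.simps) metis
    have "Real a \<in> univ Ke" "srt Ke (Real a) = snd (apsnd Inl v)"
      using a(1,2) by (simp_all only: Real_in_univ) simp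
    then show "sat Ke e' (emb_fm (Ex v \<phi>))"
      using a(3) IH[of a] unfolding emb_fm.simps sat.simps by metis
  qed
qed

text \<open>A formula of \<open>L\<close> is read as a formula about the real sorts; its witness in
  \<open>N\<close> has a real sort, hence is a real element.\<close>

lemma tarski_vaught_real:
  assumes "tarski_vaught Le Ke N"
  shows "tarski_vaught L K {a. Real a \<in> N}"
proof
  interpret N: tarski_vaught Le Ke N by (rule assms)
  show "is_structure L K" by (rule struct)
  show "{a. Real a \<in> N} \<subseteq> U" using N.N_sub Real_in_univ by auto
  fix \<phi> x assume \<phi>: "\<phi> \<in> F {a. Real a \<in> N} {x}" and x: "snd x \<in> sorts L"
    and ex: "\<exists>a. realizes K (snd x) a {\<phi>}"
  let ?x = "apsnd Inl x"
  have fv: "fv \<phi> \<subseteq> {x}" using \<phi> by (simp add: Fm_def)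
  have s: "sat1 Ke (Real a) (emb_fm \<phi>) \<longleftrightarrow> sat1 K a \<phi>" for a
    unfolding sat1_def by (rule sat_emb) simp
  have "emb_fm \<phi> \<in> Fm Le (srt Ke) N {?x}"
    using \<phi> by (auto simp: Fm_def wf_fm_emb fv_emb pars_emb)
  moreover have "snd ?x \<in> sorts Le" using x by (simp add: InlI)
  moreover have "\<exists>c. realizes Ke (snd ?x) c {emb_fm \<phi>}"
  proof -
    obtain a where a: "realizes K (snd x) a {\<phi>}" using ex ..
    have "realizes Ke (snd ?x) (Real a) {emb_fm \<phi>}"
      using a s[of a] Real_in_univ[of a] by (simp add: realizes_def)
    then show ?thesis by (rule exI)
  qed
  ultimately obtain c where c: "c \<in> N" "realizes Ke (snd ?x) c {emb_fm \<phi>}"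
    using N.witness[of "emb_fm \<phi>" ?x] by metis
  have "c \<in> univ Ke" "srt Ke c = Inl (snd x)" using c(2) by (simp_all add: realizes_def)
  from eq_univ_real[OF this] obtain a where a: "a \<in> U" "c = Real a" "srt K a = snd x" by metis
  then have "realizes K (snd x) a {\<phi>}" using c(2) s[of a] by (simp add: realizes_def)
  then show "\<exists>a\<in>{a. Real a \<in> N}. realizes K (snd x) a {\<phi>}" using c(1) a(2) by auto
qed

text \<open>The class of a tuple from \<open>N\<close> is a value of a quotient map, under which
  \<open>N\<close> is closed. Conversely, for a class \<open>c\<close> in \<open>N\<close> the
  sentence saying that \<open>c\<close> has a representative is true in the whole structure, hence
  in \<open>N\<close>, so \<open>c\<close> has a representative with entries in
  \<open>N\<close>.\<close>

lemma eq_univ_tarski_vaught: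
  assumes "tarski_vaught Le Ke N"
  shows "eq_univ L K {a. Real a \<in> N} = N"
proof
  interpret N: tarski_vaught Le Ke N by (rule assms)
  show "eq_univ L K {a. Real a \<in> N} \<subseteq> N"
  proof
    fix c assume "c \<in> eq_univ L K {a. Real a \<in> N}"
    then consider a where "c = Real a" "Real a \<in> N"
      | i as where "c = Class i (irel K i `` {as})" "i \<in> isorts L K" "as \<in> tuples K (fst i)" "set as \<subseteq> {a. Real a \<in> N}"
      unfolding eq_univ_def by blast
    then show "c \<in> N"
    proof cases
      case 1
      then show ?thesis by simp
    next
      case 2
      have "fint Ke (Inr i) (map Real as) \<in> N"
      proof (rule N.closed_fint)
        show "Inr i \<in> funs Le" using 2(2) by (simp add: InrI)
        have "map (srt K) as = fst i" "set as \<subseteq> U" using 2(3) by (simp_all add: tuples_def)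
        have "map (srt Ke) (map Real as) = map Inl (map (srt K) as)" by simp
        then have "map (srt Ke) (map Real as) = fdom Le (Inr i)"
          unfolding \<open>map (srt K) as = fst i\<close> by simp
        moreover have "set (map Real as) \<subseteq> univ Ke" using \<open>set as \<subseteq> U\<close> Real_in_univ by auto
        ultimately show "map Real as \<in> tuples Ke (fdom Le (Inr i))" by (simp only: tuples_def mem_Collect_eq simp_thms)
        show "set (map Real as) \<subseteq> N" using 2(4) by auto
      qed
      then show ?thesis using 2(1) by (simp add: o_def)
    qed
  qed
  show "N \<subseteq> eq_univ L K {a. Real a \<in> N}"
  proof
    fix c assume c: "c \<in> N"
    then have cU: "c \<in> univ Ke" using N.N_sub by (rule subsetD[rotated])
    show "c \<in> eq_univ L K {a. Real a \<in> N}"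
    proof (cases c)
      case (Real a)
      then show ?thesis using c by (simp add: eq_univ_def)
    next
      case (Class i X)
      from imag_of_surj[OF cU] obtain as where as: "as \<in> tuples K (fst i)" "imag_of K (Inr i) as = c" "Inr i \<in> sorts Le"
        using Class by (metis eq_simps(11) imag_of.simps(2) sort_list.simps(2))
      have i: "i \<in> isorts L K" using as(3) by auto
      define ws where "ws = map (\<lambda>k. (k :: nat, Inl (fst i ! k) :: 's + ('f, 'r, 's, 'a) isort)) [0..<length (fst i)]"
      have "map snd ws = map Inl (map ((!) (fst i)) [0..<length (fst i)])"
        by (simp add: ws_def o_def del: map_nth)
      then have ws: "map snd ws = map Inl (fst i)" unfolding map_nth .
      have sws: "snd ` set ws \<subseteq> sorts Le"
        using arg_cong[OF ws, of set] isorts_sorts[OF i] by auto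
      let ?E = "Eq (Par c) (Fn (Inr i) (map Var ws))"
      have srtc: "srt Ke c = Inr i" using Class by simp
      have wfE: "wf_fm Le (srt Ke) ?E"
      proof -
        have "map (tm_srt Le (srt Ke)) (map Var ws) = fdom Le (Inr i)" using ws by (simp add: o_def)
        moreover have "\<forall>t\<in>set (map Var ws). wf_tm Le (srt Ke) t" using sws by auto
        moreover have "Inr i \<in> funs Le" using i by (simp add: InrI)
        ultimately have "wf_tm Le (srt Ke) (Fn (Inr i) (map Var ws))" by (simp only: wf_tm.simps simp_thms)
        then show ?thesis using as(3) srtc by simp
      qed
      have fvE: "fv (exs ws ?E) = {}" by (simp add: fv_exs)
      have wfX: "wf_fm Le (srt Ke) (exs ws ?E)" using wfE sws by (simp only: wf_exs simp_thms)
      define e where "e = (\<lambda>v :: nat \<times> ('s + ('f, 'r, 's, 'a) isort). (Real (as ! fst v) :: ('f, 'r, 's, 'a) imag))"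
      have len: "length as = length (fst i)" using as(1) by (auto simp: tuples_def dest: arg_cong[where f=length])
      have m: "map e ws = map Real as"
        by (rule nth_equalityI) (simp_all add: e_def ws_def len)
      have "sat Ke e (exs ws ?E)" unfolding sat_exs
      proof (rule exI[of _ e], intro conjI)
        show "assigns Ke (set ws) e" unfolding assigns_def
        proof
          fix w assume "w \<in> set ws"
          then obtain k where k: "k < length as" "w = (k, Inl (fst i ! k))" by (auto simp: ws_def len)
          have "map (srt K) as = fst i" using as(1) by (simp add: tuples_def)
          from arg_cong[OF this, of "\<lambda>l. l ! k"] have "srt K (as ! k) = fst i ! k" using k(1) by simp
          moreover have "as ! k \<in> U" using as(1) k(1) by (auto simp: tuples_def)
          then have "Real (as ! k) \<in> univ Ke" unfolding Real_in_univ .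
          ultimately show "e w \<in> univ Ke \<and> srt Ke (e w) = snd w" by (simp add: e_def k(2))
        qed
        have "map the_real (map e ws) = as" unfolding m by (simp add: o_def)
        then have "map (\<lambda>x. the_real (e x)) ws = as" by (simp add: o_def)
        then show "sat Ke e ?E" using as(2) by (simp add: o_def)
      qed simp
      moreover have "sat (Ke\<lparr>univ := N\<rparr>) e (exs ws ?E) \<longleftrightarrow> sat Ke e (exs ws ?E)"
      proof (rule N.sat_submodel[OF wfX])
        show "pars (exs ws ?E) \<subseteq> N" using c by (simp add: pars_exs)
        show "e v \<in> N \<and> srt Ke (e v) = snd v" if "v \<in> fv (exs ws ?E)" for v
          using that unfolding fvE by simp
      qed
      ultimately have "sat (Ke\<lparr>univ := N\<rparr>) e (exs ws ?E)" by (simp only:)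
      then obtain e' where e': "assigns (Ke\<lparr>univ := N\<rparr>) (set ws) e'" "sat (Ke\<lparr>univ := N\<rparr>) e' ?E"
        unfolding sat_exs by (elim exE conjE)
      have real: "\<exists>b\<in>U. e' w = Real b \<and> Inl (srt K b) = snd w \<and> Real b \<in> N" if w: "w \<in> set ws" for w
      proof -
        have w1: "e' w \<in> N" "srt Ke (e' w) = snd w" using e'(1) w by (simp_all add: assigns_def)
        obtain s where "snd w = Inl s" using w by (auto simp: ws_def)
        then have "srt Ke (e' w) = Inl s" using w1(2) by simp
        from eq_univ_real[OF subsetD[OF N.N_sub w1(1)] this] show ?thesis using w1(1) \<open>snd w = Inl s\<close> by auto
      qed
      define bs where "bs = map (\<lambda>w. the_real (e' w)) ws"
      have "map (srt K) bs = fst i"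
      proof -
        have "Inl (srt K (the_real (e' w))) = snd w" if "w \<in> set ws" for w
          using real[OF that] by (elim bexE conjE) simp
        then have "map Inl (map (srt K) bs) = map snd ws" by (simp add: bs_def)
        then show ?thesis unfolding ws by (simp add: inj_map_eq_map del: map_map)
      qed
      moreover have "the_real (e' w) \<in> U \<and> Real (the_real (e' w)) \<in> N" if "w \<in> set ws" for w
        using real[OF that] by (elim bexE conjE) simp
      then have bs: "set bs \<subseteq> U" "set bs \<subseteq> {a. Real a \<in> N}" by (auto simp: bs_def)
      moreover have "c = Class i (irel K i `` {bs})"
        using e'(2) by (simp add: o_def bs_def)
      ultimately have "c = Class i (irel K i `` {bs}) \<and> i \<in> isorts L K \<and> bs \<in> tuples K (fst i) \<and>
          set bs \<subseteq> {a. Real a \<in> N}" using i by (simp add: tuples_def)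
      then show ?thesis unfolding eq_univ_def by (intro UnI2 CollectI exI)
    qed
  qed
qed

end

section \<open>Independent families\<close>

text \<open>\<open>t\<close> is a schedule: if \<open>t n = Some i\<close>, then stage
  \<open>n\<close> adds a realization \<open>b n\<close> of \<open>p i\<close>, generic over the set
  \<open>C n\<close> of \<open>A\<close> and everything added before; at \<open>None\<close> nothing
  is added, as the total number of realizations may be finite.\<close>

locale independent_family = small_base L K \<kappa> A
  for L :: "('f, 'r, 's) language" and K :: "('f, 'r, 's, 'a) struct" and \<kappa> :: "'k rel"
    and A :: "'a set" +
  fixes I s p and t :: "nat \<Rightarrow> 'i option" and C b
  assumes stable_p: "i \<in> I \<Longrightarrow> stable (s i) (p i)"
    and orthogonal_p: "i \<in> I \<Longrightarrow> j \<in> I \<Longrightarrow> i \<noteq> j \<Longrightarrow> orthogonal L K (s i) (p i) (s j) (p j)"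
    and t_in: "t n = Some i \<Longrightarrow> i \<in> I"
    and C_0: "C 0 = A" and C_None: "t n = None \<Longrightarrow> C (Suc n) = C n"
    and C_Some: "t n = Some i \<Longrightarrow> C (Suc n) = insert (b n) (C n)"
    and b_real: "t n = Some i \<Longrightarrow> realizes K (s i) (b n) (restr (p i) (C n))"
    and base_C: "base (C n)"
begin

lemma C_mono: "m \<le> n \<Longrightarrow> C m \<subseteq> C n"
proof (rule lift_Suc_mono_le[of C])
  show "C n \<subseteq> C (Suc n)" for n
    using C_None[of n] C_Some[of n] by (cases "t n") auto
qed

text \<open>Isolation over a stage would descend to the previous one. The exchange of
  \<open>b n\<close> and \<open>a\<close> that this requires is symmetry if the two types are the
  same, and orthogonality otherwise.\<close>

lemma not_isolated_C:
  assumes i: "i \<in> I" and ni: "\<not> isolated K (s i) (restr (p i) A)"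
  shows "\<not> isolated K (s i) (restr (p i) (C n))"
proof (induction n)
  case 0
  then show ?case using ni C_0 by simp
next
  case (Suc n)
  show ?case
  proof (cases "t n")
    case None
    then show ?thesis using Suc C_None by simp
  next
    case (Some j)
    have j: "j \<in> I" by (rule t_in[OF Some])
    have b: "realizes K (s j) (b n) (restr (p j) (C n))" by (rule b_real[OF Some])
    show ?thesis
    proof
      assume "isolated K (s i) (restr (p i) (C (Suc n)))"
      then have iso: "isolated K (s i) (restr (p i) (insert (b n) (C n)))" using C_Some[OF Some] by simp
      have "isolated K (s i) (restr (p i) (C n))"
      proof (rule isolated_descend[OF stable_p[OF i] stable_p[OF j] base_C b _ iso])
        fix a assume a: "realizes K (s i) a (restr (p i) (insert (b n) (C n)))"
        show "realizes K (s j) (b n) (restr (p j) (insert a (C n)))"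
        proof (cases "i = j")
          case True
          then show ?thesis using stable_symmetric[OF stable_p[OF j] base_C b] a by simp
        next
          case False
          show ?thesis
            by (rule orthogonal_commute[OF stable_p[OF i] stable_p[OF j] orthogonal_p[OF i j False] base_C b a])
        qed
      qed
      then show False using Suc by contradiction
    qed
  qed
qed

text \<open>A consistent formula over the union that implies the restriction of \<open>p i\<close>
  belongs to \<open>p i\<close>, since otherwise it would imply its own negation. It then isolates
  the restriction of \<open>p i\<close> to any stage that contains its parameters.\<close>

lemma non_isolating_C:
  assumes ni: "\<And>i. i \<in> I \<Longrightarrow> \<not> isolated K (s i) (restr (p i) A)"
  shows "non_isolating I s (\<lambda>i. restr (p i) (\<Union>n. C n)) (\<Union>n. C n)"
  unfolding non_isolating_def
proof (intro ballI impI)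
  let ?C = "\<Union>n. C n"
  have CU: "?C \<subseteq> U" using base_sub[OF base_C] by auto
  fix i \<phi> assume i: "i \<in> I" and \<phi>: "\<phi> \<in> F ?C {(0, s i)}" and ex: "\<exists>a. realizes K (s i) a {\<phi>}"
  show "\<exists>\<chi>\<in>restr (p i) ?C. \<exists>a. realizes K (s i) a {\<phi>} \<and> \<not> sat1 K a \<chi>"
  proof (rule ccontr)
    assume "\<not> ?thesis"
    then have all: "sat1 K a \<chi>" if "\<chi> \<in> restr (p i) ?C" "realizes K (s i) a {\<phi>}" for a \<chi>
      using that by metis
    obtain a where a: "realizes K (s i) a {\<phi>}" using ex ..
    have \<phi>U: "\<phi> \<in> F U {(0, s i)}" using \<phi> CU by (auto simp: Fm_def)
    have par: "pars \<phi> \<subseteq> ?C" using \<phi> by (simp add: Fm_def)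
    have "\<phi> \<in> p i"
    proof (rule ccontr)
      assume "\<phi> \<notin> p i"
      then have "Neg \<phi> \<in> restr (p i) ?C"
        using stable_Neg[OF stable_p[OF i] \<phi>U] par by (simp add: restr_def)
      from all[OF this a] show False using a by (simp add: realizes_def)
    qed
    from finite_subset_chain[OF finite_pars par C_mono] obtain n where n: "pars \<phi> \<subseteq> C n" by auto
    have "isolated K (s i) (restr (p i) (C n))" unfolding isolated_iff
    proof (rule bexI[of _ \<phi>], intro allI impI)
      show "\<phi> \<in> restr (p i) (C n)" using \<open>\<phi> \<in> p i\<close> n by (simp add: restr_def)
      fix a assume a: "realizes K (s i) a {\<phi>}"
      have "sat1 K a \<chi>" if "\<chi> \<in> restr (p i) (C n)" for \<chi>
        by (rule all[OF _ a]) (use that in \<open>auto simp: restr_def\<close>)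
      then show "realizes K (s i) a (restr (p i) (C n))" using a by (simp add: realizes_def)
    qed
    then show False using not_isolated_C[OF i ni[OF i]] by contradiction
  qed
qed

text \<open>The argument \<open>J\<close> allows inductions on the part collected up to a given
  stage.\<close>

definition part :: "'i \<Rightarrow> nat set \<Rightarrow> 'a set" where
  "part i J = b ` {n\<in>J. t n = Some i}"

lemma b_in: "t n = Some i \<Longrightarrow> b n \<in> U" "t n = Some i \<Longrightarrow> m > n \<Longrightarrow> b n \<in> C m"
proof -
  assume t: "t n = Some i"
  show "b n \<in> U" using realizes_U[OF b_real[OF t]] by simp
  show "b n \<in> C m" if "m > n"
    using C_mono[of "Suc n" m] C_Some[OF t] that by auto
qed

lemma part_sub: "part i J \<subseteq> U"
  using b_in(1) by (auto simp: part_def)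

lemma base_part: "base (C n \<union> part i J)"
  by (rule base_Un[OF base_C _ part_sub]) (simp add: part_def)

lemma realizes_Union:
  assumes "\<And>m :: nat. realizes K u a (restr q (X m))" "\<And>m. X m \<subseteq> X (Suc m)"
  shows "realizes K u a (restr q (\<Union>m. X m))"
proof -
  have "sat1 K a \<phi>" if \<phi>: "\<phi> \<in> restr q (\<Union>m. X m)" for \<phi>
  proof -
    have "pars \<phi> \<subseteq> (\<Union>m. X m)" using \<phi> by (simp add: restr_def)
    from finite_subset_chain[OF finite_pars this assms(2)] obtain m where "pars \<phi> \<subseteq> X m" by metis
    then show ?thesis using \<phi> assms(1)[of m] by (simp add: realizes_def restr_def)
  qed
  then show ?thesis using realizes_U[OF assms(1)[of 0]] by (simp add: realizes_def)
qed

text \<open>Realizations of \<open>p i\<close> chosen before stage \<open>n\<close> are in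
  \<open>C n\<close> already. Each later one is generic over a set that contains \<open>C n\<close>
  and the earlier ones, so weak orthogonality lets it join the base of \<open>b n\<close>.\<close>

lemma b_independent:
  assumes n: "t n = Some j" and i: "i \<in> I" "i \<noteq> j"
  shows "realizes K (s j) (b n) (restr (p j) (C n \<union> part i UNIV))"
proof -
  have j: "j \<in> I" by (rule t_in[OF n])
  have *: "realizes K (s j) (b n) (restr (p j) (C n \<union> part i {..<m}))" for m
  proof (induction m)
    case 0
    then show ?case using b_real[OF n] by (simp add: part_def)
  next
    case (Suc m)
    show ?case
    proof (cases "t m = Some i")
      case False
      then have "part i {..<Suc m} = part i {..<m}"
        unfolding part_def by (auto simp: less_Suc_eq)
      then show ?thesis using Suc by simp
    next
      case True
      have ins: "C n \<union> part i {..<Suc m} = insert (b m) (C n \<union> part i {..<m})"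
        using True by (auto simp: part_def less_Suc_eq)
      show ?thesis
      proof (cases "m < n")
        case True
        then have "b m \<in> C n" using b_in(2)[OF \<open>t m = Some i\<close>] by simp
        then show ?thesis using Suc unfolding ins by (simp add: insert_absorb)
      next
        case False
        have "C n \<subseteq> C m" by (rule C_mono) (use False in simp)
        moreover have "part i {..<m} \<subseteq> C m" using b_in(2) by (auto simp: part_def)
        ultimately have "C n \<union> part i {..<m} \<subseteq> C m" by simp
        then have "realizes K (s i) (b m) (restr (p i) (C n \<union> part i {..<m}))"
          by (rule realizes_restr_mono[OF b_real[OF True]])
        then show ?thesis unfolding ins
          by (rule orthogonal_independent[OF stable_p[OF j] stable_p[OF i(1)]
              orthogonal_p[OF j i(1) not_sym[OF i(2)]] base_part Suc])
      qed
    qed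
  qed
  have "realizes K (s j) (b n) (restr (p j) (\<Union>m. C n \<union> part i {..<m}))"
    by (rule realizes_Union[of _ _ _ "\<lambda>m. C n \<union> part i {..<m}", OF *]) (auto simp: part_def)
  moreover have "C n \<union> part i UNIV \<subseteq> (\<Union>m. C n \<union> part i {..<m})"
    by (auto simp: part_def)
  ultimately show ?thesis by (rule realizes_restr_mono)
qed

text \<open>The other realizations join the base stage by stage. Each of them is generic over the
  stage together with all of \<open>part i UNIV\<close>, including what is added to it later, and
  this is what weak orthogonality asks for.\<close>

lemma realizes_C:
  assumes i: "i \<in> I" and a: "realizes K (s i) a (restr (p i) (A \<union> part i UNIV))"
  shows "realizes K (s i) a (restr (p i) (\<Union>n. C n))"
proof -
  have *: "realizes K (s i) a (restr (p i) (C n \<union> part i UNIV))" for n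
  proof (induction n)
    case 0
    then show ?case using a by (simp add: C_0)
  next
    case (Suc n)
    show ?case
    proof (cases "t n")
      case None
      then show ?thesis using Suc C_None by simp
    next
      case (Some j)
      have j: "j \<in> I" by (rule t_in[OF Some])
      have ins: "C (Suc n) \<union> part i UNIV = insert (b n) (C n \<union> part i UNIV)"
        using C_Some[OF Some] by simp
      show ?thesis
      proof (cases "i = j")
        case True
        then have "b n \<in> part i UNIV" using Some by (auto simp: part_def)
        then show ?thesis using Suc unfolding ins by (simp add: insert_absorb)
      next
        case False
        show ?thesis unfolding ins
          by (rule orthogonal_independent[OF stable_p[OF i] stable_p[OF j] orthogonal_p[OF i j False]
              base_part Suc b_independent[OF Some i False]])
      qed
    qed
  qed
  show ?thesis
  proof (rule realizes_Union[of _ _ _ C])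
    show "realizes K (s i) a (restr (p i) (C m))" for m by (rule realizes_restr_mono[OF *[of m]]) simp
    show "C m \<subseteq> C (Suc m)" for m by (rule C_mono) simp
  qed
qed

lemma b_inj:
  assumes i: "i \<in> I" shows "inj_on b {n. t n = Some i}"
proof (rule linorder_inj_onI)
  fix m n assume mn: "m < n" "m \<in> {n. t n = Some i}" "n \<in> {n. t n = Some i}"
  then have "b m \<in> C n" using b_in(2) by simp
  moreover have "b n \<notin> C n" by (rule stable_new[OF stable_p[OF i] base_C b_real]) (use mn in simp)
  ultimately show "b m \<noteq> b n" by metis
qed auto

text \<open>Two maximal sequences bound each other's lengths; the first bound also provides the
  finiteness that the second one needs.\<close>

lemma has_dim_family:
  assumes i: "i \<in> I" and reg: "regular L \<kappa> K (s i) (p i) A"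
    and fin: "finite {n. t n = Some i}" "card {n. t n = Some i} = k"
    and N: "(\<Union>n. C n) \<subseteq> N" and omit: "\<not> (\<exists>a\<in>N. realizes K (s i) a (restr (p i) (\<Union>n. C n)))"
  shows "has_dim K (s i) (p i) A N |{..<k}|"
proof -
  let ?J = "{n. t n = Some i}" and ?B = "part i UNIV"
  have B: "?B = b ` ?J" by (simp add: part_def)
  \<comment> \<open>The chosen realizations are indexed by themselves, ordered by the stage at which
    they were added.\<close>
  define rk where "rk = the_inv_into ?J b"
  have rk: "rk (b n) = n" if "t n = Some i" for n
    unfolding rk_def by (rule the_inv_into_f_f[OF b_inj[OF i]]) (use that in simp)
  define \<alpha> where "\<alpha> = rank_order rk less_than ?B"
  have "inj_on rk ?B" unfolding B by (auto simp: inj_on_def rk)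
  then have wo: "Well_order \<alpha>" unfolding \<alpha>_def
    by (rule Well_order_rank_order) (simp_all add: total_less_than trans_less_than)
  have F\<alpha>: "Field \<alpha> = ?B" by (simp add: \<alpha>_def)
  have irr: "irrefl less_than" by (simp add: irrefl_def)
  have ms: "morley_seq K (s i) (p i) A \<alpha> id" unfolding morley_seq_def F\<alpha>
  proof (intro conjI ballI)
    show "well_order_on ?B \<alpha>" using wo unfolding F\<alpha> .
    fix x assume x: "x \<in> ?B"
    then obtain n where n: "t n = Some i" "x = b n" by (auto simp: part_def)
    have "underS \<alpha> x \<subseteq> C n"
      unfolding \<alpha>_def underS_rank_order[OF irr x] using b_in(2) n rk by (auto simp: part_def)
    moreover have "A \<subseteq> C n" using C_mono[of 0 n] C_0 by simp
    ultimately have "A \<union> id ` underS \<alpha> x \<subseteq> C n" by simp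
    then show "realizes K (s i) (id x) (restr (p i) (A \<union> id ` underS \<alpha> x))"
      using realizes_restr_mono[OF b_real[OF n(1)]] n(2) by simp
  qed
  have BN: "?B \<subseteq> N"
  proof
    fix x assume "x \<in> ?B"
    then obtain n where "t n = Some i" "x = b n" by (auto simp: part_def)
    then have "x \<in> C (Suc n)" using b_in(2) by simp
    then show "x \<in> N" using N by auto
  qed
  have max: "maximal_morley_seq_in K (s i) (p i) A N \<alpha> id"
    unfolding maximal_morley_seq_in_def F\<alpha>
    using ms BN omit realizes_C[OF i] by auto
  have fB: "finite (Field \<alpha>)" unfolding F\<alpha> B using fin(1) by simp
  have cB: "card (Field \<alpha>) = k" unfolding F\<alpha> B using fin(2) card_image[OF b_inj[OF i]] by simp
  show ?thesis unfolding has_dim_def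
  proof (intro conjI exI allI impI)
    show "maximal_morley_seq_in K (s i) (p i) A N \<alpha> id" by (rule max)
    fix \<beta> :: "'a rel" and a assume \<beta>: "maximal_morley_seq_in K (s i) (p i) A N \<beta> a"
    then have m\<beta>: "morley_seq K (s i) (p i) A \<beta> a" "a ` Field \<beta> \<subseteq> N"
      by (simp_all add: maximal_morley_seq_in_def)
    have 1: "finite (Field \<beta>)" "card (Field \<beta>) \<le> card (Field \<alpha>)"
      using maximal_morley_card_le[OF stable_p[OF i] reg max fB m\<beta>] by simp_all
    have "card (Field \<alpha>) \<le> card (Field \<beta>)"
      using maximal_morley_card_le[OF stable_p[OF i] reg \<beta> 1(1) ms] BN F\<alpha> by simp
    then have "card (Field \<beta>) = card {..<k}" using 1(2) cB by simp
    then obtain h where "bij_betw h (Field \<beta>) {..<k}"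
      using finite_same_card_bij[OF 1(1) finite_lessThan] by metis
    then show "|Field \<beta>| =o |{..<k}|" using card_of_ordIso by metis
  qed
qed

end

context small_base
begin

lemma independent_family_exists:
  assumes st: "\<And>i. i \<in> I \<Longrightarrow> stable (s i) (p i)"
    and orth: "\<And>i j. i \<in> I \<Longrightarrow> j \<in> I \<Longrightarrow> i \<noteq> j \<Longrightarrow> orthogonal L K (s i) (p i) (s j) (p j)"
    and t: "\<And>n i. t n = Some i \<Longrightarrow> i \<in> I"
  obtains C b where "independent_family L K \<kappa> A I s p t C b"
proof -
  define Q where "Q = (\<lambda>n X Y. case t n of None \<Rightarrow> Y = X
    | Some i \<Rightarrow> \<exists>c. realizes K (s i) c (restr (p i) X) \<and> Y = insert c X)"
  have "\<exists>C. \<forall>n. (base (C n) \<and> (n = 0 \<longrightarrow> C n = A)) \<and> Q n (C n) (C (Suc n))"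
  proof (rule dependent_nat_choice)
    show "\<exists>X. base X \<and> (0 = (0 :: nat) \<longrightarrow> X = A)"
      using countable_A A_sub by (intro exI[of _ A]) (simp add: base_def)
    fix X and n :: nat assume X: "base X \<and> (n = 0 \<longrightarrow> X = A)"
    show "\<exists>Y. (base Y \<and> (Suc n = 0 \<longrightarrow> Y = A)) \<and> Q n X Y"
    proof (cases "t n")
      case None
      then show ?thesis using X by (intro exI[of _ X]) (simp add: Q_def)
    next
      case (Some i)
      have bX: "base X" using X by simp
      obtain c where c: "realizes K (s i) c (restr (p i) X)"
        using stable_realized[OF st[OF t[OF Some]] bX] ..
      have "base (insert c X)" by (rule base_insert[OF bX]) (use realizes_U[OF c] in simp)
      then show ?thesis using c Some by (intro exI[of _ "insert c X"]) (auto simp: Q_def)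
    qed
  qed
  then obtain C where C: "\<forall>n. (base (C n) \<and> (n = 0 \<longrightarrow> C n = A)) \<and> Q n (C n) (C (Suc n))" ..
  have base: "base (C n)" and C0: "C 0 = A" and Q: "Q n (C n) (C (Suc n))" for n using C by simp_all
  \<comment> \<open>The recursion yields only the sets \<open>C n\<close>; the elements added are
    read off afterwards.\<close>
  define b where "b = (\<lambda>n. SOME c. realizes K (s (the (t n))) c (restr (p (the (t n))) (C n)) \<and> C (Suc n) = insert c (C n))"
  have b: "realizes K (s i) (b n) (restr (p i) (C n)) \<and> C (Suc n) = insert (b n) (C n)" if "t n = Some i" for n i
  proof -
    have "\<exists>c. realizes K (s (the (t n))) c (restr (p (the (t n))) (C n)) \<and> C (Suc n) = insert c (C n)"
      using Q[of n] that by (simp add: Q_def)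
    from someI_ex[OF this] show ?thesis using that by (simp add: b_def)
  qed
  have "independent_family L K \<kappa> A I s p t C b"
  proof
    show "C (Suc n) = C n" if "t n = None" for n using Q[of n] that by (simp add: Q_def)
  qed (use st orth t base C0 b in simp_all)
  then show ?thesis by (rule that)
qed

end

theorem theorem4:
  fixes L :: "('f, 'r, 's) language"
    and T :: "('f, 'r, 's, 'a) formula set"
    and \<kappa> :: "'k rel"
    and M :: "('f, 'r, 's, 'a) struct"
    and A :: "'a set"
    and I :: "'i set"
    and s :: "'i \<Rightarrow> 's + ('f, 'r, 's, 'a) isort"
    and p :: "'i \<Rightarrow> ('f + ('f, 'r, 's, 'a) isort, 'r, 's + ('f, 'r, 's, 'a) isort,
                     ('f, 'r, 's, 'a) imag) formula set"
    and f :: "'i \<Rightarrow> nat"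
  assumes "is_language L" and "countable_language L"
    and "complete_theory L T"
    and "monster_model L T \<kappa> M"
    and "A \<subseteq> univ M" and "countable A"
    and "countable I"
    and "\<And>i j. i \<in> I \<Longrightarrow> j \<in> I \<Longrightarrow> i \<noteq> j \<Longrightarrow>
           orthogonal (eq_language L M) (eq_struct L M) (s i) (p i) (s j) (p j)"
    and "\<And>i. i \<in> I \<Longrightarrow> generically_stable (eq_language L M) \<kappa> (eq_struct L M) (s i) (p i)"
    and "\<And>i. i \<in> I \<Longrightarrow> regular (eq_language L M) \<kappa> (eq_struct L M) (s i) (p i) (Real ` A)"
    and "\<And>i. i \<in> I \<Longrightarrow> \<not> isolated (eq_struct L M) (s i) (restr (p i) (Real ` A))"
  shows "\<exists>N. elementary_submodel L M N \<and> countable N \<and> A \<subseteq> N \<and>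
           (\<forall>i\<in>I. has_dim (eq_struct L M) (s i) (p i) (Real ` A) (eq_univ L M N)
                     |{..<f i}| )"
proof -
  interpret M: saturated_structure L M \<kappa>
    by unfold_locales (use assms(1,2,4) in \<open>auto simp: monster_model_def model_of_def\<close>)
  interpret E: saturated_structure M.Le M.Ke \<kappa> by (rule M.saturated_structure_eq)
  have AU: "Real ` A \<subseteq> univ M.Ke" using assms(5) M.Real_in_univ by auto
  interpret E: small_base M.Le M.Ke \<kappa> "Real ` A"
    by unfold_locales (use assms(6) AU in simp_all)
  have st: "E.stable (s i) (p i)" if "i \<in> I" for i
    using assms(9,10)[OF that] by (simp add: E.stable_def regular_def)
  define J where "J = (SIGMA i:I. {..<f i})"
  have J: "countable J" unfolding J_def using assms(7) by (intro countable_SIGMA) simp_all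
  define t where "t = (\<lambda>n. if n \<in> to_nat_on J ` J then Some (fst (from_nat_into J n)) else None)"
  have t_img: "t (to_nat_on J x) = Some (fst x)" if "x \<in> J" for x
    using that J by (simp add: t_def)
  have tJ: "\<exists>x\<in>J. n = to_nat_on J x \<and> i = fst x" if "t n = Some i" for n i
    using that J by (auto simp: t_def split: if_splits)
  have tI: "i \<in> I" if "t n = Some i" for n i using tJ[OF that] by (auto simp: J_def)
  have fib: "{n. t n = Some i} = to_nat_on J ` ({i} \<times> {..<f i})" if "i \<in> I" for i
  proof
    show "{n. t n = Some i} \<subseteq> to_nat_on J ` ({i} \<times> {..<f i})"
    proof
      fix n assume "n \<in> {n. t n = Some i}"
      then obtain x where x: "x \<in> J" "n = to_nat_on J x" "i = fst x" using tJ[of n i] by auto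
      then have "x \<in> {i} \<times> {..<f i}" by (auto simp: J_def)
      then show "n \<in> to_nat_on J ` ({i} \<times> {..<f i})" using x(2) by simp
    qed
    show "to_nat_on J ` ({i} \<times> {..<f i}) \<subseteq> {n. t n = Some i}"
    proof
      fix n assume "n \<in> to_nat_on J ` ({i} \<times> {..<f i})"
      then obtain x where x: "x \<in> {i} \<times> {..<f i}" "n = to_nat_on J x" by auto
      then have "x \<in> J" "fst x = i" using that by (auto simp: J_def)
      then show "n \<in> {n. t n = Some i}" using t_img[of x] x(2) by simp
    qed
  qed
  have cfib: "card {n. t n = Some i} = f i" "finite {n. t n = Some i}" if "i \<in> I" for i
  proof -
    have "{i} \<times> {..<f i} \<subseteq> J" using that by (auto simp: J_def)
    then have "inj_on (to_nat_on J) ({i} \<times> {..<f i})" by (rule inj_on_subset[OF inj_on_to_nat_on[OF J]])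
    then show "card {n. t n = Some i} = f i" unfolding fib[OF that] by (simp add: card_image card_cartesian_product)
    show "finite {n. t n = Some i}" unfolding fib[OF that] by simp
  qed
  obtain C b where "independent_family M.Le M.Ke \<kappa> (Real ` A) I s p t C b"
    by (rule E.independent_family_exists[of I s p t]) (use st assms(8) tI that in auto)
  then interpret D: independent_family M.Le M.Ke \<kappa> "Real ` A" I s p t C b .
  let ?C = "\<Union>n. C n"
  have C: "countable ?C" "?C \<subseteq> univ M.Ke" using D.base_C by (auto simp: E.base_def)
  have AC: "Real ` A \<subseteq> ?C" using D.C_0 by auto
  have ni: "E.non_isolating I s (\<lambda>i. restr (p i) ?C) ?C" by (rule D.non_isolating_C[OF assms(11)])
  have PF: "\<forall>i\<in>I. restr (p i) ?C \<subseteq> Fm M.Le (srt M.Ke) ?C {(0, s i)}"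
  proof
    fix i assume i: "i \<in> I"
    show "restr (p i) ?C \<subseteq> Fm M.Le (srt M.Ke) ?C {(0, s i)}"
    proof
      fix \<phi> assume "\<phi> \<in> restr (p i) ?C"
      then have "\<phi> \<in> p i" "pars \<phi> \<subseteq> ?C" by (simp_all add: restr_def)
      then show "\<phi> \<in> Fm M.Le (srt M.Ke) ?C {(0, s i)}"
        using Fm_pars[OF E.global_type_Fm[OF E.stableD(1)[OF st[OF i]]]] by simp
    qed
  qed
  have so: "\<forall>i\<in>I. s i \<in> sorts M.Le" using E.stableD(4)[OF st] by simp
  from E.omitting_types[OF ni PF so assms(7) C]
  obtain N where N: "countable N" "?C \<subseteq> N" "tarski_vaught M.Le M.Ke N"
    "\<forall>i\<in>I. \<not> (\<exists>a\<in>N. realizes M.Ke (s i) a (restr (p i) ?C))" by (elim exE conjE)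
  \<comment> \<open>The model sought consists of the real elements of \<open>N\<close>; its
    imaginaries make up exactly \<open>N\<close>.\<close>
  let ?N = "{a. Real a \<in> N}"
  interpret TV: tarski_vaught L M ?N by (rule M.tarski_vaught_real[OF N(3)])
  have eN: "eq_univ L M ?N = N" by (rule M.eq_univ_tarski_vaught[OF N(3)])
  have "?N \<subseteq> the_real ` N" by force
  then have "countable ?N" using N(1) by (meson countable_image countable_subset)
  moreover have "A \<subseteq> ?N" using AC N(2) by auto
  moreover have "has_dim M.Ke (s i) (p i) (Real ` A) (eq_univ L M ?N) |{..<f i}|" if i: "i \<in> I" for i
    unfolding eN by (rule D.has_dim_family[OF i assms(10)[OF i] cfib(2,1)[OF i] N(2)]) (use N(4) i in simp)
  ultimately show ?thesis using TV.elementary by (intro exI[of _ ?N]) simp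
qed

end
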